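(* Let $F=\mathbb{Q}(\sqrt d)$ be an imaginary quadratic field of class number $1$, and let $L$ be an even Hermitian lattice of signature $(1,n)$ over $\mathcal{O}_F$, $n>1$. If $I\subset L$ is a rank 1 primitive isotropic sublattice which is irregular (or semi-irregular, where indicated) with respect to the discriminant kernel $\Gamma=\widetilde{\mathrm{U}}(L)$, then, up to multiplication by $\mathcal{O}_F^\times$, $\mathrm{div}(I)$ is one of the values below and $A_L$ is isomorphic as an $\mathcal{O}_F$-module to one of the modules listed for that value, for some non-negative integers $a,b$. (A) $F=\mathbb{Q}(\sqrt{-1})$, $\eta=1+\sqrt{-1}$. (A1) $I$ irregular with index 2; the modules are $a\cdot\eta\oplus b\cdot\eta^2\oplus\eta^c$ or $a\cdot\eta\oplus b\cdot\eta^2\oplus\eta^{d_1}\oplus\eta^{d_2}$, where - $\mathrm{div}(I)\equiv1$: $c\in\{3,4,5,6\}$, $(d_1,d_2)\in\{(3,3),(3,4),(3,5)\}$; - $\mathrm{div}(I)\equiv1+\sqrt{-1}$: $c\in\{4,5,6,7,8\}$, $(d_1,d_2)\in\{(1,7),(3,3),(3,4),(3,5),(3,6),(3,7),(4,4),(4,5),(4,6),(5,5)\}$; - $\mathrm{div}(I)\equiv2$: $c\in\{6,7,8,9,10\}$, $(d_1,d_2)\in\{(3,5),(3,6),(3,7),(3,8),(4,4),(4,5),(4,6),(4,7),(4,8),(5,5),(5,6),(5,7),(6,6)\}$. (A2) $I$ semi-irregular with index 2, or irregular with index 4: $\mathrm{div}(I)\equiv1+\sqrt{-1}$ and the modules are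 $a\cdot\eta\oplus\eta^c$ with $c\in\{5,6,7\}$, or $a\cdot\eta\oplus\eta^{d_1}\oplus\eta^{d_2}$ with $(d_1,d_2)\in\{(1,6),(2,4),(2,5),(2,6),(3,3),(3,4),(3,5),(4,4)\}$. (B) $F=\mathbb{Q}(\sqrt{-2})$, $\eta=\sqrt{-2}$, $I$ irregular with index 2; the modules are $a\cdot\eta\oplus b\cdot\eta^2\oplus\eta^c$ or $a\cdot\eta\oplus b\cdot\eta^2\oplus\eta^{d_1}\oplus\eta^{d_2}$, where - $\mathrm{div}(I)\equiv1/\sqrt{-2}$: $c\in\{3,4,5,6\}$, $(d_1,d_2)\in\{(3,3),(3,4),(3,5)\}$; - $\mathrm{div}(I)\equiv1$: $c\in\{4,5,6,7,8\}$, $(d_1,d_2)\in\{(2,7),(3,3),(3,4),(3,5),(3,6),(3,7),(4,4),(4,5),(4,6),(5,5)\}$; - $\mathrm{div}(I)\equiv\sqrt{-2}$: $c\in\{6,7,8,9,10\}$, $(d_1,d_2)\in\{(3,5),(3,6),(3,7),(3,8),(4,4),(4,5),(4,6),(4,7),(4,8),(5,5),(5,6),(5,7),(6,6)\}$; - $\mathrm{div}(I)\equiv2$: $c\in\{6,7,8,9,10,11,12\}$, $(d_1,d_2)\in\{(1,11),(3,7),(3,8),(3,9),(3,10),(3,11),(4,6),(4,7),(4,8),(4,9),(4,10),(5,5),(5,6),(5,7),(5,8),(5,9),(6,6),(6,7),(6,8),(7,7)\}$. (C) $F=\mathbb{Q}(\sqrt{-3})$, $\eta=\sqrt{-3}$,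 $\delta=2$. (C1) $I$ irregular with index 2: - $\mathrm{div}(I)\equiv1/\sqrt{-3}$: $a\cdot\delta$; - $\mathrm{div}(I)\equiv1$: $a\cdot\delta\oplus\eta^2$, $a\cdot\delta\oplus2\cdot\eta$; - $\mathrm{div}(I)\equiv2/\sqrt{-3}$: $a\cdot\delta\oplus\delta^c$ with $c\in\{0,2,3\}$, $a\cdot\delta\oplus2\cdot\delta^2$; - $\mathrm{div}(I)\equiv2$: $a\cdot\delta\oplus\eta^2$, $a\cdot\delta\oplus2\cdot\eta^2$, $a\cdot\delta\oplus\delta^c\oplus\eta^2$, $a\cdot\delta\oplus\delta^c\oplus2\cdot\eta$, $a\cdot\delta\oplus2\cdot\delta^2\oplus\eta^2$, $a\cdot\delta\oplus2\cdot\delta^2\oplus2\cdot\eta$, with $c\in\{2,3\}$. (C2) $I$ irregular with index 3: - $\mathrm{div}(I)\equiv1/\sqrt{-3}$: $a\cdot\delta$; - $\mathrm{div}(I)\equiv1$: $a\cdot\eta\oplus b\cdot\eta^2\oplus\eta^c$ with $c\in\{0,3,4\}$, $a\cdot\eta\oplus b\cdot\eta^2\oplus2\cdot\eta^3$; - $\mathrm{div}(I)\equiv\sqrt{-3}$: $a\cdot\eta\oplus b\cdot\eta^2\oplus\eta^c$ with $c\in\{0,3,4,5,6\}$, $a\cdot\eta\oplus b\cdot\eta^2\oplus2\cdot\eta^3$, $a\cdot\eta\oplus b\cdot\eta^2\oplus\eta^3\oplus\eta^{d'}$ with $d'\in\{4,5\}$. (C3) $I$ irregular with index 6: - $\mathrm{div}(I)\equiv1/\sqrt{-3}$: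 $A_L=0$; - $\mathrm{div}(I)\equiv1$: $\eta^2$, $2\cdot\eta$. (D) $F=\mathbb{Q}(\sqrt{-7})$, $\eta_1=(1+\sqrt{-7})/2$, $\eta_2=(-1+\sqrt{-7})/2$, $\delta=\sqrt{-7}$, $I$ irregular with index 2: - $\mathrm{div}(I)\equiv1/\sqrt{-7}$: $a\cdot\eta_1\oplus b\cdot\eta_2$; - $\mathrm{div}(I)\equiv1$: $a\cdot\eta_1\oplus b\cdot\eta_2\oplus\delta^2$, $a\cdot\eta_1\oplus b\cdot\eta_2\oplus2\cdot\delta$; - $\mathrm{div}(I)\equiv\eta_1/\sqrt{-7}$: $(a-2)\cdot\eta_1\oplus a\cdot\eta_2\oplus2\cdot\eta_1^2$, $(a-1)\cdot\eta_1\oplus a\cdot\eta_2\oplus\eta_1^3$, $a\cdot\eta_1\oplus a\cdot\eta_2\oplus\eta_1^2$, $(a+2)\cdot\eta_1\oplus a\cdot\eta_2$; - $\mathrm{div}(I)\equiv\eta_2/\sqrt{-7}$: $(a-2)\cdot\eta_2\oplus a\cdot\eta_1\oplus2\cdot\eta_2^2$, $(a-1)\cdot\eta_2\oplus a\cdot\eta_1\oplus\eta_2^3$, $a\cdot\eta_2\oplus a\cdot\eta_1\oplus\eta_2^2$, $(a+2)\cdot\eta_2\oplus a\cdot\eta_1$; - $\mathrm{div}(I)\equiv\eta_1$: $N\oplus\delta^2$ or $N\oplus2\cdot\delta$, where $N$ is one of $(a-2)\cdot\eta_1\oplus a\cdot\eta_2\oplus2\cdot\eta_1^2$, $(a-1)\cdot\eta_1\oplus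 a\cdot\eta_2\oplus\eta_1^3$, $a\cdot\eta_1\oplus a\cdot\eta_2\oplus\eta_1^2$, $(a+2)\cdot\eta_1\oplus a\cdot\eta_2$; - $\mathrm{div}(I)\equiv\eta_2$: $N\oplus\delta^2$ or $N\oplus2\cdot\delta$, where $N$ is one of $(a-2)\cdot\eta_2\oplus a\cdot\eta_1\oplus2\cdot\eta_2^2$, $(a-1)\cdot\eta_2\oplus a\cdot\eta_1\oplus\eta_2^3$, $a\cdot\eta_2\oplus a\cdot\eta_1\oplus\eta_2^2$, $(a+2)\cdot\eta_2\oplus a\cdot\eta_1$; - $\mathrm{div}(I)\equiv\eta_1\eta_2/\sqrt{-7}$: $(a-2)\cdot\eta_1\oplus(a-2)\cdot\eta_2\oplus2\cdot\eta_1^2\oplus2\cdot\eta_2^2$, $(a-2)\cdot\eta_1\oplus(a-1)\cdot\eta_2\oplus2\cdot\eta_1^2\oplus\eta_2^3$, $(a-2)\cdot\eta_1\oplus a\cdot\eta_2\oplus\eta_1^2\oplus2\cdot\eta_2^2$, $(a-2)\cdot\eta_1\oplus a\cdot\eta_2\oplus2\cdot\eta_1^2\oplus\eta_2^2$, $(a-2)\cdot\eta_1\oplus(a+1)\cdot\eta_2\oplus\eta_1^2\oplus\eta_2^3$, $(a-2)\cdot\eta_1\oplus(a+2)\cdot\eta_2\oplus\eta_1^2\oplus\eta_2^2$, $(a-1)\cdot\eta_1\oplus(a-2)\cdot\eta_2\oplus\eta_1^3\oplus2\cdot\eta_2^2$, $(a-1)\cdot\eta_1\oplus(a-1)\cdot\eta_2\oplus\eta_1^3\oplus\eta_2^3$,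 $(a-1)\cdot\eta_1\oplus a\cdot\eta_2\oplus\eta_1^3\oplus\eta_2^2$, $a\cdot\eta_1\oplus(a-2)\cdot\eta_2\oplus\eta_1^2\oplus2\cdot\eta_2^2$, $a\cdot\eta_1\oplus(a-2)\cdot\eta_2\oplus2\cdot\eta_1^2\oplus\eta_2^2$, $a\cdot\eta_1\oplus(a-1)\cdot\eta_2\oplus\eta_1^2\oplus\eta_2^3$, $a\cdot\eta_1\oplus a\cdot\eta_2\oplus2\cdot\eta_1^2$, $a\cdot\eta_1\oplus a\cdot\eta_2\oplus2\cdot\eta_2^2$, $a\cdot\eta_1\oplus a\cdot\eta_2\oplus\eta_1^2\oplus\eta_2^2$, $a\cdot\eta_1\oplus(a+1)\cdot\eta_2\oplus\eta_2^3$, $a\cdot\eta_1\oplus(a+2)\cdot\eta_2\oplus\eta_1^2$, $a\cdot\eta_1\oplus(a+2)\cdot\eta_2\oplus\eta_2^2$, $(a+1)\cdot\eta_1\oplus(a-2)\cdot\eta_2\oplus\eta_1^3\oplus\eta_2^2$, $(a+1)\cdot\eta_1\oplus a\cdot\eta_2\oplus\eta_1^3$, $(a+2)\cdot\eta_1\oplus(a-2)\cdot\eta_2\oplus\eta_1^2\oplus\eta_2^2$, $(a+2)\cdot\eta_1\oplus a\cdot\eta_2\oplus\eta_1^2$, $(a+2)\cdot\eta_1\oplus a\cdot\eta_2\oplus\eta_2^2$, $(a+2)\cdot\eta_1\oplus(a+2)\cdot\eta_2$; - $\mathrm{div}(I)\equiv\eta_1\eta_2$: $N_1\oplus N_2\oplus\delta^2$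 or $N_1\oplus N_2\oplus2\cdot\delta$, where $N_1$ is one of $(a-2)\cdot\eta_1\oplus2\cdot\eta_1^2$, $(a-1)\cdot\eta_1\oplus\eta_1^3$, $a\cdot\eta_1\oplus\eta_1^2$, $(a+2)\cdot\eta_1$, and $N_2$ is one of $(a-2)\cdot\eta_2\oplus2\cdot\eta_2^2$, $(a-1)\cdot\eta_2\oplus\eta_2^3$, $a\cdot\eta_2\oplus\eta_2^2$, $(a+2)\cdot\eta_2$ (same $a$ in $N_1$ and $N_2$). (E) $F=\mathbb{Q}(\sqrt d)$ with $d\in\{-11,-19,-43,-67,-163\}$, $\eta=\sqrt d$, $\delta=2$, $I$ irregular with index 2: - $\mathrm{div}(I)\equiv1/\sqrt d$: $a\cdot\delta\oplus\eta$; - $\mathrm{div}(I)\equiv2/\sqrt d$: $a\cdot\delta\oplus\delta^c$ with $c\in\{0,2,3\}$, $a\cdot\delta\oplus2\cdot\delta^2$, $a\cdot\delta\oplus\eta^2$, $a\cdot\delta\oplus2\cdot\eta$; - $\mathrm{div}(I)\equiv1$: $a\cdot\delta\oplus\eta^2$, $a\cdot\delta\oplus2\cdot\eta$; - $\mathrm{div}(I)\equiv2$: $a\cdot\delta\oplus\delta^c\oplus\eta^2$, $a\cdot\delta\oplus\delta^c\oplus2\cdot\eta$ with $c\in\{2,3\}$, $a\cdot\delta\oplus2\cdot\delta^2\oplus\eta^2$, $a\cdot\delta\oplus2\cdot\delta^2\oplus2\cdot\eta$.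
   Context: Module notation. For $\eta\in\mathcal{O}_F$ and non-negative integers $m,j$, the symbol $m\cdot\eta^j$ denotes the $\mathcal{O}_F$-module $(\mathcal{O}_F/\eta^j)^{\oplus m}$, and $\eta^j$ alone denotes $\mathcal{O}_F/\eta^j$; in expressions such as $(a-2)\cdot\eta_1$ the multiplicity is understood to be non-negative. Setting. $F=\mathbb{Q}(\sqrt d)$, $d<0$ square-free; $\kappa=1/\sqrt d$ if $d\equiv1\bmod4$ and $\kappa=1/(2\sqrt d)$ if $d\equiv2,3\bmod4$. A Hermitian lattice $(L,\langle\ ,\ \rangle)$ over $\mathcal{O}_F$ carries a non-degenerate Hermitian form $L\times L\to\kappa\mathcal{O}_F$, linear in the first and conjugate linear in the second argument; it is even if $\langle\ell,\ell\rangle\in\mathbb{Z}$ for all $\ell\in L$. $V=L\otimes_{\mathcal{O}_F} F$, $L^\vee=\{v\in V\mid\langle v,w\rangle\in\kappa\mathcal{O}_F\ \forall w\in L\}$, $A_L=L^\vee/L$ (discriminant group), $\mathrm{U}(L)$ is the unitary group scheme, and $\widetilde{\mathrm{U}}(L)=\{g\in\mathrm{U}(L)(\mathbb{Z})\mid g|_{A_L}=\mathrm{id}\}$ is the discriminant kernel. For a rank 1 primitive isotropic sublattice $I=\mathcal{O}_Fe$, $\mathrm{div}(I)\in F$ denotes a generator of the (fractional) principal ideal $\{\langle\ell,e\rangle\mid\ell\in L\}$; it is determined up to $\mathcal{O}_F^\times$, and $\equiv$ means equality up to $\mathcal{O}_F^\times$. Types of $I$ with respect to $\Gamma$. $Z(I)_{\mathbb{Q}}$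 is the group of elements of $\mathrm{U}(L)(\mathbb{Q})$ stabilizing $I\otimes_{\mathcal{O}_F} F$ and acting trivially on $I^\perp\subset V$. Let $\omega$ be a primitive cube root of unity. If $F=\mathbb{Q}(\sqrt{-1})$: $I$ is semi-irregular with index 2 if $-\mathrm{id}\in\Gamma$, $\sqrt{-1}\,\mathrm{id}\notin\Gamma$ and $\sqrt{-1}\,T\in\Gamma$ for some $T\in Z(I)_{\mathbb{Q}}$; irregular with index 4 if $-\mathrm{id},\sqrt{-1}\,\mathrm{id}\notin\Gamma$ and $-\sqrt{-1}\,T\in\Gamma$ for some $T\in Z(I)_{\mathbb{Q}}$; irregular with index 2 if $-\mathrm{id}\notin\Gamma$, $-T\in\Gamma$ for some $T\in Z(I)_{\mathbb{Q}}$, and $I$ is not irregular with index 4. If $F=\mathbb{Q}(\sqrt{-3})$: $I$ is semi-irregular with index 2 if $\omega\,\mathrm{id}\in\Gamma$, $-\mathrm{id}\notin\Gamma$ and $-T\in\Gamma$ for some $T\in Z(I)_{\mathbb{Q}}$; irregular with index 6 if $-\mathrm{id},\omega\,\mathrm{id}\notin\Gamma$ and $-\omega T\in\Gamma$ for some $T\in Z(I)_{\mathbb{Q}}$; irregular with index 3 if $-\mathrm{id},\omega\,\mathrm{id}\notin\Gamma$, $\omega T\in\Gamma$ for some $T\in Z(I)_{\mathbb{Q}}$, and $I$ is not irregular with index 6; irregular with index 2 if $-\mathrm{id}\notin\Gamma$, $-T\in\Gamma$ for some $T\in Z(I)_{\mathbb{Q}}$, and $I$ is neither semi-irregular with index 2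 nor irregular with index 6. For other $F$: $I$ is irregular with index 2 if $-\mathrm{id}\notin\Gamma$ and $-T\in\Gamma$ for some $T\in Z(I)_{\mathbb{Q}}$. *)

theory Defs
  imports
    Complex_Main
    "HOL-Computational_Algebra.Polynomial"
    "HOL-Computational_Algebra.Squarefree"
    "HOL-Algebra.Ideal"
    "HOL-Algebra.Module"
begin

section \<open>Imaginary quadratic fields, as subfields of the complex numbers\<close>

abbreviation rt :: "int \<Rightarrow> complex" where
  "rt d \<equiv> csqrt (of_int d)"

definition quad_set :: "int \<Rightarrow> complex set" where
  "quad_set d = {of_rat a + of_rat b * rt d | a b. True}"

definition complex_subring :: "complex set \<Rightarrow> complex ring" where
  "complex_subring S = \<lparr>carrier = S, mult = (*), one = 1, zero = 0, add = (+)\<rparr>"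

definition quad_field :: "int \<Rightarrow> complex ring" where
  "quad_field d = complex_subring (quad_set d)"

definition ring_of_ints :: "int \<Rightarrow> complex ring" where
  "ring_of_ints d = complex_subring {z \<in> quad_set d. algebraic_int z}"

text \<open>The class number is the number of classes of nonzero integral ideals, where \<open>I\<close> and \<open>J\<close> are
  equivalent if \<open>x I = y J\<close> for some nonzero integers \<open>x\<close>, \<open>y\<close> of the field. \<^const>\<open>card\<close> is zero on
  infinite sets, so class number one does mean that there is exactly one class.\<close>

definition nonzero_ideals :: "int \<Rightarrow> complex set set" where
  "nonzero_ideals d = {I. ideal I (ring_of_ints d) \<and> I \<noteq> {0}}"

definition ideal_equiv :: "int \<Rightarrow> (complex set \<times> complex set) set" where
  "ideal_equiv d = {(I, J). I \<in> nonzero_ideals d \<and> J \<in> nonzero_ideals d \<and>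
     (\<exists>x \<in> carrier (ring_of_ints d) - {0}. \<exists>y \<in> carrier (ring_of_ints d) - {0}.
        (\<lambda>z. x * z) ` I = (\<lambda>z. y * z) ` J)}"

definition class_number :: "int \<Rightarrow> nat" where
  "class_number d = card (nonzero_ideals d // ideal_equiv d)"

definition unit_equiv :: "int \<Rightarrow> complex \<Rightarrow> complex \<Rightarrow> bool" where
  "unit_equiv d x y \<longleftrightarrow> (\<exists>u \<in> Units (ring_of_ints d). x = u * y)"

definition kappa :: "int \<Rightarrow> complex" where
  "kappa d = (if d mod 4 = 1 then 1 / rt d else 1 / (2 * rt d))"

definition kappa_ideal :: "int \<Rightarrow> complex set" where
  "kappa_ideal d = {kappa d * x | x. x \<in> carrier (ring_of_ints d)}"


section \<open>Modules\<close>

definition gen_submodule ::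
  "complex ring \<Rightarrow> (complex, 'v) module \<Rightarrow> 'v set \<Rightarrow> 'v set" where
  "gen_submodule R M S = \<Inter>{N. submodule N R M \<and> S \<subseteq> N}"

text \<open>The multiplicative part of a module record is irrelevant (the locale \<open>module\<close> ignores it)
  and is filled with arbitrary values below.\<close>

definition quotient_module :: "('r, 'v) module \<Rightarrow> 'v set \<Rightarrow> ('r, 'v set) module" where
  "quotient_module M N = \<lparr>carrier = a_rcosets\<^bsub>M\<^esub> N, mult = undefined, one = undefined,
     zero = N, add = (\<lambda>A B. A <+>\<^bsub>M\<^esub> B),
     smult = (\<lambda>r A. \<Union>x\<in>A. N +>\<^bsub>M\<^esub> (r \<odot>\<^bsub>M\<^esub> x))\<rparr>"

definition regular_module :: "'r ring \<Rightarrow> ('r, 'r) module" where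
  "regular_module R = \<lparr>carrier = carrier R, mult = mult R, one = one R, zero = zero R,
     add = add R, smult = mult R\<rparr>"

definition direct_sum :: "('r, 'v) module list \<Rightarrow> ('r, 'v list) module" where
  "direct_sum Ms = \<lparr>carrier = {xs. list_all2 (\<lambda>x M. x \<in> carrier M) xs Ms},
     mult = undefined, one = undefined,
     zero = map zero Ms,
     add = (\<lambda>xs ys. map (\<lambda>(M, x, y). x \<oplus>\<^bsub>M\<^esub> y) (zip Ms (zip xs ys))),
     smult = (\<lambda>r xs. map (\<lambda>(M, x). r \<odot>\<^bsub>M\<^esub> x) (zip Ms xs))\<rparr>"

definition module_isos ::
  "'r ring \<Rightarrow> ('r, 'v) module \<Rightarrow> ('r, 'w) module \<Rightarrow> ('v \<Rightarrow> 'w) set" where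
  "module_isos R M N = {f \<in> iso (add_monoid M) (add_monoid N).
     \<forall>r\<in>carrier R. \<forall>x\<in>carrier M. f (r \<odot>\<^bsub>M\<^esub> x) = r \<odot>\<^bsub>N\<^esub> f x}"

text \<open>A module expression \<open>m\<^sub>1\<cdot>x\<^sub>1 \<oplus> \<dots> \<oplus> m\<^sub>k\<cdot>x\<^sub>k\<close> (where \<open>m\<cdot>x\<close> is the direct sum of \<open>m\<close> copies of the
  ring of integers modulo \<open>x\<close>) is encoded as the list of the pairs \<open>(m\<^sub>i, x\<^sub>i)\<close>. Multiplicities are
  integers so that expressions like \<open>a - 2\<close> are not truncated; an expression with a negative
  multiplicity is isomorphic to nothing.\<close>

type_synonym module_expr = "(int \<times> complex) list"

definition expr_module :: "int \<Rightarrow> module_expr \<Rightarrow> (complex, complex set list) module" where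
  "expr_module d E = direct_sum (concat (map (\<lambda>(m, x). replicate (nat m)
     (quotient_module (regular_module (ring_of_ints d)) (PIdl\<^bsub>ring_of_ints d\<^esub> x))) E))"

definition iso_to_expr :: "int \<Rightarrow> (complex, 'v) module \<Rightarrow> module_expr \<Rightarrow> bool" where
  "iso_to_expr d M E \<longleftrightarrow> (\<forall>(m, x) \<in> set E. 0 \<le> m) \<and>
     module_isos (ring_of_ints d) M (expr_module d E) \<noteq> {}"


section \<open>Hermitian lattices\<close>

text \<open>A Hermitian lattice is given by the \<open>F\<close>-vector space \<open>V = L \<otimes> F\<close> with the \<open>F\<close>-linear extension
  of the form, together with the finitely generated submodule \<open>L\<close> over the ring of integers, which
  spans \<open>V\<close>. Such an \<open>L\<close> is torsion-free, hence projective.\<close>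

definition hermitian_lattice ::
  "int \<Rightarrow> (complex, 'v) module \<Rightarrow> ('v \<Rightarrow> 'v \<Rightarrow> complex) \<Rightarrow> 'v set \<Rightarrow> bool" where
  "hermitian_lattice d V h L \<longleftrightarrow>
     Module.module (quad_field d) V \<and>
     submodule L (ring_of_ints d) V \<and>
     (\<exists>S. finite S \<and> S \<subseteq> carrier V \<and> L = gen_submodule (ring_of_ints d) V S) \<and>
     gen_submodule (quad_field d) V L = carrier V \<and>
     (\<forall>x\<in>carrier V. \<forall>y\<in>carrier V. h x y \<in> quad_set d) \<and>
     (\<forall>x\<in>carrier V. \<forall>y\<in>carrier V. \<forall>z\<in>carrier V. h (x \<oplus>\<^bsub>V\<^esub> y) z = h x z + h y z) \<and>
     (\<forall>a\<in>quad_set d. \<forall>x\<in>carrier V. \<forall>y\<in>carrier V. h (a \<odot>\<^bsub>V\<^esub> x) y = a * h x y) \<and>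
     (\<forall>x\<in>carrier V. \<forall>y\<in>carrier V. h y x = cnj (h x y)) \<and>
     (\<forall>x\<in>L. \<forall>y\<in>L. h x y \<in> kappa_ideal d) \<and>
     (\<forall>x\<in>L. (\<forall>y\<in>L. h x y = 0) \<longrightarrow> x = \<zero>\<^bsub>V\<^esub>)"

definition even_lattice :: "('v \<Rightarrow> 'v \<Rightarrow> complex) \<Rightarrow> 'v set \<Rightarrow> bool" where
  "even_lattice h L \<longleftrightarrow> (\<forall>x\<in>L. h x x \<in> \<int>)"

text \<open>An orthogonal family of vectors of nonzero norm is linearly independent, so a spanning family
  as below is an orthogonal basis and \<open>V\<close> has dimension \<open>p + q\<close>.\<close>

definition has_signature ::
  "int \<Rightarrow> (complex, 'v) module \<Rightarrow> ('v \<Rightarrow> 'v \<Rightarrow> complex) \<Rightarrow> nat \<Rightarrow> nat \<Rightarrow> bool" where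
  "has_signature d V h p q \<longleftrightarrow> (\<exists>b :: nat \<Rightarrow> 'v.
     b ` {..<p + q} \<subseteq> carrier V \<and>
     gen_submodule (quad_field d) V (b ` {..<p + q}) = carrier V \<and>
     (\<forall>i<p + q. \<forall>j<p + q. i \<noteq> j \<longrightarrow> h (b i) (b j) = 0) \<and>
     (\<forall>i<p. Re (h (b i) (b i)) > 0) \<and>
     (\<forall>i\<in>{p..<p + q}. Re (h (b i) (b i)) < 0))"

definition dual_lattice ::
  "int \<Rightarrow> (complex, 'v) module \<Rightarrow> ('v \<Rightarrow> 'v \<Rightarrow> complex) \<Rightarrow> 'v set \<Rightarrow> 'v set" where
  "dual_lattice d V h L = {v \<in> carrier V. \<forall>w\<in>L. h v w \<in> kappa_ideal d}"

definition discriminant_group ::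
  "int \<Rightarrow> (complex, 'v) module \<Rightarrow> ('v \<Rightarrow> 'v \<Rightarrow> complex) \<Rightarrow> 'v set \<Rightarrow> (complex, 'v set) module" where
  "discriminant_group d V h L = quotient_module (V\<lparr>carrier := dual_lattice d V h L\<rparr>) L"

text \<open>The rational points of the unitary group are the isometries of \<open>V\<close>; the integral points are
  those which restrict to automorphisms of \<open>L\<close>. Values outside \<open>V\<close> are unconstrained.\<close>

definition unitary_group_rat ::
  "int \<Rightarrow> (complex, 'v) module \<Rightarrow> ('v \<Rightarrow> 'v \<Rightarrow> complex) \<Rightarrow> ('v \<Rightarrow> 'v) set" where
  "unitary_group_rat d V h = {g \<in> module_isos (quad_field d) V V.
     \<forall>x\<in>carrier V. \<forall>y\<in>carrier V. h (g x) (g y) = h x y}"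

definition unitary_group_int ::
  "int \<Rightarrow> (complex, 'v) module \<Rightarrow> ('v \<Rightarrow> 'v \<Rightarrow> complex) \<Rightarrow> 'v set \<Rightarrow> ('v \<Rightarrow> 'v) set" where
  "unitary_group_int d V h L = {g \<in> unitary_group_rat d V h. g ` L = L}"

definition discriminant_kernel ::
  "int \<Rightarrow> (complex, 'v) module \<Rightarrow> ('v \<Rightarrow> 'v \<Rightarrow> complex) \<Rightarrow> 'v set \<Rightarrow> ('v \<Rightarrow> 'v) set" where
  "discriminant_kernel d V h L = {g \<in> unitary_group_int d V h L.
     \<forall>A \<in> carrier (discriminant_group d V h L). g ` A = A}"


section \<open>Isotropic sublattices of rank one\<close>

definition primitive_isotropic_rank_one ::
  "int \<Rightarrow> (complex, 'v) module \<Rightarrow> ('v \<Rightarrow> 'v \<Rightarrow> complex) \<Rightarrow> 'v set \<Rightarrow> 'v set \<Rightarrow> bool" where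
  "primitive_isotropic_rank_one d V h L I \<longleftrightarrow>
     submodule I (ring_of_ints d) V \<and> I \<subseteq> L \<and>
     (\<exists>e \<in> carrier V - {\<zero>\<^bsub>V\<^esub>}. gen_submodule (quad_field d) V I = gen_submodule (quad_field d) V {e}) \<and>
     gen_submodule (quad_field d) V I \<inter> L = I \<and>
     (\<forall>x\<in>I. \<forall>y\<in>I. h x y = 0)"

text \<open>\<open>div_of\<close> is a choice of generator; it is only meaningful up to \<^const>\<open>unit_equiv\<close>.\<close>

definition is_div ::
  "int \<Rightarrow> (complex, 'v) module \<Rightarrow> ('v \<Rightarrow> 'v \<Rightarrow> complex) \<Rightarrow> 'v set \<Rightarrow> 'v set \<Rightarrow> complex \<Rightarrow> bool" where
  "is_div d V h L I c \<longleftrightarrow> c \<in> quad_set d \<and>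
     (\<exists>e \<in> L. I = {x \<odot>\<^bsub>V\<^esub> e | x. x \<in> carrier (ring_of_ints d)} \<and>
        {h l e | l. l \<in> L} = {x * c | x. x \<in> carrier (ring_of_ints d)})"

definition div_of ::
  "int \<Rightarrow> (complex, 'v) module \<Rightarrow> ('v \<Rightarrow> 'v \<Rightarrow> complex) \<Rightarrow> 'v set \<Rightarrow> 'v set \<Rightarrow> complex" where
  "div_of d V h L I = (SOME c. is_div d V h L I c)"

text \<open>\<open>stab_group\<close> is \<open>Z(I)\<close> over the rationals: it fixes \<open>I\<^sup>\<bottom> \<subseteq> V\<close> pointwise, not just modulo \<open>I\<close>.
  The conditions \<open>a id \<in> \<Gamma>\<close> and \<open>a T \<in> \<Gamma>\<close> for some \<open>T \<in> Z(I)\<close> are \<open>scalar_in\<close> and \<open>twist_in\<close>.\<close>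

definition stab_group ::
  "int \<Rightarrow> (complex, 'v) module \<Rightarrow> ('v \<Rightarrow> 'v \<Rightarrow> complex) \<Rightarrow> 'v set \<Rightarrow> ('v \<Rightarrow> 'v) set" where
  "stab_group d V h I = {T \<in> unitary_group_rat d V h.
     T ` gen_submodule (quad_field d) V I = gen_submodule (quad_field d) V I \<and>
     (\<forall>v\<in>carrier V. (\<forall>x\<in>I. h v x = 0) \<longrightarrow> T v = v)}"

definition scalar_in :: "(complex, 'v) module \<Rightarrow> ('v \<Rightarrow> 'v) set \<Rightarrow> complex \<Rightarrow> bool" where
  "scalar_in V G a \<longleftrightarrow> (\<lambda>v. a \<odot>\<^bsub>V\<^esub> v) \<in> G"

definition twist_in ::
  "int \<Rightarrow> (complex, 'v) module \<Rightarrow> ('v \<Rightarrow> 'v \<Rightarrow> complex) \<Rightarrow> 'v set \<Rightarrow> ('v \<Rightarrow> 'v) set \<Rightarrow> complex \<Rightarrow> bool"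
  where
  "twist_in d V h I G a \<longleftrightarrow> (\<exists>T \<in> stab_group d V h I. (\<lambda>v. a \<odot>\<^bsub>V\<^esub> T v) \<in> G)"

text \<open>With \<open>csqrt\<close> the square root of \<open>-1\<close> is \<open>\<i>\<close>. Replacing \<open>omega\<close> by the other primitive cube root
  of unity does not change the notions below, since \<open>Z(I)\<close> and \<open>\<Gamma>\<close> are groups.\<close>

definition omega :: complex where
  "omega = (- 1 + rt (- 3)) / 2"

definition semi_irregular_2 ::
  "int \<Rightarrow> (complex, 'v) module \<Rightarrow> ('v \<Rightarrow> 'v \<Rightarrow> complex) \<Rightarrow> 'v set \<Rightarrow> ('v \<Rightarrow> 'v) set \<Rightarrow> bool" where
  "semi_irregular_2 d V h I G \<longleftrightarrow>
     (d = - 1 \<and> scalar_in V G (- 1) \<and> \<not> scalar_in V G (rt (- 1)) \<and> twist_in d V h I G (rt (- 1))) \<or>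
     (d = - 3 \<and> scalar_in V G omega \<and> \<not> scalar_in V G (- 1) \<and> twist_in d V h I G (- 1))"

definition irregular_4 ::
  "int \<Rightarrow> (complex, 'v) module \<Rightarrow> ('v \<Rightarrow> 'v \<Rightarrow> complex) \<Rightarrow> 'v set \<Rightarrow> ('v \<Rightarrow> 'v) set \<Rightarrow> bool" where
  "irregular_4 d V h I G \<longleftrightarrow>
     d = - 1 \<and> \<not> scalar_in V G (- 1) \<and> \<not> scalar_in V G (rt (- 1)) \<and> twist_in d V h I G (- rt (- 1))"

definition irregular_6 ::
  "int \<Rightarrow> (complex, 'v) module \<Rightarrow> ('v \<Rightarrow> 'v \<Rightarrow> complex) \<Rightarrow> 'v set \<Rightarrow> ('v \<Rightarrow> 'v) set \<Rightarrow> bool" where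
  "irregular_6 d V h I G \<longleftrightarrow>
     d = - 3 \<and> \<not> scalar_in V G (- 1) \<and> \<not> scalar_in V G omega \<and> twist_in d V h I G (- omega)"

definition irregular_3 ::
  "int \<Rightarrow> (complex, 'v) module \<Rightarrow> ('v \<Rightarrow> 'v \<Rightarrow> complex) \<Rightarrow> 'v set \<Rightarrow> ('v \<Rightarrow> 'v) set \<Rightarrow> bool" where
  "irregular_3 d V h I G \<longleftrightarrow>
     d = - 3 \<and> \<not> scalar_in V G (- 1) \<and> \<not> scalar_in V G omega \<and> twist_in d V h I G omega \<and>
     \<not> irregular_6 d V h I G"

definition irregular_2 ::
  "int \<Rightarrow> (complex, 'v) module \<Rightarrow> ('v \<Rightarrow> 'v \<Rightarrow> complex) \<Rightarrow> 'v set \<Rightarrow> ('v \<Rightarrow> 'v) set \<Rightarrow> bool" where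
  "irregular_2 d V h I G \<longleftrightarrow>
     \<not> scalar_in V G (- 1) \<and> twist_in d V h I G (- 1) \<and>
     (d = - 1 \<longrightarrow> \<not> irregular_4 d V h I G) \<and>
     (d = - 3 \<longrightarrow> \<not> semi_irregular_2 d V h I G \<and> \<not> irregular_6 d V h I G)"


section \<open>The tables of divisors and discriminant modules\<close>

text \<open>A table is a set of pairs of a value of \<open>div(I)\<close> and a module expression.\<close>

type_synonym div_table = "(complex \<times> module_expr) set"

definition listed ::
  "int \<Rightarrow> (complex, 'v) module \<Rightarrow> ('v \<Rightarrow> 'v \<Rightarrow> complex) \<Rightarrow> 'v set \<Rightarrow> 'v set \<Rightarrow> div_table \<Rightarrow> bool"
  where
  "listed d V h L I T \<longleftrightarrow> (\<exists>(c, E) \<in> T.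
     unit_equiv d (div_of d V h L I) c \<and> iso_to_expr d (discriminant_group d V h L) E)"

definition ramified_rows :: "complex \<Rightarrow> complex \<Rightarrow> nat set \<Rightarrow> (nat \<times> nat) set \<Rightarrow> div_table" where
  "ramified_rows v \<eta> C D =
     {(v, [(int a, \<eta>), (int b, \<eta>^2), (1, \<eta>^c)]) | a b c. c \<in> C} \<union>
     {(v, [(int a, \<eta>), (int b, \<eta>^2), (1, \<eta>^d1), (1, \<eta>^d2)]) | a b d1 d2. (d1, d2) \<in> D}"

definition table_A1 :: div_table where
  "table_A1 = (let \<eta> = 1 + rt (- 1) in
     ramified_rows 1 \<eta> {3,4,5,6} {(3,3),(3,4),(3,5)} \<union>
     ramified_rows (1 + rt (- 1)) \<eta> {4,5,6,7,8}
       {(1,7),(3,3),(3,4),(3,5),(3,6),(3,7),(4,4),(4,5),(4,6),(5,5)} \<union>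
     ramified_rows 2 \<eta> {6,7,8,9,10}
       {(3,5),(3,6),(3,7),(3,8),(4,4),(4,5),(4,6),(4,7),(4,8),(5,5),(5,6),(5,7),(6,6)})"

definition table_A2 :: div_table where
  "table_A2 = (let \<eta> = 1 + rt (- 1) in
     {(1 + rt (- 1), [(int a, \<eta>), (1, \<eta>^c)]) | a c. c \<in> {5,6,7}} \<union>
     {(1 + rt (- 1), [(int a, \<eta>), (1, \<eta>^d1), (1, \<eta>^d2)]) | a d1 d2.
        (d1, d2) \<in> {(1,6),(2,4),(2,5),(2,6),(3,3),(3,4),(3,5),(4,4)}})"

definition table_B :: div_table where
  "table_B = (let \<eta> = rt (- 2) in
     ramified_rows (1 / rt (- 2)) \<eta> {3,4,5,6} {(3,3),(3,4),(3,5)} \<union>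
     ramified_rows 1 \<eta> {4,5,6,7,8}
       {(2,7),(3,3),(3,4),(3,5),(3,6),(3,7),(4,4),(4,5),(4,6),(5,5)} \<union>
     ramified_rows (rt (- 2)) \<eta> {6,7,8,9,10}
       {(3,5),(3,6),(3,7),(3,8),(4,4),(4,5),(4,6),(4,7),(4,8),(5,5),(5,6),(5,7),(6,6)} \<union>
     ramified_rows 2 \<eta> {6,7,8,9,10,11,12}
       {(1,11),(3,7),(3,8),(3,9),(3,10),(3,11),(4,6),(4,7),(4,8),(4,9),(4,10),
        (5,5),(5,6),(5,7),(5,8),(5,9),(6,6),(6,7),(6,8),(7,7)})"

definition table_C1 :: div_table where
  "table_C1 = (let \<eta> = rt (- 3); \<delta> = 2 in
     {(1 / rt (- 3), [(int a, \<delta>)]) | a. True} \<union>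
     {(1, [(int a, \<delta>), (1, \<eta>^2)]) | a. True} \<union>
     {(1, [(int a, \<delta>), (2, \<eta>)]) | a. True} \<union>
     {(2 / rt (- 3), [(int a, \<delta>), (1, \<delta>^c)]) | a c. c \<in> {0,2,3}} \<union>
     {(2 / rt (- 3), [(int a, \<delta>), (2, \<delta>^2)]) | a. True} \<union>
     {(2, [(int a, \<delta>), (1, \<eta>^2)]) | a. True} \<union>
     {(2, [(int a, \<delta>), (2, \<eta>^2)]) | a. True} \<union>
     {(2, [(int a, \<delta>), (1, \<delta>^c), (1, \<eta>^2)]) | a c. c \<in> {2,3}} \<union>
     {(2, [(int a, \<delta>), (1, \<delta>^c), (2, \<eta>)]) | a c. c \<in> {2,3}} \<union>
     {(2, [(int a, \<delta>), (2, \<delta>^2), (1, \<eta>^2)]) | a. True} \<union>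
     {(2, [(int a, \<delta>), (2, \<delta>^2), (2, \<eta>)]) | a. True})"

definition table_C2 :: div_table where
  "table_C2 = (let \<eta> = rt (- 3); \<delta> = 2 in
     {(1 / rt (- 3), [(int a, \<delta>)]) | a. True} \<union>
     {(1, [(int a, \<eta>), (int b, \<eta>^2), (1, \<eta>^c)]) | a b c. c \<in> {0,3,4}} \<union>
     {(1, [(int a, \<eta>), (int b, \<eta>^2), (2, \<eta>^3)]) | a b. True} \<union>
     {(rt (- 3), [(int a, \<eta>), (int b, \<eta>^2), (1, \<eta>^c)]) | a b c. c \<in> {0,3,4,5,6}} \<union>
     {(rt (- 3), [(int a, \<eta>), (int b, \<eta>^2), (2, \<eta>^3)]) | a b. True} \<union>
     {(rt (- 3), [(int a, \<eta>), (int b, \<eta>^2), (1, \<eta>^3), (1, \<eta>^d')]) | a b d'. d' \<in> {4,5}})"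

definition table_C3 :: div_table where
  "table_C3 = (let \<eta> = rt (- 3) in {(1 / rt (- 3), []), (1, [(1, \<eta>^2)]), (1, [(2, \<eta>)])})"

definition split_exprs :: "complex \<Rightarrow> complex \<Rightarrow> int \<Rightarrow> module_expr set" where
  "split_exprs x y a = {
     [(a - 2, x), (a, y), (2, x^2)],
     [(a - 1, x), (a, y), (1, x^3)],
     [(a, x), (a, y), (1, x^2)],
     [(a + 2, x), (a, y)]}"

definition local_exprs :: "complex \<Rightarrow> int \<Rightarrow> module_expr set" where
  "local_exprs x a = {
     [(a - 2, x), (2, x^2)],
     [(a - 1, x), (1, x^3)],
     [(a, x), (1, x^2)],
     [(a + 2, x)]}"

definition both_exprs :: "complex \<Rightarrow> complex \<Rightarrow> int \<Rightarrow> module_expr set" where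
  "both_exprs x y a = {
     [(a - 2, x), (a - 2, y), (2, x^2), (2, y^2)],
     [(a - 2, x), (a - 1, y), (2, x^2), (1, y^3)],
     [(a - 2, x), (a, y), (1, x^2), (2, y^2)],
     [(a - 2, x), (a, y), (2, x^2), (1, y^2)],
     [(a - 2, x), (a + 1, y), (1, x^2), (1, y^3)],
     [(a - 2, x), (a + 2, y), (1, x^2), (1, y^2)],
     [(a - 1, x), (a - 2, y), (1, x^3), (2, y^2)],
     [(a - 1, x), (a - 1, y), (1, x^3), (1, y^3)],
     [(a - 1, x), (a, y), (1, x^3), (1, y^2)],
     [(a, x), (a - 2, y), (1, x^2), (2, y^2)],
     [(a, x), (a - 2, y), (2, x^2), (1, y^2)],
     [(a, x), (a - 1, y), (1, x^2), (1, y^3)],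
     [(a, x), (a, y), (2, x^2)],
     [(a, x), (a, y), (2, y^2)],
     [(a, x), (a, y), (1, x^2), (1, y^2)],
     [(a, x), (a + 1, y), (1, y^3)],
     [(a, x), (a + 2, y), (1, x^2)],
     [(a, x), (a + 2, y), (1, y^2)],
     [(a + 1, x), (a - 2, y), (1, x^3), (1, y^2)],
     [(a + 1, x), (a, y), (1, x^3)],
     [(a + 2, x), (a - 2, y), (1, x^2), (1, y^2)],
     [(a + 2, x), (a, y), (1, x^2)],
     [(a + 2, x), (a, y), (1, y^2)],
     [(a + 2, x), (a + 2, y)]}"

definition table_D :: div_table where
  "table_D = (let \<eta>1 = (1 + rt (- 7)) / 2; \<eta>2 = (- 1 + rt (- 7)) / 2; \<delta> = rt (- 7);
       X = {[(1, \<delta>^2)], [(2, \<delta>)]} in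
     {(1 / rt (- 7), [(int a, \<eta>1), (int b, \<eta>2)]) | a b. True} \<union>
     {(1, [(int a, \<eta>1), (int b, \<eta>2), (1, \<delta>^2)]) | a b. True} \<union>
     {(1, [(int a, \<eta>1), (int b, \<eta>2), (2, \<delta>)]) | a b. True} \<union>
     {(\<eta>1 / rt (- 7), N) | a N. N \<in> split_exprs \<eta>1 \<eta>2 (int a)} \<union>
     {(\<eta>2 / rt (- 7), N) | a N. N \<in> split_exprs \<eta>2 \<eta>1 (int a)} \<union>
     {(\<eta>1, N @ P) | a N P. N \<in> split_exprs \<eta>1 \<eta>2 (int a) \<and> P \<in> X} \<union>
     {(\<eta>2, N @ P) | a N P. N \<in> split_exprs \<eta>2 \<eta>1 (int a) \<and> P \<in> X} \<union>
     {(\<eta>1 * \<eta>2 / rt (- 7), N) | a N. N \<in> both_exprs \<eta>1 \<eta>2 (int a)} \<union>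
     {(\<eta>1 * \<eta>2, N1 @ N2 @ P) | a N1 N2 P.
        N1 \<in> local_exprs \<eta>1 (int a) \<and> N2 \<in> local_exprs \<eta>2 (int a) \<and> P \<in> X})"

definition table_E :: "int \<Rightarrow> div_table" where
  "table_E d = (let \<eta> = rt d; \<delta> = 2 in
     {(1 / rt d, [(int a, \<delta>), (1, \<eta>)]) | a. True} \<union>
     {(2 / rt d, [(int a, \<delta>), (1, \<delta>^c)]) | a c. c \<in> {0,2,3}} \<union>
     {(2 / rt d, [(int a, \<delta>), (2, \<delta>^2)]) | a. True} \<union>
     {(2 / rt d, [(int a, \<delta>), (1, \<eta>^2)]) | a. True} \<union>
     {(2 / rt d, [(int a, \<delta>), (2, \<eta>)]) | a. True} \<union>
     {(1, [(int a, \<delta>), (1, \<eta>^2)]) | a. True} \<union>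
     {(1, [(int a, \<delta>), (2, \<eta>)]) | a. True} \<union>
     {(2, [(int a, \<delta>), (1, \<delta>^c), (1, \<eta>^2)]) | a c. c \<in> {2,3}} \<union>
     {(2, [(int a, \<delta>), (1, \<delta>^c), (2, \<eta>)]) | a c. c \<in> {2,3}} \<union>
     {(2, [(int a, \<delta>), (2, \<delta>^2), (1, \<eta>^2)]) | a. True} \<union>
     {(2, [(int a, \<delta>), (2, \<delta>^2), (2, \<eta>)]) | a. True})"

end

(* A twist a T in the discriminant kernel is trivial on D / L, where D is the dual lattice. Since
   T v = v + (<v,e>/kappa) q e for some rational q, all vectors (1 - 1/a) v + (<v,e>/kappa) q e with
   v in D lie in L. Put div(I) = kappa delta. Testing this on e / conj(delta), and on
   a v0 in D with <v0,e> = kappa, shows that (1 - 1/a) / conj(delta) and q conj(delta) are integral.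
   Hence q^2 |1 - 1/a|^2 is an integer; if |1 - 1/a|^2 is squarefree, then q is an integer and the
   scalar a itself lies in the discriminant kernel. This rules out all types except index 2. For
   a = -1 it remains that 2 q is odd and div(I) = 2 kappa up to a unit. Then v0 generates a copy of
   O / 4 in D / L, whose orthogonal complement is killed by 2; the latter is decomposed by linear
   algebra over the residue fields at 2. *)

theory Submission
  imports Defs "HOL-Library.Function_Algebras"
begin

section \<open>Decompositions into cyclic modules\<close>

text \<open>The vector v0 exists because a lattice over a principal ideal ring equals its double
  dual; there, and in the freeness of I, class number one is used. That v0 splits off orthogonally
  comes from q = m/2 with m odd: pairing 2 v0 + q e with v0 gives 2 <v0,v0> = kappa m/2 modulo kappa
  O, so the discriminant form is perfect on the copy of O/4. Up to units, 2 kappa is 1 for d = -1,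
  1/sqrt(-2) for d = -2, 2/sqrt(d) when 2 is inert, and eta_1 eta_2/sqrt(-7) for d = -7. So each
  index 2 case meets a single value of its table, where O/4 appears as eta^4, eta^4, delta^2, and
  the sum of eta_1^2 and eta_2^2. Quotients are never formed during the linear algebra: generators
  and their relations modulo L are kept as vectors of a space over the field, where division by
  elements of O is available. The records of the statement meet this type-class setting only at the
  end.\<close>

locale subring_scaling = vector_space scale
  for scale :: "'f::field \<Rightarrow> 'w::ab_group_add \<Rightarrow> 'w" (infixr "*s" 75) +
  fixes R :: "'f set"
  assumes R_0 [simp, intro]: "0 \<in> R" and R_1 [simp, intro]: "1 \<in> R"
    and R_add [intro]: "x \<in> R \<Longrightarrow> y \<in> R \<Longrightarrow> x + y \<in> R"
    and R_mult [intro]: "x \<in> R \<Longrightarrow> y \<in> R \<Longrightarrow> x * y \<in> R"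
    and R_uminus [intro]: "x \<in> R \<Longrightarrow> - x \<in> R"
begin

lemma R_diff [intro]: "x \<in> R \<Longrightarrow> y \<in> R \<Longrightarrow> x - y \<in> R"
  using R_add[of x "- y"] R_uminus[of y] by simp

lemma R_of_nat [intro, simp]: "of_nat n \<in> R"
  by (induction n) auto

lemma R_of_int [intro, simp]: "of_int n \<in> R"
  by (cases n) (auto simp del: of_nat_Suc)

lemma R_numeral [intro, simp]: "numeral n \<in> R"
  using R_of_nat[of "numeral n"] by simp

lemma R_power [intro]: "x \<in> R \<Longrightarrow> x ^ n \<in> R"
  by (induction n) auto

text \<open>Divisibility in the ambient field is trivial, so the cofactor must be required to lie in
  \<open>R\<close>.\<close>

definition dvdR :: "'f \<Rightarrow> 'f \<Rightarrow> bool" where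
  "dvdR p r \<longleftrightarrow> (\<exists>x\<in>R. r = p * x)"

definition submod :: "'w set \<Rightarrow> bool" where
  "submod N \<longleftrightarrow> 0 \<in> N \<and> (\<forall>x\<in>N. \<forall>y\<in>N. x + y \<in> N) \<and> (\<forall>r\<in>R. \<forall>x\<in>N. r *s x \<in> N)"

lemma submod_0 [simp]: "submod N \<Longrightarrow> 0 \<in> N"
  and submod_add: "submod N \<Longrightarrow> x \<in> N \<Longrightarrow> y \<in> N \<Longrightarrow> x + y \<in> N"
  and submod_scale: "submod N \<Longrightarrow> r \<in> R \<Longrightarrow> x \<in> N \<Longrightarrow> r *s x \<in> N"
  by (auto simp: submod_def)

lemma submod_uminus: "submod N \<Longrightarrow> x \<in> N \<Longrightarrow> - x \<in> N"
  using submod_scale[of N "- 1" x] by auto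

lemma submod_diff: "submod N \<Longrightarrow> x \<in> N \<Longrightarrow> y \<in> N \<Longrightarrow> x - y \<in> N"
  using submod_add[of N x "- y"] submod_uminus[of N y] by simp

lemma submod_trans: "submod N \<Longrightarrow> x - y \<in> N \<Longrightarrow> y - z \<in> N \<Longrightarrow> x - z \<in> N"
  using submod_add[of N "x - y" "y - z"] by simp

lemma submod_sym: "submod N \<Longrightarrow> x - y \<in> N \<Longrightarrow> y - x \<in> N"
  using submod_uminus[of N "x - y"] by simp

lemma submod_cong: "submod N \<Longrightarrow> x - y \<in> N \<Longrightarrow> x \<in> N \<longleftrightarrow> y \<in> N"
  using submod_add[of N "x - y" y] submod_diff[of N x "x - y"] by auto

section \<open>Linear combinations with coefficients in the subring\<close>

definition comb :: "'f list \<Rightarrow> 'w list \<Rightarrow> 'w" where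
  "comb rs gs = sum_list (map2 (*s) rs gs)"

definition coeffs :: "'w list \<Rightarrow> 'f list set" where
  "coeffs gs = {rs. length rs = length gs \<and> set rs \<subseteq> R}"

definition span_of :: "'w list \<Rightarrow> 'w set" where
  "span_of gs = {comb rs gs | rs. rs \<in> coeffs gs}"

lemma comb_Nil [simp]: "comb [] gs = 0" "comb rs [] = 0"
  and comb_Cons [simp]: "comb (r # rs) (g # gs) = r *s g + comb rs gs"
  by (simp_all add: comb_def)

lemma comb_append: "length rs = length gs \<Longrightarrow> comb (rs @ rs') (gs @ gs') = comb rs gs + comb rs' gs'"
  by (simp add: comb_def)

lemma comb_add: "length rs = length gs \<Longrightarrow> length ts = length gs \<Longrightarrow>
    comb rs gs + comb ts gs = comb (map2 (+) rs ts) gs"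
proof (induction gs arbitrary: rs ts)
  case (Cons g gs)
  then obtain r rs' t ts' where "rs = r # rs'" "ts = t # ts'"
    by (metis length_Suc_conv)
  with Cons.prems Cons.IH[of rs' ts'] show ?case
    by (simp add: scale_left_distrib add.assoc)
qed simp

lemma comb_diff: "length rs = length gs \<Longrightarrow> length ts = length gs \<Longrightarrow>
    comb rs gs - comb ts gs = comb (map2 (-) rs ts) gs"
proof (induction gs arbitrary: rs ts)
  case (Cons g gs)
  then obtain r rs' t ts' where "rs = r # rs'" "ts = t # ts'"
    by (metis length_Suc_conv)
  with Cons.prems Cons.IH[of rs' ts'] show ?case
    by (simp add: scale_left_diff_distrib add_diff_add)
qed simp

lemma comb_scale: "length rs = length gs \<Longrightarrow> comb (map ((*) c) rs) gs = c *s comb rs gs"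
proof (induction gs arbitrary: rs)
  case (Cons g gs)
  then obtain r rs' where "rs = r # rs'"
    by (metis length_Suc_conv)
  with Cons show ?case
    by (simp add: scale_right_distrib)
qed simp

lemma comb_zero [simp]: "comb (replicate n 0) gs = 0"
proof (induction n arbitrary: gs)
  case (Suc n)
  then show ?case by (cases gs) auto
qed simp

lemma coeffs_Nil [simp]: "coeffs [] = {[]}"
  by (auto simp: coeffs_def)

lemma coeffs_add: "rs \<in> coeffs gs \<Longrightarrow> ts \<in> coeffs gs \<Longrightarrow> map2 (+) rs ts \<in> coeffs gs"
  by (auto simp: coeffs_def set_zip intro!: R_add)

lemma coeffs_diff: "rs \<in> coeffs gs \<Longrightarrow> ts \<in> coeffs gs \<Longrightarrow> map2 (-) rs ts \<in> coeffs gs"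
  by (auto simp: coeffs_def set_zip intro!: R_diff)

lemma coeffs_scale: "rs \<in> coeffs gs \<Longrightarrow> c \<in> R \<Longrightarrow> map ((*) c) rs \<in> coeffs gs"
  by (auto simp: coeffs_def)

lemma coeffs_appendE:
  assumes "rs \<in> coeffs (gs @ hs)"
  obtains rs1 rs2 where "rs = rs1 @ rs2" "rs1 \<in> coeffs gs" "rs2 \<in> coeffs hs"
proof
  show "rs = take (length gs) rs @ drop (length gs) rs" by simp
qed (use assms in \<open>auto simp: coeffs_def dest: in_set_takeD in_set_dropD\<close>)

lemma coeffs_append: "rs1 \<in> coeffs gs \<Longrightarrow> rs2 \<in> coeffs hs \<Longrightarrow> rs1 @ rs2 \<in> coeffs (gs @ hs)"
  by (auto simp: coeffs_def)

lemma coeffs_length: "rs \<in> coeffs gs \<Longrightarrow> length rs = length gs"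
  by (simp add: coeffs_def)

lemma submod_span: "submod (span_of gs)"
  unfolding submod_def
proof (intro conjI ballI)
  have "replicate (length gs) 0 \<in> coeffs gs" by (auto simp: coeffs_def)
  then show "0 \<in> span_of gs" unfolding span_of_def by (metis (mono_tags, lifting) CollectI comb_zero)
next
  fix x y assume "x \<in> span_of gs" "y \<in> span_of gs"
  then show "x + y \<in> span_of gs"
    unfolding span_of_def using comb_add coeffs_add coeffs_length by fastforce
next
  fix r x assume "r \<in> R" "x \<in> span_of gs"
  then show "r *s x \<in> span_of gs"
    unfolding span_of_def using comb_scale[symmetric] coeffs_scale coeffs_length by fastforce
qed

lemma span_append: "span_of (gs @ hs) = {x + y | x y. x \<in> span_of gs \<and> y \<in> span_of hs}"
proof (intro equalityI subsetI)
  fix z assume "z \<in> span_of (gs @ hs)"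
  then obtain us where us: "us \<in> coeffs (gs @ hs)" "z = comb us (gs @ hs)"
    unfolding span_of_def by blast
  from us(1) obtain rs ts where *: "us = rs @ ts" "rs \<in> coeffs gs" "ts \<in> coeffs hs"
    by (rule coeffs_appendE)
  then have "z = comb rs gs + comb ts hs" using us by (simp add: comb_append coeffs_length)
  then show "z \<in> {x + y | x y. x \<in> span_of gs \<and> y \<in> span_of hs}"
    using * unfolding span_of_def by blast
next
  fix z assume "z \<in> {x + y | x y. x \<in> span_of gs \<and> y \<in> span_of hs}"
  then obtain rs ts where *: "z = comb rs gs + comb ts hs" "rs \<in> coeffs gs" "ts \<in> coeffs hs"
    unfolding span_of_def by auto
  then have "z = comb (rs @ ts) (gs @ hs)" using comb_append coeffs_length by metis
  then show "z \<in> span_of (gs @ hs)" using coeffs_append * unfolding span_of_def by blast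
qed

lemma span_single: "span_of [g] = {r *s g | r. r \<in> R}"
proof -
  have "coeffs [g] = (\<lambda>r. [r]) ` R"
    by (auto simp: coeffs_def length_Suc_conv)
  then show ?thesis unfolding span_of_def by force
qed

lemma span_subset: "submod N \<Longrightarrow> set gs \<subseteq> N \<Longrightarrow> span_of gs \<subseteq> N"
proof (induction gs)
  case Nil then show ?case by (simp add: span_of_def)
next
  case (Cons g gs)
  then show ?case using span_append[of "[g]" gs] span_single[of g]
    by (auto intro!: submod_add submod_scale)
qed

lemma in_span: "g \<in> set gs \<Longrightarrow> g \<in> span_of gs"
proof (induction gs)
  case (Cons a gs)
  have a: "a \<in> span_of [a]" unfolding span_single using R_1 scale_one by force
  have 0: "0 \<in> span_of [a]" "0 \<in> span_of gs" using submod_span by simp_all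
  have "a + 0 \<in> span_of ([a] @ gs)" unfolding span_append using a 0 by blast
  moreover have "g \<in> set gs \<Longrightarrow> 0 + g \<in> span_of ([a] @ gs)" unfolding span_append using Cons 0 by blast
  ultimately show ?case using Cons.prems by auto
qed simp

lemma comb_in: "submod N \<Longrightarrow> set gs \<subseteq> N \<Longrightarrow> rs \<in> coeffs gs \<Longrightarrow> comb rs gs \<in> N"
  using span_subset unfolding span_of_def by blast

text \<open>Serves to lift through multiplication by \<open>c\<close>: once each
  \<open>hs ! i\<close> is a preimage of \<open>gs ! i\<close> modulo \<open>N\<close>, the same
  coefficients give a preimage of every combination.\<close>

lemma comb_cong:
  assumes "submod N" "length gs = length hs" "rs \<in> coeffs gs"
    and "\<And>i. i < length gs \<Longrightarrow> c *s hs ! i - gs ! i \<in> N"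
  shows "c *s comb rs hs - comb rs gs \<in> N"
  using assms(2,3,4)
proof (induction gs arbitrary: hs rs)
  case Nil
  then show ?case using assms(1) by simp
next
  case (Cons g gs)
  then obtain h hs' r rs' where *: "hs = h # hs'" "rs = r # rs'" "length gs = length hs'"
    by (metis length_Suc_conv coeffs_length)
  then have r: "r \<in> R" "rs' \<in> coeffs gs" using Cons.prems by (auto simp: coeffs_def)
  have "c *s comb rs' hs' - comb rs' gs \<in> N"
  proof (rule Cons.IH)
    fix i assume "i < length gs"
    then show "c *s hs' ! i - gs ! i \<in> N" using Cons.prems(3)[of "Suc i"] * by simp
  qed (use * r in auto)
  moreover have "r *s (c *s h - g) \<in> N"
    using Cons.prems(3)[of 0] * assms(1) r by (intro submod_scale) auto
  ultimately have "r *s (c *s h - g) + (c *s comb rs' hs' - comb rs' gs) \<in> N"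
    by (rule submod_add[OF assms(1), rotated])
  then show ?case
    by (simp add: * scale_right_diff_distrib scale_right_distrib mult.commute algebra_simps)
qed

text \<open>Encodes that \<open>N / \<Lambda>\<close> is the direct sum of the cyclic modules
  \<open>R / p\<close> for \<open>p\<close> in \<open>ps\<close>, with the classes of
  \<open>gs\<close> as generators, without forming the quotient.\<close>

definition decomp :: "'f list \<Rightarrow> 'w list \<Rightarrow> 'w set \<Rightarrow> 'w set \<Rightarrow> bool" where
  "decomp ps gs N \<Lambda> \<longleftrightarrow> length gs = length ps \<and> set gs \<subseteq> N \<and>
     (\<forall>v\<in>N. \<exists>y\<in>span_of gs. v - y \<in> \<Lambda>) \<and>
     (\<forall>rs\<in>coeffs gs. comb rs gs \<in> \<Lambda> \<longleftrightarrow> list_all2 dvdR ps rs)"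

lemma replicate_dvdE:
  assumes "list_all2 dvdR (replicate n p) ts"
  obtains ts' where "length ts' = n" "set ts' \<subseteq> R" "ts = map ((*) p) ts'"
proof -
  have "\<exists>ts'. length ts' = n \<and> set ts' \<subseteq> R \<and> ts = map ((*) p) ts'" using assms
  proof (induction n arbitrary: ts)
    case (Suc n)
    then obtain t ts1 where t: "ts = t # ts1" by (cases ts) auto
    then obtain ts' where ts': "length ts' = n" "set ts' \<subseteq> R" "ts1 = map ((*) p) ts'"
      using Suc by auto
    obtain x where "x \<in> R" "t = p * x" using Suc.prems t by (auto simp: dvdR_def)
    then show ?case using t ts' by (intro exI[of _ "x # ts'"]) auto
  qed simp
  then show ?thesis using that by blast
qed

lemma dvd_replicateI:
  "set ts' \<subseteq> R \<Longrightarrow> list_all2 dvdR (replicate (length ts') p) (map ((*) p) ts')"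
  by (induction ts') (auto simp: dvdR_def)

text \<open>The images of \<open>N1\<close> and \<open>N2\<close> modulo \<open>\<Lambda>\<close>
  form an internal direct sum: \<open>gen\<close> makes them span and \<open>dir\<close> makes the
  sum direct.\<close>

lemma decomp_append:
  assumes d1: "decomp ps gs N1 \<Lambda>" and d2: "decomp qs hs N2 \<Lambda>"
    and sub: "submod \<Lambda>" "submod N1" "submod N2" "N1 \<subseteq> N" "N2 \<subseteq> N"
    and gen: "\<And>v. v \<in> N \<Longrightarrow> \<exists>v1\<in>N1. \<exists>v2\<in>N2. v - (v1 + v2) \<in> \<Lambda>"
    and dir: "\<And>v1 v2. v1 \<in> N1 \<Longrightarrow> v2 \<in> N2 \<Longrightarrow> v1 + v2 \<in> \<Lambda> \<Longrightarrow> v1 \<in> \<Lambda> \<and> v2 \<in> \<Lambda>"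
  shows "decomp (ps @ qs) (gs @ hs) N \<Lambda>"
  unfolding decomp_def
proof (intro conjI ballI)
  show "length (gs @ hs) = length (ps @ qs)" "set (gs @ hs) \<subseteq> N"
    using d1 d2 sub by (auto simp: decomp_def)
next
  fix v assume "v \<in> N"
  then obtain v1 v2 where v: "v1 \<in> N1" "v2 \<in> N2" "v - (v1 + v2) \<in> \<Lambda>" using gen by blast
  obtain y1 where y1: "y1 \<in> span_of gs" "v1 - y1 \<in> \<Lambda>" using v(1) d1 unfolding decomp_def by blast
  obtain y2 where y2: "y2 \<in> span_of hs" "v2 - y2 \<in> \<Lambda>" using v(2) d2 unfolding decomp_def by blast
  have "(v - (v1 + v2)) + ((v1 - y1) + (v2 - y2)) \<in> \<Lambda>"
    using v y1 y2 sub(1) by (intro submod_add)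
  moreover have "(v - (v1 + v2)) + ((v1 - y1) + (v2 - y2)) = v - (y1 + y2)" by simp
  moreover have "y1 + y2 \<in> span_of (gs @ hs)" using y1 y2 by (auto simp: span_append)
  ultimately show "\<exists>y\<in>span_of (gs @ hs). v - y \<in> \<Lambda>" by metis
next
  fix rs assume "rs \<in> coeffs (gs @ hs)"
  then obtain r1 r2 where r: "rs = r1 @ r2" "r1 \<in> coeffs gs" "r2 \<in> coeffs hs"
    by (elim coeffs_appendE)
  have len: "length r1 = length ps" "length r2 = length qs" "length r1 = length gs"
    using r d1 d2 by (auto simp: decomp_def coeffs_def)
  have "comb r1 gs \<in> N1" "comb r2 hs \<in> N2"
    using comb_in r d1 d2 sub by (auto simp: decomp_def)
  then have "comb rs (gs @ hs) \<in> \<Lambda> \<longleftrightarrow> comb r1 gs \<in> \<Lambda> \<and> comb r2 hs \<in> \<Lambda>"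
    using dir submod_add[OF sub(1)] r(1) comb_append[OF len(3)] by auto
  also have "\<dots> \<longleftrightarrow> list_all2 dvdR (ps @ qs) rs"
    using d1 d2 r len by (simp add: decomp_def list_all2_append)
  finally show "comb rs (gs @ hs) \<in> \<Lambda> \<longleftrightarrow> list_all2 dvdR (ps @ qs) rs" .
qed

text \<open>Finite generation comes from finiteness of the ambient quotient instead of a Noetherian
  argument: each of the finitely many classes met by \<open>N\<close> is represented once inside
  \<open>N\<close>.\<close>

lemma finite_generators:
  assumes "finite Z" and "\<And>v. v \<in> D \<Longrightarrow> \<exists>z\<in>Z. v - z \<in> \<Lambda>" and "N \<subseteq> D" and "submod \<Lambda>"
  shows "\<exists>gs. set gs \<subseteq> N \<and> (\<forall>v\<in>N. \<exists>y\<in>span_of gs. v - y \<in> \<Lambda>)"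
proof -
  define Y where "Y = {z \<in> Z. \<exists>v\<in>N. v - z \<in> \<Lambda>}"
  have "\<forall>z\<in>Y. \<exists>v. v \<in> N \<and> v - z \<in> \<Lambda>" unfolding Y_def by blast
  from bchoice[OF this] obtain f where "\<forall>z\<in>Y. f z \<in> N \<and> f z - z \<in> \<Lambda>" by (rule exE)
  then have f: "\<And>z. z \<in> Y \<Longrightarrow> f z \<in> N \<and> f z - z \<in> \<Lambda>" by simp
  have "finite (f ` Y)" using assms(1) by (simp add: Y_def)
  from finite_list[OF this] obtain gs where gs: "set gs = f ` Y" by (rule exE)
  have "\<exists>y\<in>span_of gs. v - y \<in> \<Lambda>" if v: "v \<in> N" for v
  proof -
    obtain z where z: "z \<in> Z" "v - z \<in> \<Lambda>" using v assms(2,3) by blast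
    then have "z \<in> Y" using v unfolding Y_def by blast
    then have fz: "f z - z \<in> \<Lambda>" "f z \<in> span_of gs" using f in_span gs by auto
    have "v - f z \<in> \<Lambda>" using submod_trans[OF assms(4) z(2)] submod_sym[OF assms(4) fz(1)] .
    then show ?thesis using fz by blast
  qed
  moreover have "set gs \<subseteq> N" using f by (auto simp: gs)
  ultimately show ?thesis by (intro exI[of _ gs]) simp
qed

lemma exists_basis:
  assumes sub: "submod N" "submod \<Lambda>" "\<Lambda> \<subseteq> N"
    and p: "p \<in> R" "\<And>v. v \<in> N \<Longrightarrow> p *s v \<in> \<Lambda>"
    and field: "\<And>r. r \<in> R \<Longrightarrow> \<not> dvdR p r \<Longrightarrow> \<exists>s\<in>R. dvdR p (s * r - 1)"
    and gen: "\<exists>gs. set gs \<subseteq> N \<and> (\<forall>v\<in>N. \<exists>y\<in>span_of gs. v - y \<in> \<Lambda>)"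
  shows "\<exists>gs. decomp (replicate (length gs) p) gs N \<Lambda>"
proof -
  define Q where "Q = (\<lambda>gs. set gs \<subseteq> N \<and> (\<forall>v\<in>N. \<exists>y\<in>span_of gs. v - y \<in> \<Lambda>))"
  obtain gs0 where "Q gs0" using gen unfolding Q_def by blast
  then obtain gs where gs: "Q gs" and min: "\<And>hs. Q hs \<Longrightarrow> length gs \<le> length hs"
    using ex_has_least_nat[of Q gs0 length] by blast
  have "comb rs gs \<in> \<Lambda> \<longleftrightarrow> list_all2 dvdR (replicate (length gs) p) rs" if rs: "rs \<in> coeffs gs" for rs
  proof
    assume c: "comb rs gs \<in> \<Lambda>"
    have "dvdR p (rs ! i)" if i: "i < length gs" for i
    proof (rule ccontr)
      assume nd: "\<not> dvdR p (rs ! i)"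
      define g r gs1 gs2 rs1 rs2 where defs: "g = gs ! i" "r = rs ! i"
        "gs1 = take i gs" "gs2 = drop (Suc i) gs" "rs1 = take i rs" "rs2 = drop (Suc i) rs"
      have spl: "gs = gs1 @ [g] @ gs2" "rs = rs1 @ [r] @ rs2"
        using i coeffs_length[OF rs] by (simp_all add: defs id_take_nth_drop[symmetric])
      have c1: "rs1 \<in> coeffs gs1" "rs2 \<in> coeffs gs2" "r \<in> R"
        using rs i by (auto simp: coeffs_def defs dest: in_set_takeD in_set_dropD)
      obtain s where s: "s \<in> R" "dvdR p (s * r - 1)" using field nd c1 defs by blast
      have gN: "g \<in> N" "set gs1 \<subseteq> N" "set gs2 \<subseteq> N" using gs spl unfolding Q_def by auto
      \<comment> \<open>The relation solved for \<open>g\<close>: as \<open>s * r\<close> is 1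
        modulo \<open>p\<close>, the vector \<open>w\<close> is congruent to \<open>g\<close> and
        uses only the other generators.\<close>
      define w where "w = - (s *s (comb rs1 gs1 + comb rs2 gs2))"
      have "comb rs1 gs1 + comb rs2 gs2 \<in> span_of (gs1 @ gs2)"
        using c1 unfolding span_append by (auto simp: span_of_def)
      then have w: "w \<in> span_of (gs1 @ gs2)"
        unfolding w_def using s submod_span by (intro submod_uminus submod_scale)
      have "comb rs gs = comb rs1 gs1 + (r *s g + comb rs2 gs2)"
        using c1 by (simp add: spl comb_append coeffs_length)
      then have "s *s (comb rs1 gs1 + (r *s g + comb rs2 gs2)) \<in> \<Lambda>"
        using c s sub by (metis submod_scale)
      moreover have "(s * r - 1) *s g \<in> \<Lambda>"
      proof -
        obtain x where x: "x \<in> R" "s * r - 1 = p * x" using s by (auto simp: dvdR_def)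
        then have "(s * r - 1) *s g = p *s (x *s g)" by simp
        also have "\<dots> \<in> \<Lambda>" using x gN sub by (intro p submod_scale)
        finally show ?thesis .
      qed
      ultimately have "(s * r - 1) *s g - s *s (comb rs1 gs1 + (r *s g + comb rs2 gs2)) \<in> \<Lambda>"
        using sub submod_diff by blast
      moreover have "(s * r - 1) *s g - s *s (comb rs1 gs1 + (r *s g + comb rs2 gs2)) = w - g"
        by (simp add: w_def scale_left_diff_distrib scale_right_distrib algebra_simps)
      ultimately have gw: "g - w \<in> \<Lambda>" using sub submod_sym by metis
      have "Q (gs1 @ gs2)" unfolding Q_def
      proof (intro conjI ballI)
        show "set (gs1 @ gs2) \<subseteq> N" using gN by auto
        fix v assume "v \<in> N"
        then obtain y where y: "y \<in> span_of gs" "v - y \<in> \<Lambda>" using gs unfolding Q_def by blast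
        obtain y1 t y2 where y12: "y = y1 + (t *s g + y2)" "y1 \<in> span_of gs1" "y2 \<in> span_of gs2" "t \<in> R"
          using y(1) unfolding spl(1) span_append span_single by auto
        have "y1 + y2 \<in> span_of (gs1 @ gs2)" using y12 unfolding span_append by blast
        then have 1: "(y1 + y2) + t *s w \<in> span_of (gs1 @ gs2)"
          using submod_add[OF submod_span _ submod_scale[OF submod_span _ w]] y12(4) by blast
        have "(v - y) + t *s (g - w) \<in> \<Lambda>" using y gw y12 sub by (intro submod_add submod_scale)
        moreover have "(v - y) + t *s (g - w) = v - ((y1 + y2) + t *s w)"
          by (simp add: y12 scale_right_diff_distrib algebra_simps)
        ultimately show "\<exists>y\<in>span_of (gs1 @ gs2). v - y \<in> \<Lambda>" using 1 by metis
      qed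
      then have "length gs \<le> length (gs1 @ gs2)" by (rule min)
      then show False using spl by simp
    qed
    then show "list_all2 dvdR (replicate (length gs) p) rs"
      using rs by (auto simp: list_all2_conv_all_nth coeffs_def)
  next
    assume "list_all2 dvdR (replicate (length gs) p) rs"
    moreover have "set gs \<subseteq> N" using gs Q_def by blast
    ultimately show "comb rs gs \<in> \<Lambda>" using rs
    proof (induction gs arbitrary: rs)
      case Nil then show ?case using sub by simp
    next
      case (Cons g gs)
      then obtain r rs' where *: "rs = r # rs'" by (cases rs) auto
      then obtain x where x: "r = p * x" "x \<in> R" using Cons.prems by (auto simp: dvdR_def)
      have "p *s (x *s g) \<in> \<Lambda>" using Cons.prems x sub by (intro p submod_scale) auto
      moreover have "comb rs' gs \<in> \<Lambda>" using Cons * by (auto simp: coeffs_def)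
      ultimately show ?case using sub by (simp add: * x submod_add)
    qed
  qed
  then show ?thesis using gs unfolding decomp_def Q_def by (intro exI[of _ gs]) auto
qed

text \<open>Multiplication by \<open>p\<close> has square zero on \<open>N / \<Lambda>\<close>.
  Preimages under it of a basis of its image give the summands of order \<open>p\<^sup>2\<close>,
  and a basis of its kernel modulo its image gives those of order \<open>p\<close>.\<close>

lemma exists_decomp_square:
  assumes sub: "submod N" "submod \<Lambda>" "\<Lambda> \<subseteq> N"
    and p: "p \<in> R" "p \<noteq> 0" "\<And>v. v \<in> N \<Longrightarrow> p *s p *s v \<in> \<Lambda>"
    and field: "\<And>r. r \<in> R \<Longrightarrow> \<not> dvdR p r \<Longrightarrow> \<exists>s\<in>R. dvdR p (s * r - 1)"
    and fin: "finite Z" "\<And>v. v \<in> N \<Longrightarrow> \<exists>z\<in>Z. v - z \<in> \<Lambda>"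
  shows "\<exists>gs a b. decomp (replicate a p @ replicate b (p\<^sup>2)) gs N \<Lambda>"
proof -
  \<comment> \<open>Modulo \<open>\<Lambda>\<close>, \<open>B\<close> is the image and
    \<open>C\<close> the kernel of multiplication by \<open>p\<close>.\<close>
  define B where "B = {v \<in> N. \<exists>x\<in>N. v - p *s x \<in> \<Lambda>}"
  define C where "C = {v \<in> N. p *s v \<in> \<Lambda>}"
  have "p *s r *s x \<in> \<Lambda>" if "r \<in> R" "p *s x \<in> \<Lambda>" for r x
    using submod_scale[OF sub(2) that] by (simp add: mult.commute)
  then have subC: "submod C" unfolding C_def submod_def using sub p(1)
    by (auto simp: submod_add submod_scale scale_right_distrib simp del: scale_scale)
  have subB: "submod B" unfolding submod_def
  proof (intro conjI ballI)
    show "0 \<in> B" unfolding B_def using sub by (auto intro!: bexI[of _ 0])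
  next
    fix v w assume "v \<in> B" "w \<in> B"
    then obtain x y where *: "v \<in> N" "w \<in> N" "x \<in> N" "y \<in> N" "v - p *s x \<in> \<Lambda>" "w - p *s y \<in> \<Lambda>"
      unfolding B_def by auto
    then have "(v - p *s x) + (w - p *s y) \<in> \<Lambda>" using sub submod_add by blast
    then have "v + w - p *s (x + y) \<in> \<Lambda>" by (simp add: scale_right_distrib algebra_simps)
    then show "v + w \<in> B" unfolding B_def using * sub submod_add by blast
  next
    fix r v assume "r \<in> R" "v \<in> B"
    then obtain x where *: "v \<in> N" "x \<in> N" "v - p *s x \<in> \<Lambda>" unfolding B_def by auto
    then have "r *s (v - p *s x) \<in> \<Lambda>" using sub \<open>r \<in> R\<close> by (intro submod_scale)
    then have "r *s v - p *s (r *s x) \<in> \<Lambda>" by (simp add: scale_right_diff_distrib mult.commute)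
    then show "r *s v \<in> B" unfolding B_def using * sub submod_scale \<open>r \<in> R\<close> by blast
  qed
  have LB: "\<Lambda> \<subseteq> B" unfolding B_def using sub by (auto intro!: bexI[of _ 0])
  have pN: "p *s v \<in> B" if "v \<in> N" for v
    unfolding B_def using that sub p(1) by (auto intro!: bexI[of _ v] submod_scale)
  have pB: "p *s v \<in> \<Lambda>" if v: "v \<in> B" for v
  proof -
    obtain x where x: "x \<in> N" "v - p *s x \<in> \<Lambda>" using v unfolding B_def by auto
    then have "p *s (v - p *s x) + p *s p *s x \<in> \<Lambda>" using sub p submod_add submod_scale by blast
    then show ?thesis by (simp add: scale_right_diff_distrib)
  qed
  have pC: "p *s v \<in> B" if "v \<in> C" for v using that LB unfolding C_def by blast
  have BC: "B \<subseteq> C" using pB unfolding C_def B_def by auto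
  have fgB: "\<exists>gs. set gs \<subseteq> B \<and> (\<forall>v\<in>B. \<exists>y\<in>span_of gs. v - y \<in> \<Lambda>)"
    by (rule finite_generators[OF fin _ sub(2)]) (auto simp: B_def)
  have finB: "\<exists>z\<in>Z. v - z \<in> B" if "v \<in> N" for v using fin(2)[OF that] LB by blast
  have fgC: "\<exists>gs. set gs \<subseteq> C \<and> (\<forall>v\<in>C. \<exists>y\<in>span_of gs. v - y \<in> B)"
    by (rule finite_generators[OF fin(1) finB _ subB]) (auto simp: C_def)
  obtain gs where gs: "decomp (replicate (length gs) p) gs B \<Lambda>"
    using exists_basis[OF subB sub(2) LB p(1) pB field fgB] by blast
  obtain ys where ys: "decomp (replicate (length ys) p) ys C B"
    using exists_basis[OF subC subB BC p(1) pC field fgC] by blast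
  have ysN: "set ys \<subseteq> C" "set gs \<subseteq> B" using ys gs by (auto simp: decomp_def)
  have "\<forall>g\<in>set gs. \<exists>x. x \<in> N \<and> p *s x - g \<in> \<Lambda>"
    using ysN submod_sym[OF sub(2)] unfolding B_def by blast
  from bchoice[OF this] obtain f where "\<forall>g\<in>set gs. f g \<in> N \<and> p *s f g - g \<in> \<Lambda>" by (rule exE)
  then have f: "\<And>g. g \<in> set gs \<Longrightarrow> f g \<in> N \<and> p *s f g - g \<in> \<Lambda>" by simp
  define xs where "xs = map f gs"
  have xsN: "set xs \<subseteq> N" using f by (auto simp: xs_def)
  have lift: "p *s comb rs xs - comb rs gs \<in> \<Lambda>" if "rs \<in> coeffs gs" for rs
    by (rule comb_cong[OF sub(2) _ that]) (auto simp: xs_def f)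
  have cxs: "coeffs xs = coeffs gs" by (auto simp: coeffs_def xs_def)
  have "decomp (replicate (length ys) p @ replicate (length gs) (p\<^sup>2)) (ys @ xs) N \<Lambda>"
    unfolding decomp_def
  proof (intro conjI ballI)
    show "length (ys @ xs) = length (replicate (length ys) p @ replicate (length gs) (p\<^sup>2))"
      by (simp add: xs_def)
    show "set (ys @ xs) \<subseteq> N" using xsN ysN C_def by auto
  next
    fix v assume v: "v \<in> N"
    have split: "\<exists>rs\<in>coeffs gs. b - p *s comb rs xs \<in> \<Lambda>" if b: "b \<in> B" for b
    proof -
      obtain rs where rs: "rs \<in> coeffs gs" "b - comb rs gs \<in> \<Lambda>"
        using b gs unfolding decomp_def span_of_def by fast
      show ?thesis
        using submod_trans[OF sub(2) rs(2) submod_sym[OF sub(2) lift[OF rs(1)]]] rs(1) by blast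
    qed
    \<comment> \<open>Matching \<open>p *s v\<close> by the \<open>xs\<close> moves \<open>v\<close>
      into \<open>C\<close>. What the \<open>ys\<close> leave over there lies in \<open>B\<close>
      and is absorbed as \<open>p\<close> times a further combination of the
      \<open>xs\<close>.\<close>
    obtain rs where rs: "rs \<in> coeffs gs" "p *s v - p *s comb rs xs \<in> \<Lambda>" using split pN v by blast
    have cN: "comb rs xs \<in> N" using comb_in xsN rs sub cxs by blast
    have "v - comb rs xs \<in> C" unfolding C_def
      using rs v cN sub by (auto intro!: submod_diff simp: scale_right_diff_distrib)
    then obtain y where y: "y \<in> span_of ys" "v - comb rs xs - y \<in> B"
      using ys unfolding decomp_def by blast
    then obtain ts where ts: "ts \<in> coeffs gs" "v - comb rs xs - y - p *s comb ts xs \<in> \<Lambda>"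
      using split by blast
    have "comb rs xs \<in> span_of xs" "comb ts xs \<in> span_of xs"
      using rs ts cxs unfolding span_of_def by auto
    then have "comb rs xs + p *s comb ts xs \<in> span_of xs"
      using submod_span p(1) by (intro submod_add submod_scale) auto
    then have "y + (comb rs xs + p *s comb ts xs) \<in> span_of (ys @ xs)"
      using y unfolding span_append by blast
    moreover have "v - (y + (comb rs xs + p *s comb ts xs)) \<in> \<Lambda>" using ts(2) by (simp add: algebra_simps)
    ultimately show "\<exists>y\<in>span_of (ys @ xs). v - y \<in> \<Lambda>" by blast
  next
    fix us assume "us \<in> coeffs (ys @ xs)"
    then obtain ts rs where us: "us = ts @ rs" "ts \<in> coeffs ys" "rs \<in> coeffs gs"
      using cxs by (metis coeffs_appendE)
    have len: "length ts = length ys" "length rs = length gs" using us coeffs_length by auto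
    have cu: "comb us (ys @ xs) = comb ts ys + comb rs xs" using us len by (simp add: comb_append)
    have tC: "comb ts ys \<in> C" using comb_in[OF subC] us ysN by blast
    have indB: "qs \<in> coeffs gs \<Longrightarrow> comb qs gs \<in> \<Lambda> \<longleftrightarrow> list_all2 dvdR (replicate (length gs) p) qs" for qs
      using gs by (simp add: decomp_def)
    have indC: "qs \<in> coeffs ys \<Longrightarrow> comb qs ys \<in> B \<longleftrightarrow> list_all2 dvdR (replicate (length ys) p) qs" for qs
      using ys by (simp add: decomp_def)
    have tL: "comb ts ys \<in> \<Lambda>" if t: "list_all2 dvdR (replicate (length ys) p) ts"
    proof -
      obtain ts' where "length ts' = length ys" "set ts' \<subseteq> R" "ts = map ((*) p) ts'"
        using replicate_dvdE[OF t] by blast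
      then have ts': "ts' \<in> coeffs ys" "ts = map ((*) p) ts'" by (simp_all add: coeffs_def)
      then have "comb ts' ys \<in> C" using comb_in[OF subC] ysN by blast
      then show ?thesis using ts' by (simp add: C_def comb_scale coeffs_length)
    qed
    show "comb us (ys @ xs) \<in> \<Lambda> \<longleftrightarrow>
        list_all2 dvdR (replicate (length ys) p @ replicate (length gs) (p\<^sup>2)) us"
    proof
      assume "comb us (ys @ xs) \<in> \<Lambda>"
      then have L: "comb ts ys + comb rs xs \<in> \<Lambda>" using cu by simp
      \<comment> \<open>Multiplication by \<open>p\<close> kills the \<open>ys\<close> part, which
        yields one factor \<open>p\<close> in \<open>rs\<close>. Then the \<open>xs\<close> part
        lies in \<open>B\<close>, so the \<open>ys\<close> part does too and vanishes modulo
        \<open>\<Lambda>\<close> by independence modulo \<open>B\<close>; the remaining relation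
        yields the second factor.\<close>
      have "p *s comb ts ys \<in> \<Lambda>" using tC by (simp add: C_def)
      then have "p *s (comb ts ys + comb rs xs) - p *s comb ts ys \<in> \<Lambda>"
        by (rule submod_diff[OF sub(2) submod_scale[OF sub(2) p(1) L]])
      then have "p *s comb rs xs \<in> \<Lambda>" by (simp add: scale_right_distrib)
      then have "comb rs gs \<in> \<Lambda>" using submod_cong[OF sub(2) lift[OF us(3)]] by simp
      then have "list_all2 dvdR (replicate (length gs) p) rs" using indB us by blast
      then obtain rs' where rs': "length rs' = length gs" "set rs' \<subseteq> R" "rs = map ((*) p) rs'"
        by (rule replicate_dvdE)
      then have rs'c: "rs' \<in> coeffs gs" by (simp add: coeffs_def)
      have eq: "comb rs xs = p *s comb rs' xs" using rs' by (simp add: comb_scale xs_def)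
      have "comb rs' xs \<in> N" using comb_in[OF sub(1) xsN] rs'c cxs by blast
      then have "comb rs xs \<in> B" using pN eq by simp
      then have "comb ts ys \<in> B"
        using submod_diff[OF subB, of "comb ts ys + comb rs xs" "comb rs xs"] L LB by auto
      then have t: "list_all2 dvdR (replicate (length ys) p) ts" using indC us by blast
      then have "p *s comb rs' xs \<in> \<Lambda>"
        using submod_diff[OF sub(2) L tL] eq by simp
      then have "comb rs' gs \<in> \<Lambda>" using submod_cong[OF sub(2) lift[OF rs'c]] by simp
      then have "list_all2 dvdR (replicate (length gs) p) rs'" using indB rs'c by blast
      then obtain rs'' where rs'': "length rs'' = length gs" "set rs'' \<subseteq> R" "rs' = map ((*) p) rs''"
        by (rule replicate_dvdE)
      then have "rs = map ((*) (p\<^sup>2)) rs''" using rs' by (simp add: power2_eq_square mult.assoc)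
      then have "list_all2 dvdR (replicate (length gs) (p\<^sup>2)) rs"
        using dvd_replicateI[OF rs''(2), of "p\<^sup>2"] rs'' by simp
      then show "list_all2 dvdR (replicate (length ys) p @ replicate (length gs) (p\<^sup>2)) us"
        using t us(1) by (simp add: list_all2_appendI)
    next
      assume "list_all2 dvdR (replicate (length ys) p @ replicate (length gs) (p\<^sup>2)) us"
      then have t: "list_all2 dvdR (replicate (length ys) p) ts"
        and r: "list_all2 dvdR (replicate (length gs) (p\<^sup>2)) rs"
        using us(1) len by (simp_all add: list_all2_append)
      obtain rs' where rs': "length rs' = length gs" "set rs' \<subseteq> R" "rs = map ((*) (p\<^sup>2)) rs'"
        using r by (rule replicate_dvdE)
      have "comb rs' xs \<in> N"
        using comb_in[OF sub(1) xsN, of rs'] rs' by (auto simp: coeffs_def xs_def)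
      from p(3)[OF this] have "comb rs xs \<in> \<Lambda>"
        using rs' by (simp add: comb_scale xs_def power2_eq_square)
      then show "comb us (ys @ xs) \<in> \<Lambda>" using tL[OF t] sub cu submod_add by simp
    qed
  qed
  then show ?thesis by (intro exI)
qed

end

section \<open>Hermitian lattices and primitive isotropic vectors\<close>

text \<open>The axioms isolate the arithmetic: class number one appears as
  \<open>R_principal\<close>, finiteness of \<open>R\<close> modulo 4 as \<open>R_mod_4\<close>, and
  \<open>k_cnj\<close> makes the ideal of \<open>k\<close> stable under conjugation.\<close>

locale hermitian_space = subring_scaling scale R
  for scale :: "complex \<Rightarrow> 'w::ab_group_add \<Rightarrow> 'w" (infixr "*s" 75) and R :: "complex set" +
  fixes F :: "complex set" and k :: complex and V L :: "'w set" and h :: "'w \<Rightarrow> 'w \<Rightarrow> complex"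
  assumes R_F: "R \<subseteq> F"
    and F_add: "a \<in> F \<Longrightarrow> b \<in> F \<Longrightarrow> a + b \<in> F"
    and F_mult: "a \<in> F \<Longrightarrow> b \<in> F \<Longrightarrow> a * b \<in> F"
    and F_inverse: "a \<in> F \<Longrightarrow> inverse a \<in> F"
    and F_cnj: "a \<in> F \<Longrightarrow> cnj a \<in> F"
    and F_real: "a \<in> F \<Longrightarrow> cnj a = a \<Longrightarrow> a \<in> \<rat>"
    and R_cnj: "a \<in> R \<Longrightarrow> cnj a \<in> R"
    and R_rat: "a \<in> R \<Longrightarrow> a \<in> \<rat> \<Longrightarrow> a \<in> \<int>"
    and R_principal: "J \<subseteq> R \<Longrightarrow> 0 \<in> J \<Longrightarrow> (\<And>a b. a \<in> J \<Longrightarrow> b \<in> J \<Longrightarrow> a + b \<in> J) \<Longrightarrow>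
      (\<And>r a. r \<in> R \<Longrightarrow> a \<in> J \<Longrightarrow> r * a \<in> J) \<Longrightarrow> \<exists>g\<in>R. J = {r * g | r. r \<in> R}"
    and R_mod_4: "\<exists>Z. finite Z \<and> (\<forall>r\<in>R. \<exists>z\<in>Z. dvdR 4 (r - z))"
    and k_F: "k \<in> F" and k_nz: "k \<noteq> 0" and k_cnj: "cnj k = - k"
    and V_0: "0 \<in> V" and V_add: "x \<in> V \<Longrightarrow> y \<in> V \<Longrightarrow> x + y \<in> V"
    and V_scale: "a \<in> F \<Longrightarrow> x \<in> V \<Longrightarrow> a *s x \<in> V"
    and L_V: "L \<subseteq> V" and L_submod: "submod L"
    and L_generated: "\<exists>ss. set ss \<subseteq> L \<and> L \<subseteq> span_of ss"
    and L_denominator: "x \<in> V \<Longrightarrow> \<exists>r\<in>R. r \<noteq> 0 \<and> r *s x \<in> L"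
    and h_F: "x \<in> V \<Longrightarrow> y \<in> V \<Longrightarrow> h x y \<in> F"
    and h_add: "x \<in> V \<Longrightarrow> y \<in> V \<Longrightarrow> z \<in> V \<Longrightarrow> h (x + y) z = h x z + h y z"
    and h_scale: "a \<in> F \<Longrightarrow> x \<in> V \<Longrightarrow> y \<in> V \<Longrightarrow> h (a *s x) y = a * h x y"
    and h_cnj: "x \<in> V \<Longrightarrow> y \<in> V \<Longrightarrow> h y x = cnj (h x y)"
    and h_L: "x \<in> L \<Longrightarrow> y \<in> L \<Longrightarrow> \<exists>r\<in>R. h x y = k * r"
    and L_nondegenerate: "x \<in> L \<Longrightarrow> (\<And>y. y \<in> L \<Longrightarrow> h x y = 0) \<Longrightarrow> x = 0"
begin

section \<open>The dual lattice and integrality of the form\<close>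

definition kR :: "complex set" where
  "kR = {k * r | r. r \<in> R}"

definition D :: "'w set" where
  "D = {v \<in> V. \<forall>l\<in>L. h v l \<in> kR}"

lemma kR_iff: "x \<in> kR \<longleftrightarrow> x / k \<in> R"
proof
  assume "x / k \<in> R"
  moreover have "x = k * (x / k)" using k_nz by simp
  ultimately show "x \<in> kR" unfolding kR_def by blast
qed (use k_nz in \<open>auto simp: kR_def\<close>)

lemma kR_add: "x \<in> kR \<Longrightarrow> y \<in> kR \<Longrightarrow> x + y \<in> kR"
  by (auto simp: kR_iff add_divide_distrib)

lemma kR_diff: "x \<in> kR \<Longrightarrow> y \<in> kR \<Longrightarrow> x - y \<in> kR"
  by (auto simp: kR_iff diff_divide_distrib)

lemma kR_uminus: "x \<in> kR \<Longrightarrow> - x \<in> kR"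
  using R_uminus by (auto simp: kR_iff)

lemma kR_0 [simp]: "0 \<in> kR"
  by (auto simp: kR_iff)

lemma kR_mult: "r \<in> R \<Longrightarrow> x \<in> kR \<Longrightarrow> r * x \<in> kR"
  using R_mult[of r "x / k"] by (simp add: kR_iff)

lemma kR_cnj: "x \<in> kR \<Longrightarrow> cnj x \<in> kR"
  using R_cnj[of "x / k"] R_uminus[of "cnj (x / k)"] by (simp add: kR_iff k_cnj)

lemma F_R [simp]: "x \<in> R \<Longrightarrow> x \<in> F"
  using R_F by blast

lemma F_minus_1 [simp]: "- 1 \<in> F"
  using R_uminus[OF R_1] by simp

lemma F_uminus: "x \<in> F \<Longrightarrow> - x \<in> F"
  using F_mult[of "- 1" x] by auto

lemma F_divide: "x \<in> F \<Longrightarrow> y \<in> F \<Longrightarrow> x / y \<in> F"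
  by (simp add: divide_inverse F_mult F_inverse)

lemma V_uminus: "x \<in> V \<Longrightarrow> - x \<in> V"
  using V_scale[of "- 1" x] by auto

lemma V_diff: "x \<in> V \<Longrightarrow> y \<in> V \<Longrightarrow> x - y \<in> V"
  using V_add[of x "- y"] V_uminus[of y] by simp

lemma V_L [simp]: "x \<in> L \<Longrightarrow> x \<in> V"
  using L_V by blast

lemma V_D [simp]: "x \<in> D \<Longrightarrow> x \<in> V"
  by (simp add: D_def)

lemmas V_closed = V_add V_diff V_scale V_uminus

lemma h_uminus: "x \<in> V \<Longrightarrow> y \<in> V \<Longrightarrow> h (- x) y = - h x y"
  using h_scale[of "- 1" x y] by auto

lemma h_diff: "x \<in> V \<Longrightarrow> y \<in> V \<Longrightarrow> z \<in> V \<Longrightarrow> h (x - y) z = h x z - h y z"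
  using h_add[of x "- y" z] h_uminus[of y z] V_uminus[of y] by simp

lemma h_0: "x \<in> V \<Longrightarrow> h 0 x = 0"
  using h_scale[of 0 x x] by simp

lemma h_0_right: "x \<in> V \<Longrightarrow> h x 0 = 0"
  using h_cnj[of 0 x] h_0 V_0 by simp

lemma h_add_right: "x \<in> V \<Longrightarrow> y \<in> V \<Longrightarrow> z \<in> V \<Longrightarrow> h z (x + y) = h z x + h z y"
  using h_add[of x y z] h_cnj[of "x + y" z] h_cnj[of x z] h_cnj[of y z] V_add by simp

lemma h_scale_right: "a \<in> F \<Longrightarrow> x \<in> V \<Longrightarrow> y \<in> V \<Longrightarrow> h y (a *s x) = cnj a * h y x"
  using h_scale[of a x y] h_cnj[of "a *s x" y] h_cnj[of x y] V_scale by simp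

lemma h_uminus_right: "x \<in> V \<Longrightarrow> y \<in> V \<Longrightarrow> h y (- x) = - h y x"
  using h_scale_right[of "- 1" x y] by auto

lemma h_diff_right: "x \<in> V \<Longrightarrow> y \<in> V \<Longrightarrow> z \<in> V \<Longrightarrow> h z (x - y) = h z x - h z y"
  using h_add_right[of x "- y" z] h_uminus_right[of y z] V_uminus[of y] by simp

lemmas h_expand = h_add h_diff h_scale h_uminus h_add_right h_diff_right h_scale_right h_uminus_right

lemma nondegenerate:
  assumes "x \<in> V" and "\<And>y. y \<in> V \<Longrightarrow> h x y = 0"
  shows "x = 0"
proof -
  obtain r where r: "r \<in> R" "r \<noteq> 0" "r *s x \<in> L" using L_denominator assms(1) by blast
  have "r *s x = 0" using r assms by (intro L_nondegenerate) (auto simp: h_scale)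
  then show ?thesis using r by simp
qed

lemma submod_D: "submod D"
  unfolding submod_def D_def using V_0 h_0 kR_add kR_mult
  by (simp add: V_closed h_expand)

lemma L_D: "L \<subseteq> D"
  using h_L L_V unfolding D_def kR_def by blast

lemma h_D_L: "v \<in> D \<Longrightarrow> l \<in> L \<Longrightarrow> h v l \<in> kR"
  unfolding D_def by blast

lemma h_L_D: "v \<in> D \<Longrightarrow> l \<in> L \<Longrightarrow> h l v \<in> kR"
  using kR_cnj[of "h v l"] h_D_L[of v l] h_cnj[of v l] by simp

text \<open>Divided by \<open>k\<close>, the values form an ideal of \<open>R\<close>. The submodule
  \<open>N\<close> is arbitrary because the lemma is applied to \<open>L\<close>, to the dual
  lattice and to the isotropic sublattice alike.\<close>

lemma values_principal:
  assumes N: "submod N" "N \<subseteq> V" and v: "v \<in> V" "\<And>l. l \<in> N \<Longrightarrow> h l v \<in> kR"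
  obtains g l0 where "g \<in> R" "l0 \<in> N" "h l0 v = k * g" "\<And>l. l \<in> N \<Longrightarrow> \<exists>r\<in>R. h l v = k * (r * g)"
proof -
  define J where "J = {x. \<exists>l\<in>N. h l v = k * x}"
  have NV: "l \<in> V" if "l \<in> N" for l using that N(2) by blast
  have "\<exists>g\<in>R. J = {r * g | r. r \<in> R}"
  proof (rule R_principal)
    show "J \<subseteq> R"
    proof
      fix x assume "x \<in> J"
      then obtain l where "l \<in> N" "h l v = k * x" by (auto simp: J_def)
      then show "x \<in> R" using v(2)[of l] k_nz by (simp add: kR_iff)
    qed
    show "0 \<in> J" unfolding J_def using N(1) h_0[OF v(1)] by auto
    show "x + y \<in> J" if "x \<in> J" "y \<in> J" for x y
    proof -
      obtain l m where "l \<in> N" "m \<in> N" "h l v = k * x" "h m v = k * y"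
        using \<open>x \<in> J\<close> \<open>y \<in> J\<close> J_def by auto
      then have "h (l + m) v = k * (x + y)" "l + m \<in> N"
        using N(1) NV v(1) by (auto simp: h_expand algebra_simps submod_add)
      then show ?thesis unfolding J_def by blast
    qed
    show "r * x \<in> J" if r: "r \<in> R" and x: "x \<in> J" for r x
    proof -
      obtain l where "l \<in> N" "h l v = k * x" using x J_def by auto
      then have "h (r *s l) v = k * (r * x)" "r *s l \<in> N"
        using r N(1) NV v(1) by (auto simp: h_expand algebra_simps submod_scale)
      then show ?thesis unfolding J_def by blast
    qed
  qed
  then obtain g where g: "g \<in> R" "J = {r * g | r. r \<in> R}" by blast
  have "g \<in> J" unfolding g(2) using R_1 by force
  then obtain l0 where l0: "l0 \<in> N" "h l0 v = k * g" unfolding J_def by blast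
  have "\<exists>r\<in>R. h l v = k * (r * g)" if "l \<in> N" for l
  proof -
    have "h l v = k * (h l v / k)" using k_nz by simp
    then have "h l v / k \<in> J" unfolding J_def using that by blast
    then show ?thesis using g k_nz by (auto simp: field_simps)
  qed
  then show thesis using that g(1) l0 by blast
qed

text \<open>The induction splits off a vector of \<open>M\<close> on which the functional \<open>h _ v\<close> takes a generator of
  its ideal of values; the rest of \<open>M\<close> lies in the kernel of that functional.\<close>

lemma reflexive_aux:
  assumes "submod M" "M \<subseteq> V" "set vs \<subseteq> V"
    and "\<And>l v. l \<in> M \<Longrightarrow> v \<in> set vs \<Longrightarrow> h l v \<in> kR"
    and "\<And>l. l \<in> M \<Longrightarrow> (\<And>v. v \<in> set vs \<Longrightarrow> h l v = 0) \<Longrightarrow> l = 0"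
    and "w \<in> V" "\<exists>r\<in>R. r \<noteq> 0 \<and> r *s w \<in> M"
    and "\<And>v. v \<in> V \<Longrightarrow> (\<And>l. l \<in> M \<Longrightarrow> h l v \<in> kR) \<Longrightarrow> h w v \<in> kR"
  shows "w \<in> M"
  using assms
proof (induction vs arbitrary: M w)
  case Nil
  obtain r where "r \<in> R" "r \<noteq> 0" "r *s w \<in> M" using Nil.prems(7) by blast
  then have "w = 0" using Nil.prems(5)[of "r *s w"] by simp
  then show ?case using Nil.prems(1) by simp
next
  case (Cons v vs)
  note M = Cons.prems(1) and MV = Cons.prems(2)
  have v: "v \<in> V" using Cons.prems(3) by simp
  have MV': "x \<in> V" if "x \<in> M" for x using that MV by blast
  obtain g l0 where g: "g \<in> R" and l0: "l0 \<in> M" "h l0 v = k * g"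
    and val: "\<And>l. l \<in> M \<Longrightarrow> \<exists>r\<in>R. h l v = k * (r * g)"
    using values_principal[OF M MV v] Cons.prems(4) by (metis list.set_intros(1))
  show ?case
  proof (cases "g = 0")
    case True
    have z: "h l v = 0" if "l \<in> M" for l using val[OF that] True by auto
    show ?thesis
    proof (rule Cons.IH[OF M MV])
      show "set vs \<subseteq> V" using Cons.prems(3) by simp
      show "\<And>l v. l \<in> M \<Longrightarrow> v \<in> set vs \<Longrightarrow> h l v \<in> kR" using Cons.prems(4) by simp
      show "l = 0" if "l \<in> M" "\<And>v. v \<in> set vs \<Longrightarrow> h l v = 0" for l
        using Cons.prems(5)[OF that(1)] that(2) z[OF that(1)] by (metis set_ConsD)
    qed (use Cons.prems in auto)
  next
    case False
    define c where "c = (\<lambda>x. h x v / (k * g))"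
    \<comment> \<open>Projection along \<open>l0\<close> onto the kernel of \<open>h _ v\<close>; it
      preserves \<open>M\<close> because \<open>c\<close> is integral there.\<close>
    define p where "p = (\<lambda>x. x - c x *s l0)"
    have kg: "k * g \<in> F" "k * g \<noteq> 0" using k_F g F_mult False k_nz by auto
    have cF: "c x \<in> F" if "x \<in> V" for x unfolding c_def using h_F[OF that v] kg F_divide by blast
    have cR: "c x \<in> R" if "x \<in> M" for x
    proof -
      obtain r where r: "r \<in> R" "h x v = k * (r * g)" using val[OF \<open>x \<in> M\<close>] by blast
      then have "c x = r" unfolding c_def using kg by (simp add: field_simps)
      then show ?thesis using r by simp
    qed
    have pV: "p x \<in> V" if "x \<in> V" for x
      unfolding p_def using that cF l0 MV' by (auto intro!: V_closed)
    have pv: "h (p x) v = 0" if "x \<in> V" for x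
      using that cF l0 MV' v kg by (simp add: p_def h_expand V_closed c_def)
    define M' where "M' = {l \<in> M. h l v = 0}"
    have pM: "p x \<in> M'" if "x \<in> M" for x
      using that pv MV' M l0 cR by (auto simp: M'_def p_def intro!: submod_diff submod_scale)
    \<comment> \<open>The scaling makes \<open>h x u = k * c x\<close>, so testing \<open>w\<close>
      against \<open>u\<close> shows that the coordinate \<open>c w\<close> is integral.\<close>
    define u where "u = inverse (cnj g) *s v"
    have gF: "inverse (cnj g) \<in> F" "g \<in> F" using g by (auto intro!: F_inverse F_cnj)
    have uV: "u \<in> V" unfolding u_def using gF v V_scale by blast
    have hu: "h x u = h x v / g" if "x \<in> V" for x
      unfolding u_def using that v gF by (simp add: h_expand field_simps)
    have "h w u \<in> kR"
    proof (rule Cons.prems(8)[OF uV])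
      fix l assume l: "l \<in> M"
      have "h l u = k * c l" using hu MV'[OF l] kg by (simp add: c_def field_simps)
      then show "h l u \<in> kR" using cR[OF l] by (auto simp: kR_def)
    qed
    then have cw: "c w \<in> R" using hu[OF Cons.prems(6)] kg by (simp add: kR_iff c_def field_simps)
    have "p w \<in> M'"
    proof (rule Cons.IH)
      show "submod M'" unfolding submod_def M'_def using M MV' v h_0[OF v]
        by (auto simp: h_expand submod_add submod_scale)
      show "M' \<subseteq> V" "set vs \<subseteq> V" using MV Cons.prems(3) by (auto simp: M'_def)
      show "h l x \<in> kR" if "l \<in> M'" "x \<in> set vs" for l x
        using Cons.prems(4) that by (simp add: M'_def)
      show "l = 0" if "l \<in> M'" "\<And>v. v \<in> set vs \<Longrightarrow> h l v = 0" for l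
        using Cons.prems(5)[of l] that by (auto simp: M'_def)
      show "p w \<in> V" using pV Cons.prems(6) by simp
      obtain r where r: "r \<in> R" "r \<noteq> 0" "r *s w \<in> M" using Cons.prems(7) by blast
      have "p (r *s w) = r *s p w"
        using r v Cons.prems(6) by (simp add: p_def c_def h_expand scale_right_diff_distrib)
      then show "\<exists>r\<in>R. r \<noteq> 0 \<and> r *s p w \<in> M'" using pM r by metis
      fix x assume x: "x \<in> V" "\<And>l. l \<in> M' \<Longrightarrow> h l x \<in> kR"
      \<comment> \<open>Chosen so that passing from \<open>x\<close> to \<open>x'\<close> is adjoint
        to the projection, \<open>h y x' = h (p y) x\<close>. Testing \<open>p w\<close> against
        \<open>x\<close> thereby becomes testing \<open>w\<close> against \<open>x'\<close>.\<close>
      define b where "b = cnj (h l0 x / (k * g))"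
      have bF: "b \<in> F" unfolding b_def using h_F[of l0 x] MV' l0 x kg by (intro F_cnj F_divide) auto
      define x' where "x' = x - b *s v"
      have x'V: "x' \<in> V" unfolding x'_def using x v bF by (intro V_closed)
      have adj: "h y x' = h (p y) x" if "y \<in> V" for y
        using that x v bF cF[OF that] l0 MV' kg
        by (simp add: x'_def p_def h_expand V_closed b_def c_def field_simps)
      have "h w x' \<in> kR"
      proof (rule Cons.prems(8)[OF x'V])
        fix l assume "l \<in> M"
        then show "h l x' \<in> kR" using adj MV' pM x(2) by simp
      qed
      then show "h (p w) x \<in> kR" using adj Cons.prems(6) by simp
    qed
    then have "p w + c w *s l0 \<in> M" using cw M l0 by (intro submod_add submod_scale) (auto simp: M'_def)
    then show ?thesis by (simp add: p_def)
  qed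
qed

text \<open>A finite generating list of \<open>L\<close> supplies the functionals for
  \<open>reflexive_aux\<close>; they separate the points of \<open>L\<close> by nondegeneracy. That
  \<open>L\<close> is its own double dual is later used to divide \<open>e\<close> inside
  \<open>L\<close> and to show that a vector orthogonal to \<open>D\<close> is trivial modulo
  \<open>L\<close>.\<close>

lemma reflexive:
  assumes w: "w \<in> V" and "\<And>v. v \<in> D \<Longrightarrow> h v w \<in> kR"
  shows "w \<in> L"
proof -
  obtain ss where ss: "set ss \<subseteq> L" "L \<subseteq> span_of ss" using L_generated by blast
  show ?thesis
  proof (rule reflexive_aux[OF L_submod L_V, of ss])
    show "set ss \<subseteq> V" using ss L_V by blast
    show "h l v \<in> kR" if "l \<in> L" "v \<in> set ss" for l v
      using that ss h_L_D L_D by blast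
    show "l = 0" if l: "l \<in> L" "\<And>v. v \<in> set ss \<Longrightarrow> h l v = 0" for l
    proof (rule L_nondegenerate[OF l(1)])
      fix y assume "y \<in> L"
      have "submod {y \<in> L. h l y = 0}" unfolding submod_def using L_submod l(1)
        by (auto simp: h_0_right h_expand submod_add submod_scale)
      then have "span_of ss \<subseteq> {y \<in> L. h l y = 0}" using ss l(2) by (intro span_subset) auto
      then show "h l y = 0" using ss \<open>y \<in> L\<close> by blast
    qed
    show "h w v \<in> kR" if v: "v \<in> V" "\<And>l. l \<in> L \<Longrightarrow> h l v \<in> kR" for v
    proof -
      have "h v l \<in> kR" if "l \<in> L" for l
        using kR_cnj[OF v(2)[OF that]] h_cnj[of l v] v(1) that by simp
      then have "v \<in> D" using v(1) unfolding D_def by blast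
      then show ?thesis using assms(2)[of v] kR_cnj[of "h v w"] h_cnj[of v w] v(1) w by simp
    qed
  qed (use w L_denominator in auto)
qed

end

section \<open>Primitive isotropic vectors and their transvections\<close>

locale isotropic_vector = hermitian_space scale R F k V L h
  for scale :: "complex \<Rightarrow> 'w::ab_group_add \<Rightarrow> 'w" (infixr "*s" 75) and R F k V L h +
  fixes e :: 'w
  assumes e_L: "e \<in> L" and e_nz: "e \<noteq> 0" and e_isotropic: "h e e = 0"
    and e_primitive: "x \<in> F \<Longrightarrow> x *s e \<in> L \<Longrightarrow> x \<in> R"
begin

lemma e_V [simp]: "e \<in> V"
  using e_L by simp

text \<open>If the values \<open>h v e\<close> on \<open>D\<close> are the multiples of
  \<open>k * g\<close>, then \<open>e\<close> divided by \<open>cnj g\<close> pairs integrally with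
  \<open>D\<close> and lies in \<open>L\<close> by reflexivity; primitivity of \<open>e\<close>
  makes \<open>g\<close> a unit.\<close>

lemma exists_dual_vector: "\<exists>v\<in>D. h v e = k"
proof -
  obtain g v where g: "g \<in> R" and v: "v \<in> D" "h v e = k * g"
    and all: "\<And>v. v \<in> D \<Longrightarrow> \<exists>r\<in>R. h v e = k * (r * g)"
    using values_principal[OF submod_D _ e_V h_D_L[OF _ e_L]] V_D by blast
  have "g \<noteq> 0"
  proof
    assume "g = 0"
    then have "h e l = 0" if "l \<in> L" for l
      using all[of l] L_D that h_cnj[of l e] by auto
    then show False using L_nondegenerate e_L e_nz by blast
  qed
  define e' where "e' = inverse (cnj g) *s e"
  have gF: "inverse (cnj g) \<in> F" using g by (auto intro!: F_inverse F_cnj)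
  have "e' \<in> L"
  proof (rule reflexive)
    show "e' \<in> V" unfolding e'_def using gF by (intro V_scale) auto
    fix v assume v: "v \<in> D"
    obtain r where r: "r \<in> R" "h v e = k * (r * g)" using all v by blast
    then have "h v e' = k * r" using v gF \<open>g \<noteq> 0\<close> by (simp add: e'_def h_expand)
    then show "h v e' \<in> kR" using r by (auto simp: kR_def)
  qed
  then have "inverse (cnj g) \<in> R" using e_primitive gF e'_def by simp
  then have "inverse g \<in> R" using R_cnj[of "inverse (cnj g)"] by simp
  then have "inverse g *s v \<in> D" "h (inverse g *s v) e = k"
    using v \<open>g \<noteq> 0\<close> submod_scale[OF submod_D] by (simp_all add: h_expand)
  then show ?thesis by blast
qed

definition v0 :: 'w where
  "v0 = (SOME v. v \<in> D \<and> h v e = k)"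

lemma v0_D [simp]: "v0 \<in> D" and h_v0_e [simp]: "h v0 e = k"
  using someI_ex[of "\<lambda>v. v \<in> D \<and> h v e = k"] exists_dual_vector unfolding v0_def by blast+

lemma h_e_v0 [simp]: "h e v0 = - k"
  using h_cnj[of v0 e] by (simp add: k_cnj)

text \<open>\<open>T\<close> is determined by \<open>T v0\<close>, since \<open>v0\<close> and the
  orthogonal complement of \<open>e\<close> span \<open>V\<close>. The displacement
  \<open>T v0 - v0\<close> is orthogonal to that complement, hence a multiple of \<open>e\<close>,
  and the norm of \<open>v0\<close> being preserved forces the factor to be real.\<close>

lemma transvection:
  assumes TV: "\<And>x. x \<in> V \<Longrightarrow> T x \<in> V" and Tadd: "\<And>x y. x \<in> V \<Longrightarrow> y \<in> V \<Longrightarrow> T (x + y) = T x + T y"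
    and Tscale: "\<And>a x. a \<in> F \<Longrightarrow> x \<in> V \<Longrightarrow> T (a *s x) = a *s T x"
    and Th: "\<And>x y. x \<in> V \<Longrightarrow> y \<in> V \<Longrightarrow> h (T x) (T y) = h x y"
    and Tid: "\<And>x. x \<in> V \<Longrightarrow> h x e = 0 \<Longrightarrow> T x = x"
  shows "\<exists>q\<in>\<rat>. \<forall>v\<in>V. T v = v + (h v e / k * q) *s e"
proof -
  define y where "y = T v0 - v0"
  \<comment> \<open>The divisor is \<open>h e v0 = - k\<close>, so that \<open>y\<close> and
    \<open>q *s e\<close> pair equally with \<open>v0\<close>.\<close>
  define q where "q = h y v0 / (- k)"
  have yV: "y \<in> V" unfolding y_def using TV by (intro V_closed) auto
  have qF: "q \<in> F" unfolding q_def using yV k_F by (intro F_divide h_F F_uminus) auto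
  have dec: "v - (h v e / k) *s v0 \<in> V \<and> h (v - (h v e / k) *s v0) e = 0" "h v e / k \<in> F" if "v \<in> V" for v
  proof -
    show *: "h v e / k \<in> F" using that k_F by (intro F_divide h_F) auto
    show "v - (h v e / k) *s v0 \<in> V \<and> h (v - (h v e / k) *s v0) e = 0"
      using that * k_nz by (auto simp: h_expand V_closed)
  qed
  have yu: "h y u = 0" if "u \<in> V" "h u e = 0" for u
    using Th[of v0 u] Tid[OF that] that TV by (simp add: y_def h_expand)
  have Te: "T e = e" using Tid e_isotropic by simp
  have eu: "h e u = 0" if "u \<in> V" "h u e = 0" for u
    using that h_cnj[of u e] by simp
  have "y - q *s e = 0"
  proof (rule nondegenerate)
    show "y - q *s e \<in> V" using yV qF by (intro V_closed) auto
    fix v assume v: "v \<in> V"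
    define u where "u = v - (h v e / k) *s v0"
    have u: "u \<in> V" "h u e = 0" using dec v u_def by auto
    have "v = u + (h v e / k) *s v0" by (simp add: u_def)
    moreover have "h (y - q *s e) u = 0" using u yu eu yV qF by (simp add: h_expand V_closed)
    moreover have "h (y - q *s e) v0 = h y v0 + q * k" using yV qF by (simp add: h_expand V_closed)
    then have "h (y - q *s e) v0 = 0" using k_nz by (simp add: q_def)
    ultimately show "h (y - q *s e) v = 0"
      using dec(2)[OF v] u yV qF by (metis V_D V_diff V_scale add_0 e_V h_add_right h_scale_right mult_zero_right v0_D)
  qed
  then have Tv0: "T v0 = v0 + q *s e" by (simp add: y_def algebra_simps)
  \<comment> \<open>The cross terms are \<open>- q * k\<close> and \<open>cnj q * k\<close>, because
    \<open>k\<close> is purely imaginary; as the norm is unchanged they must cancel.\<close>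
  have "h (T v0) (T v0) = h v0 v0 + q * h e v0 + cnj q * h v0 e + q * cnj q * h e e"
    unfolding Tv0 using qF F_cnj by (simp add: h_expand V_closed algebra_simps)
  then have "cnj q * k = q * k" using Th[of v0 v0] e_isotropic by simp
  then have "q \<in> \<rat>" using F_real qF k_nz by simp
  moreover have "T v = v + (h v e / k * q) *s e" if v: "v \<in> V" for v
  proof -
    define u where "u = v - (h v e / k) *s v0"
    have u: "u \<in> V" "h u e = 0" using dec v u_def by auto
    have "v = u + (h v e / k) *s v0" by (simp add: u_def)
    then have "T v = u + (h v e / k) *s (v0 + q *s e)"
      using Tadd[of u "(h v e / k) *s v0"] Tscale[of "h v e / k" v0] Tid u dec(2)[OF v] Tv0 by (simp add: V_scale)
    then show ?thesis by (simp add: u_def scale_right_distrib)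
  qed
  ultimately show ?thesis by blast
qed

lemma twist_imp_scalar:
  assumes q: "q \<in> \<rat>" and \<alpha>: "\<alpha> \<in> R" and c: "{h l e | l. l \<in> L} = {x * c | x. x \<in> R}"
    and twist: "\<forall>v\<in>D. \<alpha> *s v + (h v e / k * q) *s e \<in> L"
  shows "c / k \<in> R" "c \<noteq> 0" "\<alpha> / cnj (c / k) \<in> R" "q * cnj (c / k) \<in> R"
    "q \<in> \<int> \<Longrightarrow> v \<in> D \<Longrightarrow> \<alpha> *s v \<in> L"
proof -
  note tw = bspec[OF twist]
  have "1 * c \<in> {x * c | x. x \<in> R}" using R_1 by blast
  then have "c \<in> {h l e | l. l \<in> L}" using c by simp
  then obtain l1 where l1: "l1 \<in> L" "h l1 e = c" by blast
  show ck: "c / k \<in> R" using h_D_L[of l1 e] l1 L_D e_L by (auto simp: kR_iff)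
  show c0: "c \<noteq> 0"
  proof
    assume "c = 0"
    have "h l e \<in> {x * c | x. x \<in> R}" if "l \<in> L" for l using c that by blast
    then have "h l e = 0" if "l \<in> L" for l using that \<open>c = 0\<close> by auto
    then have "h e l = 0" if "l \<in> L" for l using that h_cnj[of l e] by simp
    then show False using L_nondegenerate e_L e_nz by blast
  qed
  \<comment> \<open>The conjugate appears because \<open>h e l\<close> is the conjugate of
    \<open>h l e\<close>, a multiple of \<open>c\<close>; dividing \<open>e\<close> by
    \<open>\<delta>\<close> therefore keeps its pairings with \<open>L\<close> in
    \<open>kR\<close>.\<close>
  define \<delta> where "\<delta> = cnj (c / k)"
  have \<delta>: "\<delta> \<in> R" "\<delta> \<noteq> 0" unfolding \<delta>_def using R_cnj[OF ck] c0 k_nz by simp_all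
  have \<delta>F: "inverse \<delta> \<in> F" using \<delta> by (intro F_inverse) auto
  have qF: "q \<in> F"
  proof -
    obtain a b :: int where "q = of_int a / of_int b"
      using Rats_cases'[OF q] by metis
    then show ?thesis by (simp add: F_divide)
  qed
  have eD: "inverse \<delta> *s e \<in> D"
    unfolding D_def
  proof (intro CollectI conjI ballI)
    show "inverse \<delta> *s e \<in> V" using \<delta>F by (intro V_scale) auto
    fix l assume l: "l \<in> L"
    then obtain x where x: "x \<in> R" "h l e = x * c" using c by blast
    have "h (inverse \<delta> *s e) l = cnj (x * c) / \<delta>"
      using \<delta>F l h_cnj[of l e] x(2) by (simp add: h_expand field_simps)
    also have "\<dots> = k * (- cnj x)" using c0 k_nz by (simp add: \<delta>_def k_cnj field_simps)
    finally show "h (inverse \<delta> *s e) l \<in> kR"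
      using R_uminus[OF R_cnj[OF x(1)]] unfolding kR_def by blast
  qed
  have "\<alpha> *s inverse \<delta> *s e \<in> L"
    using tw[OF eD] \<delta>F e_isotropic by (simp add: h_expand)
  then show "\<alpha> / cnj (c / k) \<in> R"
    using e_primitive[of "\<alpha> / \<delta>"] \<alpha> \<delta>F by (simp add: divide_inverse \<delta>_def F_mult)
  \<comment> \<open>The vector \<open>\<alpha> *s v0\<close> is only known to lie in
    \<open>D\<close>, so only \<open>q *s e \<in> D\<close> results. Pairing with \<open>l1\<close>,
    where \<open>h l1 e = c\<close>, gives integrality of \<open>q * \<delta>\<close> instead of
    \<open>q\<close>.\<close>
  have "(\<alpha> *s v0 + q *s e) - \<alpha> *s v0 \<in> D"
    using subsetD[OF L_D tw[OF v0_D]] k_nz submod_D \<alpha> by (intro submod_diff submod_scale) auto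
  then have "h (q *s e) l1 \<in> kR" using h_D_L l1 by simp
  moreover have "h (q *s e) l1 = k * (- (q * \<delta>))"
    using qF l1 h_cnj[of l1 e] k_nz by (simp add: h_expand \<delta>_def k_cnj)
  ultimately have "- (q * \<delta>) \<in> R" using k_nz by (simp add: kR_iff)
  then show "q * cnj (c / k) \<in> R" using R_uminus[of "- (q * \<delta>)"] unfolding \<delta>_def by simp
  show "\<alpha> *s v \<in> L" if "q \<in> \<int>" "v \<in> D" for v
  proof -
    have "q \<in> R" using that(1) by (auto elim!: Ints_cases)
    moreover have "h v e / k \<in> R" using h_D_L[OF that(2) e_L] by (simp add: kR_iff)
    ultimately have "\<alpha> *s v + (h v e / k * q) *s e - (h v e / k * q) *s e \<in> L"
      using tw[OF that(2)] e_L L_submod R_mult[of "h v e / k" q]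
      by (intro submod_diff submod_scale) auto
    then show ?thesis by simp
  qed
qed

end

section \<open>Twists by minus one\<close>

text \<open>In lowest terms the square of the denominator divides \<open>N\<close>. This serves both
  the coefficient \<open>q\<close> of a twist and the denominators of quadratic integers.\<close>

lemma rational_times_squarefree_int:
  fixes q :: complex and N :: nat
  assumes q: "q \<in> \<rat>" and N: "squarefree N" and i: "q\<^sup>2 * of_nat N \<in> \<int>"
  shows "q \<in> \<int>"
proof -
  obtain a b :: int where ab: "b > 0" "coprime a b" "q = of_int a / of_int b"
    using Rats_cases'[OF q] by metis
  obtain z where z: "q\<^sup>2 * of_nat N = of_int z" using i by (auto elim: Ints_cases)
  have "(of_int (a\<^sup>2 * int N) :: complex) = of_int (b\<^sup>2 * z)"
    using z ab by (simp add: field_simps power2_eq_square)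
  then have "a\<^sup>2 * int N = b\<^sup>2 * z" by (simp only: of_int_eq_iff)
  then have "b\<^sup>2 dvd a\<^sup>2 * int N" by simp
  moreover have "coprime (b\<^sup>2) (a\<^sup>2)" using ab by (simp add: coprime_commute)
  ultimately have "b\<^sup>2 dvd int N" using coprime_dvd_mult_right_iff by blast
  then have "int ((nat b)\<^sup>2) dvd int N" using ab by simp
  then have "(nat b)\<^sup>2 dvd N" by (simp only: int_dvd_int_iff)
  then have "nat b dvd 1" using N by (meson squarefreeD)
  then have "b = 1" using ab by simp
  then show ?thesis using ab by simp
qed

context isotropic_vector
begin

lemma twist_imp_scalar_squarefree:
  assumes q: "q \<in> \<rat>" and \<alpha>: "\<alpha> \<in> R" and c: "{h l e | l. l \<in> L} = {x * c | x. x \<in> R}"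
    and tw: "\<forall>v\<in>D. \<alpha> *s v + (h v e / k * q) *s e \<in> L"
    and N: "cnj \<alpha> * \<alpha> = of_nat N" "squarefree N" and v: "v \<in> D"
  shows "\<alpha> *s v \<in> L"
proof -
  note * = twist_imp_scalar[OF q \<alpha> c tw]
  have "(\<alpha> / cnj (c / k)) * (q * cnj (c / k)) \<in> R" by (rule R_mult[OF *(3) *(4)])
  moreover have "(\<alpha> / cnj (c / k)) * (q * cnj (c / k)) = q * \<alpha>" using *(2) k_nz by simp
  ultimately have qa: "q * \<alpha> \<in> R" by simp
  have "cnj q = q"
    using Rats_cases'[OF q] by (metis complex_cnj_divide complex_cnj_of_int)
  then have "cnj (q * \<alpha>) * (q * \<alpha>) = q\<^sup>2 * of_nat N"
    using N by (simp add: power2_eq_square algebra_simps)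
  then have "q\<^sup>2 * of_nat N \<in> R" using R_mult[OF R_cnj[OF qa] qa] by simp
  moreover have "q\<^sup>2 * of_nat N \<in> \<rat>" using q by simp
  ultimately have "q\<^sup>2 * of_nat N \<in> \<int>" by (rule R_rat)
  then have "q \<in> \<int>" using rational_times_squarefree_int q N by blast
  then show ?thesis using *(5) v by blast
qed

lemma dvdR_iff: "p \<noteq> 0 \<Longrightarrow> dvdR p r \<longleftrightarrow> r / p \<in> R"
  unfolding dvdR_def by (metis nonzero_mult_div_cancel_left times_divide_eq_right)

text \<open>The norm 4 of \<open>2\<close> is not squarefree, so \<open>q\<close> may be a
  half-integer, and it must be one since \<open>2\<close> itself does not map \<open>D\<close> into
  \<open>L\<close>. Removing the integer part of \<open>q\<close> from the integral
  \<open>q * \<delta>\<close> leaves \<open>\<delta> / 2\<close>; as \<open>2 / \<delta>\<close> is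
  integral too, \<open>\<delta>\<close> is associated to 2.\<close>

lemma twist_2:
  assumes q: "q \<in> \<rat>" and c: "{h l e | l. l \<in> L} = {x * c | x. x \<in> R}"
    and tw: "\<forall>v\<in>D. 2 *s v + (h v e / k * q) *s e \<in> L"
    and not_scalar: "\<not> (\<forall>v\<in>D. 2 *s v \<in> L)"
  obtains m :: int where "odd m" "q = of_int m / 2" "c / (2 * k) \<in> R" "2 * k / c \<in> R"
proof -
  have "2 \<in> R" by simp
  note * = twist_imp_scalar[OF q this c tw]
  define \<delta> where "\<delta> = cnj (c / k)"
  have \<delta>0: "\<delta> \<noteq> 0" using *(2) k_nz by (simp add: \<delta>_def)
  have "(2 / \<delta>) * (q * \<delta>) \<in> R" unfolding \<delta>_def by (rule R_mult[OF *(3) *(4)])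
  then have "2 * q \<in> R" using \<delta>0 by simp
  then have "2 * q \<in> \<int>" using q by (intro R_rat) auto
  then obtain m where m: "2 * q = of_int m" by (auto elim: Ints_cases)
  have "odd m"
  proof
    assume "even m"
    then obtain j where "m = 2 * j" by blast
    then have "q = of_int j" using m by simp
    then show False using *(5) not_scalar by auto
  qed
  then obtain j where j: "m = 2 * j + 1" by (auto elim: oddE)
  have "q * \<delta> - of_int j * \<delta> \<in> R"
    unfolding \<delta>_def using *(4) R_cnj[OF *(1)] by (intro R_diff R_mult[OF R_of_int])
  moreover have "q * \<delta> - of_int j * \<delta> = \<delta> / 2"
  proof -
    have "q = of_int j + 1 / 2" using m j by (simp add: field_simps)
    then show ?thesis by (simp add: algebra_simps)
  qed
  ultimately have 1: "\<delta> / 2 \<in> R" by simp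
  have 2: "2 / \<delta> \<in> R" unfolding \<delta>_def by (rule *(3))
  have "cnj (\<delta> / 2) = c / (2 * k)" "cnj (2 / \<delta>) = 2 * k / c" by (simp_all add: \<delta>_def)
  then show thesis using that[of m] \<open>odd m\<close> m R_cnj[OF 1] R_cnj[OF 2] by (simp add: field_simps)
qed

text \<open>\<open>D\<close> lies in a quarter of the finitely generated \<open>L\<close>, and there
  coefficients matter only modulo 4, where \<open>R\<close> has finitely many classes.\<close>

lemma finite_index:
  assumes "\<And>v. v \<in> D \<Longrightarrow> 4 *s v \<in> L"
  shows "\<exists>Z. finite Z \<and> (\<forall>v\<in>D. \<exists>z\<in>Z. v - z \<in> L)"
proof -
  obtain ss where ss: "set ss \<subseteq> L" "L \<subseteq> span_of ss" using L_generated by blast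
  obtain Z where Z: "finite Z" "\<forall>r\<in>R. \<exists>z\<in>Z. dvdR 4 (r - z)" using R_mod_4 by blast
  have approx: "\<exists>zs. set zs \<subseteq> Z \<and> length zs = length ss \<and> (1/4) *s comb rs ss - (1/4) *s comb zs ss \<in> L"
    if "rs \<in> coeffs ss" for rs
    using that ss(1)
  proof (induction ss arbitrary: rs)
    case Nil then show ?case using L_submod by simp
  next
    case (Cons s ss)
    then obtain r rs' where rs: "rs = r # rs'" "r \<in> R" "rs' \<in> coeffs ss"
      by (cases rs) (auto simp: coeffs_def)
    obtain zs where zs: "set zs \<subseteq> Z" "length zs = length ss"
        "(1/4) *s comb rs' ss - (1/4) *s comb zs ss \<in> L"
      using Cons.IH[OF rs(3)] Cons.prems by auto
    obtain z x where z: "z \<in> Z" "x \<in> R" "r - z = 4 * x"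
      using Z(2) rs(2) unfolding dvdR_def by blast
    have "x *s s + ((1/4) *s comb rs' ss - (1/4) *s comb zs ss) \<in> L"
      using z zs Cons.prems L_submod by (intro submod_add submod_scale) auto
    moreover have "x *s s = (r / 4) *s s - (z / 4) *s s"
      using z by (simp flip: scale_left_diff_distrib diff_divide_distrib)
    ultimately have "(1/4) *s comb (r # rs') (s # ss) - (1/4) *s comb (z # zs) (s # ss) \<in> L"
      by (simp add: scale_right_distrib add_diff_add add_diff_eq diff_add_eq)
    then show ?case using rs z zs by (intro exI[of _ "z # zs"]) simp
  qed
  let ?Y = "(\<lambda>zs. (1/4) *s comb zs ss) ` {zs. set zs \<subseteq> Z \<and> length zs = length ss}"
  have "finite ?Y" using finite_lists_length_eq[OF Z(1)] by simp
  moreover have "\<exists>z\<in>?Y. v - z \<in> L" if v: "v \<in> D" for v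
  proof -
    have "4 *s v \<in> span_of ss" using assms[OF v] ss(2) by blast
    then obtain rs where rs: "rs \<in> coeffs ss" "4 *s v = comb rs ss" unfolding span_of_def by blast
    have "(1/4) *s comb rs ss = v" using rs(2)[symmetric] by simp
    then show ?thesis using approx[OF rs(1)] by auto
  qed
  ultimately show ?thesis by (intro exI[of _ ?Y]) blast
qed

end

text \<open>The situation of a twist by \<open>-1\<close>: the vector \<open>v0\<close> spans a direct summand \<open>N0 / L\<close>
  of \<open>D / L\<close>, and \<open>M / L\<close> is its orthogonal complement, which is killed by \<open>2\<close>.\<close>

locale twisted = isotropic_vector scale R F k V L h e
  for scale :: "complex \<Rightarrow> 'w::ab_group_add \<Rightarrow> 'w" (infixr "*s" 75) and R F k V L h e +
  fixes m :: int
  assumes odd_m: "odd m"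
    and twist: "v \<in> D \<Longrightarrow> 2 *s v + (h v e / k * (of_int m / 2)) *s e \<in> L"
begin

definition M :: "'w set" where
  "M = {v \<in> D. 2 *s v \<in> L \<and> h v v0 \<in> kR}"

definition N0 :: "'w set" where
  "N0 = {v \<in> D. \<exists>r\<in>R. v - r *s v0 \<in> L}"

lemma half_in_R: "r \<in> R \<Longrightarrow> of_int m * r / 2 \<in> R \<Longrightarrow> r / 2 \<in> R"
proof -
  assume r: "r \<in> R" "of_int m * r / 2 \<in> R"
  obtain j where "m = 2 * j + 1" using odd_m by (auto elim: oddE)
  then have "r / 2 = of_int m * r / 2 - of_int j * r" by (simp add: field_simps)
  also have "\<dots> \<in> R" using r by (intro R_diff R_mult) auto
  finally show ?thesis .
qed

lemma half_F [simp]: "of_int a / 2 \<in> F" "x \<in> F \<Longrightarrow> x / 2 \<in> F"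
  by (auto intro!: F_divide)

lemma twist_v0: "2 *s v0 + (of_int m / 2) *s e \<in> L"
  using twist[of v0] k_nz by simp

lemma four_v: "v \<in> D \<Longrightarrow> 4 *s v \<in> L"
proof -
  assume v: "v \<in> D"
  have hR: "h v e / k \<in> R" using h_D_L[OF v e_L] by (simp add: kR_iff)
  have "2 *s (2 *s v + (h v e / k * (of_int m / 2)) *s e) - (h v e / k * of_int m) *s e \<in> L"
    using twist[OF v] e_L L_submod hR by (intro submod_diff submod_scale R_mult) auto
  then show ?thesis by (simp add: scale_right_distrib)
qed

text \<open>Modulo \<open>L\<close>, \<open>2 *s v0\<close> is \<open>- (m / 2) *s e\<close>. As
  \<open>m\<close> is odd and \<open>e\<close> primitive, \<open>(2 * s) *s v0\<close> lies in
  \<open>L\<close> only if 2 divides \<open>s\<close>; this is applied to \<open>s = r\<close> and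
  then to \<open>s = r / 2\<close>.\<close>

lemma v0_order: "r \<in> R \<Longrightarrow> r *s v0 \<in> L \<longleftrightarrow> dvdR 4 r"
proof
  assume r: "r \<in> R" "r *s v0 \<in> L"
  have half: "s / 2 \<in> R" if s: "s \<in> R" "(2 * s) *s v0 \<in> L" for s
  proof -
    have "s *s (2 *s v0 + (of_int m / 2) *s e) - (2 * s) *s v0 \<in> L"
      by (rule submod_diff[OF L_submod submod_scale[OF L_submod s(1) twist_v0] s(2)])
    then have "(s * (of_int m / 2)) *s e \<in> L"
      by (simp add: scale_right_distrib mult.commute)
    then have "s * (of_int m / 2) \<in> R" using s by (intro e_primitive F_mult) auto
    then show ?thesis using s half_in_R by (simp add: mult.commute)
  qed
  have "r / 2 \<in> R"
  proof (rule half[OF r(1)])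
    have "2 *s r *s v0 \<in> L" by (rule submod_scale[OF L_submod _ r(2)]) simp
    then show "(2 * r) *s v0 \<in> L" by simp
  qed
  then have "r / 2 / 2 \<in> R" using half[of "r / 2"] r by simp
  then show "dvdR 4 r" by (simp add: dvdR_iff)
next
  assume "r \<in> R" "dvdR 4 r"
  then obtain x where x: "x \<in> R" "r = 4 * x" unfolding dvdR_def by blast
  have "x *s 4 *s v0 \<in> L" by (rule submod_scale[OF L_submod x(1) four_v[OF v0_D]])
  then show "r *s v0 \<in> L" using x by (simp add: mult.commute)
qed

text \<open>Obtained by pairing the twist of \<open>v0\<close> with \<open>v0\<close>. Since
  \<open>m\<close> is odd, it expresses that the discriminant form is nondegenerate on the summand
  \<open>N0 / L\<close>.\<close>

lemma h_2v0: "h (2 *s v0) v0 - k * (of_int m / 2) \<in> kR"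
proof -
  have "h (2 *s v0 + (of_int m / 2) *s e) v0 \<in> kR" by (rule h_L_D[OF v0_D twist_v0])
  also have "h (2 *s v0 + (of_int m / 2) *s e) v0 = h (2 *s v0) v0 - k * (of_int m / 2)"
    by (simp add: h_expand V_closed)
  finally show ?thesis .
qed

lemma submod_M: "submod M"
  unfolding submod_def M_def
  using submod_D L_submod V_0 kR_add kR_mult scale_left_commute[of 2]
  by (auto simp: submod_add submod_scale h_expand h_0 scale_right_distrib simp del: scale_scale)

lemma submod_N0: "submod N0"
  unfolding submod_def
proof (intro conjI ballI)
  show "0 \<in> N0" unfolding N0_def using submod_D L_submod by (auto intro!: bexI[of _ 0])
next
  fix x y assume "x \<in> N0" "y \<in> N0"
  then obtain r s where *: "x \<in> D" "y \<in> D" "r \<in> R" "s \<in> R" "x - r *s v0 \<in> L" "y - s *s v0 \<in> L"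
    unfolding N0_def by blast
  then have "(x - r *s v0) + (y - s *s v0) \<in> L" using L_submod submod_add by blast
  then have "x + y - (r + s) *s v0 \<in> L" by (simp add: scale_left_distrib algebra_simps)
  then show "x + y \<in> N0" unfolding N0_def using * submod_add[OF submod_D] R_add by blast
next
  fix a x assume a: "a \<in> R" "x \<in> N0"
  then obtain r where *: "x \<in> D" "r \<in> R" "x - r *s v0 \<in> L" unfolding N0_def by blast
  then have "a *s (x - r *s v0) \<in> L" using L_submod a submod_scale by blast
  then have "a *s x - (a * r) *s v0 \<in> L" by (simp add: scale_right_diff_distrib)
  then show "a *s x \<in> N0" unfolding N0_def using * a submod_scale[OF submod_D] R_mult by blast
qed

lemma L_M: "L \<subseteq> M"
  unfolding M_def using L_D h_L_D L_submod submod_scale by auto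

text \<open>Subtracting \<open>\<beta> *s v0\<close> makes the vector orthogonal to
  \<open>e\<close>, so the twist puts its double in \<open>L\<close>. Its pairing with
  \<open>v0\<close> is then integral up to a factor 2, and a multiple of \<open>2 *s v0\<close>
  repairs this while the double stays in \<open>L\<close>.\<close>

lemma D_N0_M: "v \<in> D \<Longrightarrow> \<exists>v1\<in>N0. \<exists>v2\<in>M. v - (v1 + v2) \<in> L"
proof -
  assume v: "v \<in> D"
  define \<beta> where "\<beta> = h v e / k"
  have \<beta>: "\<beta> \<in> R" using h_D_L[OF v e_L] by (simp add: kR_iff \<beta>_def)
  define y where "y = v - \<beta> *s v0"
  have yD: "y \<in> D" unfolding y_def using v \<beta> submod_D by (intro submod_diff submod_scale) auto
  have "h y e = 0" unfolding y_def using v \<beta> k_nz by (simp add: h_expand V_closed) (simp add: \<beta>_def)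
  then have y2: "2 *s y \<in> L" using twist[OF yD] by simp
  have "h (2 *s y) v0 \<in> kR" by (rule h_L_D[OF v0_D y2])
  then obtain z where z: "z \<in> R" "2 * h y v0 = k * z" using yD unfolding kR_def by (auto simp: h_expand)
  \<comment> \<open>Modulo \<open>kR\<close>, the pairing of \<open>(2 * z) *s v0\<close> with
    \<open>v0\<close> is \<open>z * k * m / 2\<close>. It cancels \<open>h y v0 = k * z / 2\<close>
    because \<open>m\<close> is odd.\<close>
  define y' where "y' = y - (2 * z) *s v0"
  have y'D: "y' \<in> D" unfolding y'_def using yD z submod_D by (intro submod_diff submod_scale) auto
  have "2 *s y - z *s 4 *s v0 \<in> L"
    by (rule submod_diff[OF L_submod y2 submod_scale[OF L_submod z(1) four_v[OF v0_D]]])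
  then have y'2: "2 *s y' \<in> L" by (simp add: y'_def scale_right_diff_distrib mult.commute)
  have "h y' v0 \<in> kR"
  proof -
    obtain j where j: "m = 2 * j + 1" using odd_m by (auto elim: oddE)
    have "k * (- (z * of_int j)) \<in> kR" unfolding kR_def using z R_mult R_uminus by blast
    moreover have "z * (h (2 *s v0) v0 - k * (of_int m / 2)) \<in> kR" using h_2v0 z kR_mult by blast
    ultimately have "k * (- (z * of_int j)) - z * (h (2 *s v0) v0 - k * (of_int m / 2)) \<in> kR"
      by (rule kR_diff)
    also have "k * (- (z * of_int j)) - z * (h (2 *s v0) v0 - k * (of_int m / 2)) = h y' v0"
    proof -
      have "h y v0 = k * z / 2" using z by (simp add: field_simps)
      moreover have "2 * z \<in> F" "z * 2 \<in> F" using z by (auto intro!: F_mult)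
      ultimately show ?thesis using yD z j
        by (simp add: y'_def h_expand V_closed algebra_simps add_divide_distrib)
    qed
    finally show ?thesis .
  qed
  then have "y' \<in> M" using y'D y'2 by (simp add: M_def)
  moreover have "(\<beta> + 2 * z) *s v0 \<in> N0"
    unfolding N0_def using \<beta> z submod_D L_submod
    by (auto intro!: bexI[of _ "\<beta> + 2 * z"] submod_scale R_add R_mult)
  moreover have "v - ((\<beta> + 2 * z) *s v0 + y') \<in> L"
    using L_submod by (simp add: y'_def y_def scale_left_distrib)
  ultimately show ?thesis by blast
qed

text \<open>For \<open>r *s v0\<close> in \<open>M\<close> the order of \<open>v0\<close> gives
  \<open>r = 2 * s\<close>. Its pairing with \<open>v0\<close> is \<open>s * k * m / 2\<close>
  modulo \<open>kR\<close> and has to be integral, so 2 divides \<open>s\<close> as well and 4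
  divides \<open>r\<close>.\<close>

lemma N0_Int_M: "v \<in> N0 \<Longrightarrow> v \<in> M \<Longrightarrow> v \<in> L"
proof -
  assume "v \<in> N0" and vM: "v \<in> M"
  then obtain r where r: "r \<in> R" "v - r *s v0 \<in> L" unfolding N0_def by blast
  have "v - (v - r *s v0) \<in> M" using submod_diff[OF submod_M vM subsetD[OF L_M r(2)]] .
  then have rM: "r *s v0 \<in> M" by simp
  then have "(2 * r) *s v0 \<in> L" by (simp add: M_def)
  then have "dvdR 4 (2 * r)" using v0_order[of "2 * r"] r R_mult by simp
  then obtain s where s: "s \<in> R" "r = s * 2" unfolding dvdR_def by auto
  have "s * (h (2 *s v0) v0 - k * (of_int m / 2)) \<in> kR" using h_2v0 s kR_mult by blast
  moreover have "h (r *s v0) v0 \<in> kR" using rM by (simp add: M_def)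
  ultimately have "h (r *s v0) v0 - s * (h (2 *s v0) v0 - k * (of_int m / 2)) \<in> kR"
    using kR_diff by blast
  also have "h (r *s v0) v0 - s * (h (2 *s v0) v0 - k * (of_int m / 2)) = k * (of_int m * s / 2)"
    using r s by (simp add: h_expand algebra_simps)
  finally have "of_int m * s / 2 \<in> R" using k_nz by (simp add: kR_iff)
  then have "s / 2 \<in> R" using half_in_R s by blast
  then have "dvdR 4 r" using s by (simp add: dvdR_iff)
  then have "r *s v0 \<in> L" using v0_order r by blast
  then show ?thesis using submod_cong[OF L_submod r(2)] by blast
qed

lemma decomp_D:
  assumes "decomp ps gs M L" and "decomp qs hs N0 L"
  shows "decomp (ps @ qs) (gs @ hs) D L"
proof (rule decomp_append[OF assms L_submod submod_M submod_N0])
  show "M \<subseteq> D" "N0 \<subseteq> D" unfolding M_def N0_def by auto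
  show "\<exists>v1\<in>M. \<exists>v2\<in>N0. v - (v1 + v2) \<in> L" if "v \<in> D" for v
    using D_N0_M[OF that] by (metis add.commute)
  fix v1 v2 assume v: "v1 \<in> M" "v2 \<in> N0" "v1 + v2 \<in> L"
  have "v1 + v2 - v1 \<in> M" by (rule submod_diff[OF submod_M subsetD[OF L_M v(3)] v(1)])
  then have "v2 \<in> L" using N0_Int_M v by simp
  then show "v1 \<in> L \<and> v2 \<in> L" using submod_diff[OF L_submod v(3), of v2] by simp
qed

text \<open>Any generator \<open>p\<close> of the ideal of 4 is allowed, because the ramified case
  needs a fourth power of the prime there.\<close>

lemma N0_single:
  assumes "\<And>r. r \<in> R \<Longrightarrow> dvdR p r \<longleftrightarrow> dvdR 4 r"
  shows "decomp [p] [v0] N0 L"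
  unfolding decomp_def
proof (intro conjI ballI)
  show "set [v0] \<subseteq> N0" unfolding N0_def using L_submod by (auto intro!: bexI[of _ 1])
  show "\<exists>y\<in>span_of [v0]. v - y \<in> L" if "v \<in> N0" for v
    using that unfolding N0_def span_single by blast
  show "comb rs [v0] \<in> L \<longleftrightarrow> list_all2 dvdR [p] rs" if "rs \<in> coeffs [v0]" for rs
    using that v0_order assms by (auto simp: coeffs_def length_Suc_conv)
qed simp

lemma finite_index_M: "\<exists>Z. finite Z \<and> (\<forall>v\<in>M. \<exists>z\<in>Z. v - z \<in> L)"
  using finite_index[OF four_v] unfolding M_def by blast

text \<open>When 2 stays prime, \<open>M / L\<close> is a vector space over the residue field and
  only \<open>N0 / L\<close> contributes a square.\<close>

lemma decomp_inert:
  assumes field: "\<And>r. r \<in> R \<Longrightarrow> \<not> dvdR 2 r \<Longrightarrow> \<exists>s\<in>R. dvdR 2 (s * r - 1)"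
  shows "\<exists>gs a. decomp (replicate a 2 @ [2\<^sup>2]) gs D L"
proof -
  obtain Z where Z: "finite Z" "\<And>v. v \<in> M \<Longrightarrow> \<exists>z\<in>Z. v - z \<in> L" using finite_index_M by blast
  have "\<exists>gs. decomp (replicate (length gs) 2) gs M L"
  proof (rule exists_basis[OF submod_M L_submod L_M])
    show "\<exists>gs. set gs \<subseteq> M \<and> (\<forall>v\<in>M. \<exists>y\<in>span_of gs. v - y \<in> L)"
      by (rule finite_generators[OF Z _ L_submod]) auto
  qed (use field in \<open>auto simp: M_def\<close>)
  then obtain gs where "decomp (replicate (length gs) 2) gs M L" by blast
  from decomp_D[OF this N0_single] show ?thesis by fastforce
qed

text \<open>Being killed by 2 means being killed by \<open>\<eta>\<^sup>2\<close>, so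
  \<open>exists_decomp_square\<close> applies to \<open>M / L\<close>; on the part of
  \<open>v0\<close> the modulus 4 is \<open>\<eta> ^ 4\<close> up to a unit.\<close>

lemma decomp_ramified:
  assumes \<eta>: "\<eta> \<in> R" "\<eta> \<noteq> 0" and "2 = u * \<eta>\<^sup>2" "u \<in> R" "inverse u \<in> R"
    and field: "\<And>r. r \<in> R \<Longrightarrow> \<not> dvdR \<eta> r \<Longrightarrow> \<exists>s\<in>R. dvdR \<eta> (s * r - 1)"
  shows "\<exists>gs a b. decomp (replicate a \<eta> @ replicate b (\<eta>\<^sup>2) @ [\<eta> ^ 4]) gs D L"
proof -
  have u0: "u \<noteq> 0" using assms by auto
  obtain Z where Z: "finite Z" "\<And>v. v \<in> M \<Longrightarrow> \<exists>z\<in>Z. v - z \<in> L" using finite_index_M by blast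
  have eta2: "\<eta>\<^sup>2 = inverse u * 2" using assms(3) u0 by (simp add: field_simps)
  have "\<exists>gs a b. decomp (replicate a \<eta> @ replicate b (\<eta>\<^sup>2)) gs M L"
  proof (rule exists_decomp_square[OF submod_M L_submod L_M \<eta> _ field Z])
    fix v assume "v \<in> M"
    then have "inverse u *s 2 *s v \<in> L"
      by (intro submod_scale[OF L_submod assms(5)]) (simp add: M_def)
    also have "inverse u *s 2 *s v = \<eta> *s \<eta> *s v" using eta2 by (simp add: power2_eq_square)
    finally show "\<eta> *s \<eta> *s v \<in> L" .
  qed
  then obtain gs a b where gs: "decomp (replicate a \<eta> @ replicate b (\<eta>\<^sup>2)) gs M L" by blast
  have "\<eta> ^ 4 = (\<eta>\<^sup>2)\<^sup>2" by simp
  then have eta4: "\<eta> ^ 4 = inverse u * (inverse u * 4)" unfolding eta2 by (simp add: power2_eq_square)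
  have "dvdR (\<eta> ^ 4) r \<longleftrightarrow> dvdR 4 r" if "r \<in> R" for r
  proof
    assume "dvdR (\<eta> ^ 4) r"
    then obtain x where "x \<in> R" "r = \<eta> ^ 4 * x" unfolding dvdR_def by blast
    then have "r = 4 * (inverse u * (inverse u * x))" "inverse u * (inverse u * x) \<in> R"
      using eta4 assms(5) by (auto intro: R_mult)
    then show "dvdR 4 r" unfolding dvdR_def by blast
  next
    assume "dvdR 4 r"
    then obtain x where "x \<in> R" "r = 4 * x" unfolding dvdR_def by blast
    then have "r = \<eta> ^ 4 * (u * (u * x))" "u * (u * x) \<in> R"
      using eta4 assms(4) u0 by (auto intro: R_mult simp: field_simps)
    then show "dvdR (\<eta> ^ 4) r" unfolding dvdR_def by blast
  qed
  from decomp_D[OF gs N0_single[OF this]] show ?thesis by auto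
qed


text \<open>For \<open>d = -7\<close> the prime \<open>2\<close> splits as \<open>- p p'\<close>. The \<open>p\<close>-part and the \<open>p'\<close>-part of
  \<open>M / L\<close> are isotropic and dual to each other, which is why they have the same dimension.\<close>

definition part :: "complex \<Rightarrow> 'w set" where
  "part p = {v \<in> M. p *s v \<in> L}"

lemma submod_part: "p \<in> R \<Longrightarrow> submod (part p)"
  unfolding submod_def part_def using submod_M L_submod scale_left_commute[of p]
  by (auto simp: submod_add submod_scale scale_right_distrib simp del: scale_scale)

lemma L_part: "p \<in> R \<Longrightarrow> L \<subseteq> part p"
  unfolding part_def using L_M L_submod submod_scale by auto

text \<open>The model is \<open>p = (1 + rt (- 7)) / 2\<close> and
  \<open>p' = (- 1 + rt (- 7)) / 2\<close>. The condition on \<open>p - p'\<close> is a Bezout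
  identity; both signs are allowed so that the two primes can change roles. The last two clauses say
  that \<open>R / p\<close> has exactly two elements.\<close>

definition splitting :: "complex \<Rightarrow> complex \<Rightarrow> bool" where
  "splitting p p' \<longleftrightarrow> p \<in> R \<and> p' \<in> R \<and> cnj p = - p' \<and> p * p' = - 2 \<and>
     (p - p' = 1 \<or> p - p' = - 1) \<and> \<not> dvdR p 1 \<and> (\<forall>r\<in>R. dvdR p r \<or> dvdR p (r - 1))"

lemma splitting_nz: "splitting p p' \<Longrightarrow> p \<noteq> 0 \<and> p' \<noteq> 0"
  unfolding splitting_def by auto

text \<open>The Bezout identity \<open>\<epsilon> * (p - p') = 1\<close> splits \<open>v\<close>
  into its multiples by \<open>\<epsilon> * p\<close> and \<open>- \<epsilon> * p'\<close>. As
  \<open>p * p' = - 2\<close>, each piece is killed by the prime missing from its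
  coefficient.\<close>

lemma M_parts:
  assumes s: "splitting p p'" and v: "v \<in> M"
  shows "\<exists>v1\<in>part p. \<exists>v2\<in>part p'. v - (v1 + v2) \<in> L"
proof -
  define \<epsilon> where "\<epsilon> = p - p'"
  have R: "p \<in> R" "p' \<in> R" "\<epsilon> \<in> R" "- \<epsilon> \<in> R" and pp: "p * p' = - 2" and d: "\<epsilon> * \<epsilon> = 1"
    using s R_diff R_uminus by (auto simp: splitting_def \<epsilon>_def)
  have v2: "2 *s v \<in> L" using v by (simp add: M_def)
  define c1 where "c1 = - \<epsilon> * p'"
  define c2 where "c2 = \<epsilon> * p"
  define v1 where "v1 = c1 *s v"
  define v2 where "v2 = c2 *s v"
  have "p * c1 = - \<epsilon> * (p * p')" "p' * c2 = \<epsilon> * (p * p')"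
    by (simp_all add: c1_def c2_def algebra_simps)
  then have "p * c1 = \<epsilon> * 2" "p' * c2 = - \<epsilon> * 2" using pp by simp_all
  then have "p *s v1 = \<epsilon> *s 2 *s v" "p' *s v2 = - \<epsilon> *s 2 *s v"
    by (simp_all only: v1_def v2_def scale_scale)
  moreover have "c1 \<in> R" "c2 \<in> R" unfolding c1_def c2_def using R by (auto intro!: R_mult simp del: mult_minus_left)
  then have "v1 \<in> M" "v2 \<in> M" unfolding v1_def v2_def
    by (auto intro!: submod_scale[OF submod_M _ v])
  moreover have "\<epsilon> *s 2 *s v \<in> L" "- \<epsilon> *s 2 *s v \<in> L"
    using submod_scale[OF L_submod R(3) v2] submod_scale[OF L_submod R(4) v2] by simp_all
  ultimately have "v1 \<in> part p" "v2 \<in> part p'"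
    unfolding part_def by simp_all
  moreover have "v1 + v2 = (\<epsilon> * (p - p')) *s v"
    unfolding v1_def v2_def scale_left_distrib[symmetric] by (simp add: c1_def c2_def algebra_simps)
  then have "v - (v1 + v2) \<in> L" using d L_submod by (simp add: \<epsilon>_def)
  ultimately show ?thesis by blast
qed

lemma part_Int:
  assumes s: "splitting p p'" and "p *s v \<in> L" "p' *s v \<in> L"
  shows "v \<in> L"
proof -
  have "p *s v - p' *s v \<in> L" using assms(2,3) L_submod submod_diff by blast
  then have "(p - p') *s v \<in> L" by (simp add: scale_left_diff_distrib)
  moreover have "p - p' = 1 \<or> p - p' = - 1" using s by (simp add: splitting_def)
  ultimately show ?thesis using submod_uminus[OF L_submod, of "- v"] by auto
qed

lemma decomp_parts:
  assumes s: "splitting p p'" and "decomp ps xs (part p) L" "decomp qs ys (part p') L"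
  shows "decomp (ps @ qs) (xs @ ys) M L"
proof (rule decomp_append[OF assms(2,3) L_submod])
  have R: "p \<in> R" "p' \<in> R" using s by (auto simp: splitting_def)
  show "submod (part p)" "submod (part p')" using R submod_part by blast+
  show "part p \<subseteq> M" "part p' \<subseteq> M" by (auto simp: part_def)
  show "\<exists>v1\<in>part p. \<exists>v2\<in>part p'. v - (v1 + v2) \<in> L" if "v \<in> M" for v
    using M_parts[OF s that] .
  fix v1 v2 assume v: "v1 \<in> part p" "v2 \<in> part p'" "v1 + v2 \<in> L"
  have "p *s (v1 + v2) - p *s v1 \<in> L"
    using v submod_scale[OF L_submod R(1) v(3)] by (intro submod_diff[OF L_submod]) (auto simp: part_def)
  then have "p *s v2 \<in> L" by (simp add: scale_right_distrib)
  moreover have "p' *s v2 \<in> L" using v by (simp add: part_def)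
  ultimately have "v2 \<in> L" by (rule part_Int[OF s])
  then show "v1 \<in> L \<and> v2 \<in> L" using submod_diff[OF L_submod v(3), of v2] by simp
qed

text \<open>Moving \<open>p\<close> into either argument shows that \<open>p\<close> and its
  conjugate \<open>- p'\<close> both carry \<open>h x y\<close> into \<open>kR\<close>; hence so
  does their sum, the unit \<open>p - p'\<close>.\<close>

lemma part_isotropic:
  assumes s: "splitting p p'" and x: "x \<in> part p" and y: "y \<in> part p"
  shows "h x y \<in> kR"
proof -
  have R: "p \<in> R" "p' \<in> R" and c: "cnj p = - p'" using s by (auto simp: splitting_def)
  have D: "x \<in> D" "y \<in> D" "p *s x \<in> L" "p *s y \<in> L" using x y by (auto simp: part_def M_def)
  have "p * h x y \<in> kR" using h_L_D[OF D(2,3)] D R by (simp add: h_expand)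
  moreover have "- p' * h x y \<in> kR" using h_D_L[OF D(1,4)] D R c by (simp add: h_expand)
  ultimately have "p * h x y + - p' * h x y \<in> kR" by (rule kR_add)
  then have "(p - p') * h x y \<in> kR" by (simp add: algebra_simps)
  moreover have "p - p' = 1 \<or> p - p' = - 1" using s by (simp add: splitting_def)
  ultimately show ?thesis using kR_uminus[of "- h x y"] by auto
qed

text \<open>Modulo \<open>kR\<close> the pairing takes values in the multiples of
  \<open>k / p\<close>, a group with two elements, so any two nonzero values agree.\<close>

lemma part_difference:
  assumes s: "splitting p p'" and x: "x \<in> part p" "x' \<in> part p" and y: "y \<in> part p'"
    and nk: "h x y \<notin> kR" "h x' y \<notin> kR"
  shows "h (x - x') y \<in> kR"
proof -
  have R: "p \<in> R" "p \<noteq> 0" using s splitting_nz by (auto simp: splitting_def)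
  have yD: "y \<in> D" using y by (auto simp: part_def M_def)
  have one: "z \<in> D \<and> dvdR p (p * (h z y / k) - 1)" if z: "z \<in> part p" "h z y \<notin> kR" for z
  proof -
    have zD: "z \<in> D" "p *s z \<in> L" using z by (auto simp: part_def M_def)
    have "p * h z y \<in> kR" using h_L_D[OF yD zD(2)] zD yD R by (simp add: h_expand)
    then have "p * (h z y / k) \<in> R" by (simp add: kR_iff)
    moreover have "\<not> dvdR p (p * (h z y / k))" using z(2) R by (simp add: dvdR_iff kR_iff)
    ultimately show ?thesis using s zD unfolding splitting_def by blast
  qed
  obtain a where a: "x \<in> D" "a \<in> R" "p * (h x y / k) - 1 = p * a"
    using one[OF x(1) nk(1)] by (auto simp: dvdR_def)
  obtain b where b: "x' \<in> D" "b \<in> R" "p * (h x' y / k) - 1 = p * b"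
    using one[OF x(2) nk(2)] by (auto simp: dvdR_def)
  have "p * (h x y / k - h x' y / k) = p * (a - b)" using a b by (simp add: algebra_simps)
  then have "h x y / k - h x' y / k = a - b" using R(2) by (simp only: mult_cancel_left) simp
  then have "h (x - x') y / k = a - b" using a b yD by (simp add: h_expand diff_divide_distrib)
  then show ?thesis using a b R_diff by (simp add: kR_iff)
qed

text \<open>\<open>z\<close> is orthogonal to all of \<open>D\<close>: to its own part by isotropy,
  to the other part by the hypothesis on generators, and to \<open>v0\<close> because
  \<open>z\<close> lies in \<open>M\<close>. Reflexivity then puts it in \<open>L\<close>.\<close>

lemma part_nondegenerate:
  assumes s: "splitting p p'" and z: "z \<in> part p" and d: "decomp qs ys (part p') L"
    and orth: "\<And>y. y \<in> set ys \<Longrightarrow> h z y \<in> kR"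
  shows "z \<in> L"
proof -
  have zM: "z \<in> M" "z \<in> D" "z \<in> V" using z by (auto simp: part_def M_def)
  define N where "N = {y \<in> D. h z y \<in> kR}"
  have subN: "submod N" unfolding submod_def N_def
    using submod_D zM kR_add kR_mult[OF R_cnj] h_0_right
    by (auto simp: submod_add submod_scale h_expand)
  have LN: "L \<subseteq> N" using L_D h_D_L[OF zM(2)] unfolding N_def by blast
  have "set ys \<subseteq> part p'" using d by (simp add: decomp_def)
  then have "set ys \<subseteq> N" using orth unfolding N_def part_def M_def by blast
  then have "span_of ys \<subseteq> N" by (rule span_subset[OF subN])
  have p2: "y \<in> N" if y: "y \<in> part p'" for y
  proof -
    obtain w where w: "w \<in> span_of ys" "y - w \<in> L" using d y unfolding decomp_def by blast
    then have "(y - w) + w \<in> N" using LN \<open>span_of ys \<subseteq> N\<close>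
      by (intro submod_add[OF subN, of "y - w"]) auto
    then show ?thesis by simp
  qed
  have p1: "y \<in> N" if "y \<in> part p" for y
    using that part_isotropic[OF s z that] unfolding N_def part_def M_def by blast
  have M: "y \<in> N" if y: "y \<in> M" for y
  proof -
    obtain v1 v2 where v: "v1 \<in> part p" "v2 \<in> part p'" "y - (v1 + v2) \<in> L" using M_parts[OF s y] by blast
    then have "(y - (v1 + v2)) + (v1 + v2) \<in> N"
      by (intro submod_add[OF subN subsetD[OF LN] submod_add[OF subN p1 p2]])
    then show ?thesis by simp
  qed
  have v0: "v0 \<in> N" using zM by (simp add: N_def M_def)
  show ?thesis
  proof (rule reflexive[OF zM(3)])
    fix v assume v: "v \<in> D"
    obtain v1 v2 where w: "v1 \<in> N0" "v2 \<in> M" "v - (v1 + v2) \<in> L" using D_N0_M[OF v] by blast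
    obtain r where r: "r \<in> R" "v1 - r *s v0 \<in> L" using w(1) unfolding N0_def by blast
    have "(v - (v1 + v2)) + ((v1 - r *s v0) + r *s v0 + v2) \<in> N"
      by (intro submod_add[OF subN subsetD[OF LN w(3)]
          submod_add[OF subN submod_add[OF subN subsetD[OF LN r(2)] submod_scale[OF subN r(1) v0]] M[OF w(2)]]])
    then have "v \<in> N" by simp
    then show "h v z \<in> kR" using kR_cnj[of "h z v"] h_cnj[of z v] zM v unfolding N_def by simp
  qed
qed

text \<open>Counting replaces linear algebra over the field with two elements. A subset of the basis
  is sent to the set of indices \<open>j\<close> at which its sum pairs nontrivially with
  \<open>ys ! j\<close>; nondegeneracy makes this injective, whence
  \<open>2 ^ a \<le> 2 ^ b\<close>.\<close>

lemma part_dim_le: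
  assumes s: "splitting p p'" and xs: "decomp (replicate a p) xs (part p) L"
    and ys: "decomp (replicate b p') ys (part p') L"
  shows "a \<le> b"
proof -
  have R: "p \<in> R" "p \<noteq> 0" using s splitting_nz by (auto simp: splitting_def)
  have len: "length xs = a" "length ys = b" using xs ys by (simp_all add: decomp_def)
  have xsP: "set xs \<subseteq> part p" using xs by (simp add: decomp_def)
  have ysP: "ys ! j \<in> part p'" if "j < b" for j using ys that len by (auto simp: decomp_def)
  define ind where "ind A = map (\<lambda>i. if i \<in> A then 1 else 0 :: complex) [0..<a]" for A
  have ind: "ind A \<in> coeffs xs" for A by (auto simp: ind_def coeffs_def len)
  define X where "X A = comb (ind A) xs" for A
  have X: "X A \<in> part p" for A unfolding X_def by (rule comb_in[OF submod_part[OF R(1)] xsP ind])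
  define \<phi> where "\<phi> A = {j. j < b \<and> h (X A) (ys ! j) \<notin> kR}" for A
  have "inj_on \<phi> (Pow {..<a})"
  proof (rule inj_onI)
    fix A B assume AB: "A \<in> Pow {..<a}" "B \<in> Pow {..<a}" "\<phi> A = \<phi> B"
    have "h (X A - X B) y \<in> kR" if yset: "y \<in> set ys" for y
    proof -
      obtain j where j: "j < b" "y = ys ! j" using yset len unfolding in_set_conv_nth by blast
      have V: "X A \<in> V" "X B \<in> V" "y \<in> V"
        using X[of A] X[of B] ysP[OF j(1)] j(2) by (auto simp: part_def M_def)
      show ?thesis
      proof (cases "j \<in> \<phi> A")
        case True
        moreover have "j \<in> \<phi> B" using True AB(3) by simp
        ultimately have "h (X A) (ys ! j) \<notin> kR" "h (X B) (ys ! j) \<notin> kR" unfolding \<phi>_def by simp_all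
        then show ?thesis unfolding j(2) by (rule part_difference[OF s X X ysP[OF j(1)]])
      next
        case False
        moreover have "j \<notin> \<phi> B" using False AB(3) by simp
        ultimately have "h (X A) y \<in> kR" "h (X B) y \<in> kR" unfolding \<phi>_def using j by simp_all
        then have "h (X A) y - h (X B) y \<in> kR" by (rule kR_diff)
        then show ?thesis using V by (simp add: h_expand)
      qed
    qed
    moreover have "X A - X B \<in> part p" by (rule submod_diff[OF submod_part[OF R(1)] X X])
    ultimately have "X A - X B \<in> L" by (rule part_nondegenerate[OF s _ ys, rotated])
    then have "comb (map2 (-) (ind A) (ind B)) xs \<in> L"
      unfolding X_def using comb_diff coeffs_length[OF ind] by simp
    then have "list_all2 dvdR (replicate a p) (map2 (-) (ind A) (ind B))"
      using xs coeffs_diff[OF ind ind] unfolding decomp_def by blast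
    then have dv: "dvdR p ((if i \<in> A then 1 else 0) - (if i \<in> B then 1 else 0))" if "i < a" for i
      using that by (auto simp: list_all2_conv_all_nth ind_def)
    have n1: "\<not> dvdR p 1" using s by (simp add: splitting_def)
    moreover have "\<not> dvdR p (- 1)" using n1 R_uminus[of "- 1 / p"] R(2) by (auto simp: dvdR_iff)
    ultimately have "i \<in> A \<longleftrightarrow> i \<in> B" if "i < a" for i using dv[OF that] by (auto split: if_splits)
    then show "A = B" using AB by blast
  qed
  moreover have "\<phi> ` Pow {..<a} \<subseteq> Pow {..<b}" by (auto simp: \<phi>_def)
  ultimately have "card (Pow {..<a}) \<le> card (Pow {..<b})" by (intro card_inj_on_le) auto
  then have "(2::nat) ^ a \<le> 2 ^ b" by (simp add: card_Pow)
  then show ?thesis by simp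
qed

lemma part_basis:
  assumes s: "splitting p p'"
  shows "\<exists>gs. decomp (replicate (length gs) p) gs (part p) L"
proof -
  have R: "p \<in> R" and f: "\<forall>r\<in>R. dvdR p r \<or> dvdR p (r - 1)" using s by (auto simp: splitting_def)
  obtain Z where Z: "finite Z" "\<And>v. v \<in> M \<Longrightarrow> \<exists>z\<in>Z. v - z \<in> L" using finite_index_M by blast
  show ?thesis
  proof (rule exists_basis[OF submod_part[OF R] L_submod L_part[OF R] R])
    show "p *s v \<in> L" if "v \<in> part p" for v using that by (simp add: part_def)
    \<comment> \<open>The only nonzero class modulo \<open>p\<close> is that of 1, which is its own
      inverse.\<close>
    show "\<exists>s\<in>R. dvdR p (s * r - 1)" if "r \<in> R" "\<not> dvdR p r" for r
      using that f by (intro bexI[of _ 1]) auto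
    show "\<exists>gs. set gs \<subseteq> part p \<and> (\<forall>v\<in>part p. \<exists>y\<in>span_of gs. v - y \<in> L)"
      by (rule finite_generators[OF Z _ L_submod]) (auto simp: part_def)
  qed
qed

text \<open>This is the Chinese remainder theorem for \<open>4 = p\<^sup>2 * p'\<^sup>2\<close>:
  multiplying \<open>v0\<close> by one square gives a generator of the summand killed by the
  other.\<close>

lemma N0_split:
  assumes s: "splitting p p'"
  shows "decomp [p\<^sup>2, p'\<^sup>2] [p'\<^sup>2 *s v0, p\<^sup>2 *s v0] N0 L"
proof -
  have R: "p \<in> R" "p' \<in> R" and pp: "p * p' = - 2" using s by (auto simp: splitting_def)
  have nz: "p \<noteq> 0" "p' \<noteq> 0" using splitting_nz[OF s] by auto
  have four: "p\<^sup>2 * p'\<^sup>2 = 4" using pp by (simp flip: power_mult_distrib)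
  have "(p - p')\<^sup>2 = 1" using s by (auto simp: splitting_def)
  then have "(p - p') ^ 4 = 1" using power_mult[of "p - p'" 2 2] by simp
  \<comment> \<open>Bezout coefficients read off from the binomial expansion of
    \<open>(p - p') ^ 4 = 1\<close>; its middle coefficient 6 is shared as 3 and 3.\<close>
  define a where "a = p\<^sup>2 - 4 * p * p' + 3 * p'\<^sup>2"
  define b where "b = 3 * p\<^sup>2 - 4 * p * p' + p'\<^sup>2"
  have "p\<^sup>2 * a + p'\<^sup>2 * b = (p - p') ^ 4"
    unfolding a_def b_def by (simp add: power2_eq_square power4_eq_xxxx algebra_simps)
  then have bez: "p\<^sup>2 * a + p'\<^sup>2 * b = 1" using \<open>(p - p') ^ 4 = 1\<close> by simp
  have ab: "a \<in> R" "b \<in> R" unfolding a_def b_def using R by (auto intro!: R_add R_diff R_mult R_power)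
  have v0N: "r *s v0 \<in> N0" if "r \<in> R" for r
    unfolding N0_def using that submod_D L_submod by (auto intro!: bexI[of _ r] submod_scale)
  have sp: "span_of [p'\<^sup>2 *s v0, p\<^sup>2 *s v0] = {r *s v0 | r. r \<in> R}" (is "?A = ?B")
  proof (intro equalityI subsetI)
    fix x assume "x \<in> ?A"
    then obtain r t where "r \<in> R" "t \<in> R" "x = r *s p'\<^sup>2 *s v0 + t *s p\<^sup>2 *s v0"
      using span_append[of "[p'\<^sup>2 *s v0]" "[p\<^sup>2 *s v0]"] unfolding span_single by auto
    then have "x = (r * p'\<^sup>2 + t * p\<^sup>2) *s v0" "r * p'\<^sup>2 + t * p\<^sup>2 \<in> R"
      using R by (auto simp: scale_left_distrib intro!: R_add R_mult R_power)
    then show "x \<in> ?B" by blast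
  next
    fix x assume "x \<in> ?B"
    then obtain r where r: "r \<in> R" "x = r *s v0" by blast
    have "x = (r * (p\<^sup>2 * a + p'\<^sup>2 * b)) *s v0" using r bez by simp
    then have "x = (r * b) *s p'\<^sup>2 *s v0 + (r * a) *s p\<^sup>2 *s v0"
      by (simp add: scale_left_distrib algebra_simps)
    moreover have "r * b \<in> R" "r * a \<in> R" using r ab by auto
    ultimately show "x \<in> ?A"
      using span_append[of "[p'\<^sup>2 *s v0]" "[p\<^sup>2 *s v0]"] unfolding span_single by auto
  qed
  \<comment> \<open>A generic pair \<open>q\<close>, \<open>q'\<close> allows the two primes to be
    inserted in either order.\<close>
  have half: "dvdR (q\<^sup>2) r"
    if H: "r \<in> R" "t \<in> R" "dvdR 4 (r * q'\<^sup>2 + t * q\<^sup>2)" "q \<in> R" "q' \<in> R" "q\<^sup>2 * q'\<^sup>2 = 4"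
       "q\<^sup>2 * c + q'\<^sup>2 * d = 1" "c \<in> R" "d \<in> R" for q q' r t c d
  proof -
    obtain x where x: "x \<in> R" "r * q'\<^sup>2 + t * q\<^sup>2 = q\<^sup>2 * q'\<^sup>2 * x"
      using H(3,6) unfolding dvdR_def by auto
    have "r = r * (q\<^sup>2 * c + q'\<^sup>2 * d)" using that by simp
    also have "\<dots> = q\<^sup>2 * (r * c) + d * (r * q'\<^sup>2)" by (simp add: algebra_simps)
    also have "r * q'\<^sup>2 = q\<^sup>2 * q'\<^sup>2 * x - t * q\<^sup>2" using x(2) by (simp add: algebra_simps)
    finally have "r = q\<^sup>2 * (r * c + d * (q'\<^sup>2 * x - t))" by (simp add: algebra_simps)
    moreover have "r * c + d * (q'\<^sup>2 * x - t) \<in> R" using that x by (auto intro!: R_add R_diff R_mult R_power)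
    ultimately show ?thesis unfolding dvdR_def by blast
  qed
  show ?thesis
    unfolding decomp_def
  proof (intro conjI ballI)
    show "set [p'\<^sup>2 *s v0, p\<^sup>2 *s v0] \<subseteq> N0" using v0N R by auto
    show "\<exists>y\<in>span_of [p'\<^sup>2 *s v0, p\<^sup>2 *s v0]. v - y \<in> L" if "v \<in> N0" for v
      using that unfolding sp N0_def by blast
    fix rs assume "rs \<in> coeffs [p'\<^sup>2 *s v0, p\<^sup>2 *s v0]"
    then obtain r t where rt: "rs = [r, t]" "r \<in> R" "t \<in> R"
      by (auto simp: coeffs_def length_Suc_conv)
    have "comb rs [p'\<^sup>2 *s v0, p\<^sup>2 *s v0] = (r * p'\<^sup>2 + t * p\<^sup>2) *s v0"
      by (simp add: rt scale_left_distrib)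
    moreover have "r * p'\<^sup>2 + t * p\<^sup>2 \<in> R" using rt R by (auto intro!: R_add R_mult R_power)
    ultimately have 1: "comb rs [p'\<^sup>2 *s v0, p\<^sup>2 *s v0] \<in> L \<longleftrightarrow> dvdR 4 (r * p'\<^sup>2 + t * p\<^sup>2)"
      using v0_order by simp
    have 2: "dvdR (p\<^sup>2) r \<and> dvdR (p'\<^sup>2) t \<Longrightarrow> dvdR 4 (r * p'\<^sup>2 + t * p\<^sup>2)"
    proof (elim conjE)
      assume "dvdR (p\<^sup>2) r" "dvdR (p'\<^sup>2) t"
      then obtain x y where xy: "x \<in> R" "r = p\<^sup>2 * x" "y \<in> R" "t = p'\<^sup>2 * y" unfolding dvdR_def by blast
      have "r * p'\<^sup>2 + t * p\<^sup>2 = (p\<^sup>2 * p'\<^sup>2) * (x + y)" by (simp add: xy algebra_simps)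
      then show ?thesis unfolding four dvdR_def using xy R_add by blast
    qed
    have 3: "dvdR 4 (r * p'\<^sup>2 + t * p\<^sup>2) \<Longrightarrow> dvdR (p\<^sup>2) r \<and> dvdR (p'\<^sup>2) t"
    proof
      assume d: "dvdR 4 (r * p'\<^sup>2 + t * p\<^sup>2)"
      show "dvdR (p\<^sup>2) r"
        by (rule half[OF rt(2,3) d R four bez ab])
      have "dvdR 4 (t * p\<^sup>2 + r * p'\<^sup>2)" using d by (simp only: add.commute)
      moreover have "p'\<^sup>2 * p\<^sup>2 = 4" using four by (simp only: mult.commute)
      moreover have "p'\<^sup>2 * b + p\<^sup>2 * a = 1" using bez by (simp only: add.commute)
      ultimately show "dvdR (p'\<^sup>2) t" by (intro half[OF rt(3,2) _ R(2,1) _ _ ab(2,1)])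
    qed
    have "list_all2 dvdR [p\<^sup>2, p'\<^sup>2] rs \<longleftrightarrow> dvdR (p\<^sup>2) r \<and> dvdR (p'\<^sup>2) t"
      by (simp add: rt(1))
    then show "comb rs [p'\<^sup>2 *s v0, p\<^sup>2 *s v0] \<in> L \<longleftrightarrow> list_all2 dvdR [p\<^sup>2, p'\<^sup>2] rs"
      using 1 2 3 by blast
  qed simp
qed

text \<open>The parts are dual to each other, so \<open>part_dim_le\<close> in both directions gives
  one common multiplicity \<open>a\<close>, as the table for \<open>d = - 7\<close> demands.\<close>

lemma decomp_split:
  assumes s: "splitting p p'" and s': "splitting p' p"
  shows "\<exists>gs a. decomp (replicate a p @ replicate a p' @ [p\<^sup>2, p'\<^sup>2]) gs D L"
proof -
  obtain xs where xs: "decomp (replicate (length xs) p) xs (part p) L" using part_basis[OF s] by blast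
  obtain ys where ys: "decomp (replicate (length ys) p') ys (part p') L" using part_basis[OF s'] by blast
  have "length xs = length ys"
    using part_dim_le[OF s xs ys] part_dim_le[OF s' ys xs] by simp
  then show ?thesis
    using decomp_D[OF decomp_parts[OF s xs ys] N0_split[OF s]] by auto
qed

end

section \<open>Imaginary quadratic fields of class number one\<close>

lemma rt_squared [simp]: "rt d * rt d = of_int d"
  using power2_csqrt[of "of_int d"] by (simp add: power2_eq_square)

lemma rt_eq: "d < 0 \<Longrightarrow> rt d = \<i> * of_real (sqrt (- of_int d))"
  using csqrt_of_real_nonpos[of "of_int d"] by simp

lemma cnj_rt: "d < 0 \<Longrightarrow> cnj (rt d) = - rt d"
  by (simp add: rt_eq)

lemma rt_nz [simp]: "d < 0 \<Longrightarrow> rt d \<noteq> 0"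
  by (simp add: rt_eq)

lemma carrier_quad_field [simp]: "carrier (quad_field d) = quad_set d"
  and mult_quad_field [simp]: "x \<otimes>\<^bsub>quad_field d\<^esub> y = x * y"
  and add_quad_field [simp]: "x \<oplus>\<^bsub>quad_field d\<^esub> y = x + y"
  and one_quad_field [simp]: "\<one>\<^bsub>quad_field d\<^esub> = 1"
  and zero_quad_field [simp]: "\<zero>\<^bsub>quad_field d\<^esub> = 0"
  by (simp_all add: quad_field_def complex_subring_def)

lemma carrier_ring_of_ints: "carrier (ring_of_ints d) = {z \<in> quad_set d. algebraic_int z}"
  and mult_ring_of_ints [simp]: "x \<otimes>\<^bsub>ring_of_ints d\<^esub> y = x * y"
  and add_ring_of_ints [simp]: "x \<oplus>\<^bsub>ring_of_ints d\<^esub> y = x + y"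
  and one_ring_of_ints [simp]: "\<one>\<^bsub>ring_of_ints d\<^esub> = 1"
  and zero_ring_of_ints [simp]: "\<zero>\<^bsub>ring_of_ints d\<^esub> = 0"
  by (simp_all add: ring_of_ints_def complex_subring_def)

section \<open>Field operations in a quadratic field\<close>

lemma quad_setI: "of_rat a + of_rat b * rt d \<in> quad_set d"
  unfolding quad_set_def by blast

lemma quad_set_rat: "x \<in> \<rat> \<Longrightarrow> x \<in> quad_set d"
  using quad_setI[of _ 0 d] by (auto elim!: Rats_cases)

lemma quad_set_rt: "rt d \<in> quad_set d"
  using quad_setI[of 0 1 d] by simp

lemma quad_set_add: "x \<in> quad_set d \<Longrightarrow> y \<in> quad_set d \<Longrightarrow> x + y \<in> quad_set d"
proof -
  assume "x \<in> quad_set d" "y \<in> quad_set d"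
  then obtain a b a' b' where "x = of_rat a + of_rat b * rt d" "y = of_rat a' + of_rat b' * rt d"
    unfolding quad_set_def by blast
  then have "x + y = of_rat (a + a') + of_rat (b + b') * rt d" by (simp add: of_rat_add algebra_simps)
  then show ?thesis using quad_setI by metis
qed

lemma quad_set_mult: "x \<in> quad_set d \<Longrightarrow> y \<in> quad_set d \<Longrightarrow> x * y \<in> quad_set d"
proof -
  assume "x \<in> quad_set d" "y \<in> quad_set d"
  then obtain a b a' b' where "x = of_rat a + of_rat b * rt d" "y = of_rat a' + of_rat b' * rt d"
    unfolding quad_set_def by blast
  then have "x * y = of_rat (a * a' + of_int d * b * b') + of_rat (a * b' + b * a') * rt d"
    by (simp add: of_rat_add of_rat_mult algebra_simps)
  then show ?thesis using quad_setI by metis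
qed

lemma cnj_rat: "x \<in> \<rat> \<Longrightarrow> cnj x = x"
  by (metis Rats_cases' complex_cnj_divide complex_cnj_of_int)

lemma cnj_of_rat [simp]: "cnj (of_rat q) = of_rat q"
  by (rule cnj_rat) simp

lemma quad_set_cnj: "d < 0 \<Longrightarrow> x \<in> quad_set d \<Longrightarrow> cnj x \<in> quad_set d"
proof -
  assume d: "d < 0" and "x \<in> quad_set d"
  then obtain a b where "x = of_rat a + of_rat b * rt d"
    unfolding quad_set_def by blast
  then have "cnj x = of_rat a + of_rat (- b) * rt d" using d
    by (simp add: cnj_rt of_rat_minus)
  then show ?thesis using quad_setI by metis
qed

lemma quad_set_real:
  assumes d: "d < 0" and x: "x \<in> quad_set d" "cnj x = x"
  shows "x \<in> \<rat>"
proof -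
  obtain a b where ab: "x = of_rat a + of_rat b * rt d"
    using x unfolding quad_set_def by blast
  then have "cnj x = of_rat a - of_rat b * rt d" using d by (simp add: cnj_rt cnj_rat)
  then have "of_rat b * rt d = 0" using ab x(2) by simp
  then show ?thesis using ab d by simp
qed

lemma quad_set_inverse:
  assumes d: "d < 0" and x: "x \<in> quad_set d"
  shows "inverse x \<in> quad_set d"
proof (cases "x = 0")
  case True
  then show ?thesis using x by simp
next
  case False
  have n: "x * cnj x \<in> \<rat>"
    using d x by (intro quad_set_real[OF d] quad_set_mult quad_set_cnj) (simp_all add: mult.commute)
  have "inverse x = cnj x * inverse (x * cnj x)" using False by simp
  also have "\<dots> \<in> quad_set d"
    by (rule quad_set_mult[OF quad_set_cnj[OF d x] quad_set_rat[OF Rats_inverse[OF n]]])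
  finally show ?thesis .
qed

locale class_number_one =
  fixes d :: int
  assumes d_neg: "d < 0" and d_squarefree: "squarefree d" and class_number: "class_number d = 1"
begin

section \<open>The ring of integers and its ideals\<close>

definition R :: "complex set" where
  "R = carrier (ring_of_ints d)"

lemma R_iff: "x \<in> R \<longleftrightarrow> x \<in> quad_set d \<and> algebraic_int x"
  by (simp add: R_def carrier_ring_of_ints)

text \<open>Closure of the integers under sums and products is read off from the class number: the
  unique class shows that some ideal exists, and the locale \<open>ideal\<close> includes the ring
  axioms.\<close>

lemma ring_ring_of_ints: "ring (ring_of_ints d)"
proof -
  have "nonzero_ideals d // ideal_equiv d \<noteq> {}"
    using class_number unfolding class_number_def by auto
  then obtain J where "J \<in> nonzero_ideals d" by (auto simp: quotient_def)
  then show ?thesis using ideal.axioms(2) unfolding nonzero_ideals_def by blast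
qed

sublocale RI: ring "ring_of_ints d"
  by (rule ring_ring_of_ints)

lemma R_closed: "x \<in> R \<Longrightarrow> y \<in> R \<Longrightarrow> x + y \<in> R" "x \<in> R \<Longrightarrow> y \<in> R \<Longrightarrow> x * y \<in> R"
  using RI.a_closed[of x y] RI.m_closed[of x y] by (simp_all add: R_def)

lemma R_uminus: "x \<in> R \<Longrightarrow> - x \<in> R"
  using quad_set_mult[OF quad_set_rat[of "- 1"], of x d] by (simp add: R_iff)

lemma R_cnj: "x \<in> R \<Longrightarrow> cnj x \<in> R"
  using quad_set_cnj d_neg by (auto simp: R_iff)

lemma R_of_int [simp]: "of_int n \<in> R"
  using quad_set_rat by (simp add: R_iff)

lemma R_numeral [simp]: "numeral n \<in> R" "1 \<in> R" "0 \<in> R"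
  using R_of_int[of "numeral n"] R_of_int[of 1] R_of_int[of 0] by (simp_all del: R_of_int)

lemma R_rat: "x \<in> R \<Longrightarrow> x \<in> \<rat> \<Longrightarrow> x \<in> \<int>"
  using rational_algebraic_int_is_int[of x] by (simp add: R_iff)

lemma R_monic_quadratic:
  assumes "x \<in> quad_set d" and "x\<^sup>2 = of_int a * x + of_int b"
  shows "x \<in> R"
proof -
  have "algebraic_int x"
  proof (rule algebraic_int.intros)
    let ?p = "[:of_int (- b), of_int (- a), 1:]"
    show "lead_coeff ?p = 1" by simp
    show "\<forall>i. coeff ?p i \<in> \<int>" by (auto simp: coeff_pCons split: nat.split)
    show "poly ?p x = 0" using assms(2) by (simp add: power2_eq_square algebra_simps)
  qed
  then show ?thesis using assms(1) by (simp add: R_iff)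
qed

lemma R_rt: "rt d \<in> R"
  by (rule R_monic_quadratic[of _ 0 d]) (simp_all add: quad_set_rt power2_eq_square)

text \<open>With a single class, \<open>J\<close> is equivalent to the unit ideal,
  \<open>x J = y R\<close>, and the quotient of \<open>y\<close> by \<open>x\<close> generates
  \<open>J\<close>.\<close>

lemma principal:
  assumes J: "J \<subseteq> R" "0 \<in> J" "\<And>x y. x \<in> J \<Longrightarrow> y \<in> J \<Longrightarrow> x + y \<in> J"
    "\<And>r x. r \<in> R \<Longrightarrow> x \<in> J \<Longrightarrow> r * x \<in> J"
  shows "\<exists>g\<in>R. J = {r * g | r. r \<in> R}"
proof (cases "J = {0}")
  case True
  then show ?thesis by (intro bexI[of _ 0]) (auto intro: R_numeral)
next
  case False
  have neg: "- x \<in> J" if "x \<in> J" for x using J(4)[OF R_uminus[OF R_numeral(2)] that] by simp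
  have "ideal J (ring_of_ints d)"
  proof (rule idealI[OF ring_ring_of_ints])
    have "inv\<^bsub>add_monoid (ring_of_ints d)\<^esub> x = - x" if "x \<in> J" for x
      using RI.minus_equality[of "- x" x] J(1) that R_uminus by (auto simp: a_inv_def R_def)
    then show "subgroup J (add_monoid (ring_of_ints d))"
      using J neg by (intro subgroup.intro) (auto simp: R_def)
    show "x \<otimes>\<^bsub>ring_of_ints d\<^esub> a \<in> J" "a \<otimes>\<^bsub>ring_of_ints d\<^esub> x \<in> J"
      if "a \<in> J" "x \<in> carrier (ring_of_ints d)" for a x
      using J(4)[of x a] that by (simp_all add: R_def mult.commute)
  qed
  then have Jn: "J \<in> nonzero_ideals d" using False by (simp add: nonzero_ideals_def)
  have "1 \<in> R" by simp
  then have "R \<noteq> {0}" by (metis singletonD zero_neq_one)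
  then have Rn: "R \<in> nonzero_ideals d"
    using RI.oneideal by (simp add: nonzero_ideals_def R_def)
  have refl: "(R, R) \<in> ideal_equiv d"
    unfolding ideal_equiv_def using Rn R_numeral by (auto simp: R_def intro!: bexI[of _ 1])
  obtain C where C: "nonzero_ideals d // ideal_equiv d = {C}"
    using class_number card_1_singletonE unfolding class_number_def by metis
  \<comment> \<open>Both images are members of a one-element quotient, hence the same set, and
    \<open>(J, R)\<close> follows from \<open>(R, R)\<close>.\<close>
  have "ideal_equiv d `` {J} = C" "ideal_equiv d `` {R} = C"
    using quotientI[OF Jn, of "ideal_equiv d"] quotientI[OF Rn, of "ideal_equiv d"] C by auto
  then have "(J, R) \<in> ideal_equiv d" using refl by blast
  then obtain x y where xy: "x \<in> R" "x \<noteq> 0" "y \<in> R" "y \<noteq> 0" "(\<lambda>z. x * z) ` J = (\<lambda>z. y * z) ` R"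
    unfolding ideal_equiv_def R_def by auto
  have "y * 1 \<in> (\<lambda>z. x * z) ` J" unfolding xy(5) using R_numeral by blast
  then obtain g where g: "g \<in> J" "y = x * g" by auto
  have "J = {r * g | r. r \<in> R}"
  proof (intro equalityI subsetI)
    fix z assume "z \<in> J"
    then have "x * z \<in> (\<lambda>z. y * z) ` R" using xy(5) by blast
    then obtain r where "r \<in> R" "x * z = y * r" by blast
    then have "z = r * g" "r \<in> R" using g xy(2) by auto
    then show "z \<in> {r * g | r. r \<in> R}" by blast
  qed (use g J in auto)
  then show ?thesis using g J by blast
qed

lemma norm_int: "x \<in> R \<Longrightarrow> \<exists>N. cnj x * x = of_int N"
proof -
  assume x: "x \<in> R"
  have "cnj x * x \<in> R" using x R_closed R_cnj by blast
  moreover have "cnj x * x \<in> \<rat>"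
    by (rule quad_set_real[OF d_neg]) (use x calculation in \<open>auto simp: R_iff mult.commute\<close>)
  ultimately show ?thesis using R_rat by (auto elim: Ints_cases)
qed

text \<open>Trace and norm are rational and integral over the integers, hence integers. The trace
  leaves at most a denominator 2 in the rational coordinate; four times the norm, with
  \<open>d\<close> squarefree, does the same for the coefficient of \<open>rt d\<close>.\<close>

lemma R_cases:
  assumes x: "x \<in> R"
  obtains A B :: int where "x = (of_int A + of_int B * rt d) / 2" "4 dvd A\<^sup>2 - d * B\<^sup>2"
proof -
  obtain a b where ab: "x = of_rat a + of_rat b * rt d"
    using x unfolding R_iff quad_set_def by blast
  have cx: "cnj x = of_rat a - of_rat b * rt d" using ab d_neg by (simp add: cnj_rt cnj_rat)
  have tr: "x + cnj x = of_rat (2 * a)" using ab cx by (simp add: of_rat_mult)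
  then have "(of_rat (2 * a) :: complex) \<in> \<int>" using R_rat R_closed R_cnj x by (metis Rats_of_rat)
  then obtain A where A: "of_rat (2 * a) = (of_int A :: complex)" by (auto elim: Ints_cases)
  obtain N where N: "cnj x * x = of_int N" using norm_int x by blast
  have n: "cnj x * x = (of_rat a)\<^sup>2 - of_int d * (of_rat b)\<^sup>2"
    unfolding cx unfolding ab by (simp add: power2_eq_square algebra_simps)
  define q :: complex where "q = of_rat (2 * b)"
  have A2: "of_int A = 2 * (of_rat a :: complex)" using A by (simp add: of_rat_mult)
  have q2: "q = 2 * of_rat b" by (simp add: q_def of_rat_mult)
  have N4: "4 * of_int N = (of_int A)\<^sup>2 - of_int d * q\<^sup>2"
    using n N by (simp add: A2 q2 power_mult_distrib)
  then have "q\<^sup>2 * of_nat (nat (- d)) = of_int (4 * N - A\<^sup>2)"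
    using d_neg by (simp add: algebra_simps)
  then have "q\<^sup>2 * of_nat (nat (- d)) \<in> \<int>" by simp
  moreover have "squarefree (nat (- d))"
    unfolding squarefree_def
  proof (intro allI impI)
    fix x :: nat assume "x\<^sup>2 dvd nat (- d)"
    then have "int (x\<^sup>2) dvd int (nat (- d))" by (simp only: int_dvd_int_iff)
    then have "(int x)\<^sup>2 dvd d" using d_neg by simp
    then have "int x dvd 1" using d_squarefree unfolding squarefree_def by blast
    then show "x dvd 1" by simp
  qed
  ultimately have "q \<in> \<int>" using rational_times_squarefree_int[of q] by (simp add: q_def)
  then obtain B where B: "q = of_int B" by (auto elim: Ints_cases)
  have "(of_int (4 * N) :: complex) = of_int (A\<^sup>2 - d * B\<^sup>2)" using N4 B by simp
  then have "4 * N = A\<^sup>2 - d * B\<^sup>2" by (simp only: of_int_eq_iff)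
  then have "4 dvd A\<^sup>2 - d * B\<^sup>2" by (metis dvd_triv_left)
  moreover have "x = (of_int A + of_int B * rt d) / 2" unfolding ab A2 B[symmetric] q2
    by (simp add: field_simps)
  ultimately show thesis using that by blast
qed

text \<open>The numerators \<open>A\<close> and \<open>B\<close> modulo 8 determine the class modulo
  4, because of the common denominator 2. One representative for each attained pair
  suffices.\<close>

lemma R_mod_4: "\<exists>Z. finite Z \<and> (\<forall>r\<in>R. \<exists>z\<in>Z. \<exists>x\<in>R. r - z = 4 * x)"
proof -
  have "\<forall>r\<in>R. \<exists>A B. r = (of_int A + of_int B * rt d) / 2" by (metis R_cases)
  then obtain A B :: "complex \<Rightarrow> int" where AB: "\<And>r. r \<in> R \<Longrightarrow> r = (of_int (A r) + of_int (B r) * rt d) / 2"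
    by metis
  define f where "f r = (A r mod 8, B r mod 8)" for r
  define Z where "Z = inv_into R f ` f ` R"
  have "f ` R \<subseteq> {0..<8} \<times> {0..<8}" by (auto simp: f_def)
  then have "finite (f ` R)" by (rule finite_subset) auto
  then have "finite Z" by (simp add: Z_def)
  moreover have "\<exists>z\<in>Z. \<exists>x\<in>R. r - z = 4 * x" if r: "r \<in> R" for r
  proof -
    define z where "z = inv_into R f (f r)"
    have z: "z \<in> Z" "z \<in> R" "f z = f r"
      using r by (auto simp: z_def Z_def f_inv_into_f inv_into_into)
    then have "8 dvd A r - A z" "8 dvd B r - B z"
      unfolding f_def by (simp_all flip: mod_eq_dvd_iff)
    then obtain a b where ab: "A r - A z = 8 * a" "B r - B z = 8 * b" by (auto elim!: dvdE)
    have "r - z = (of_int (A r - A z) + of_int (B r - B z) * rt d) / 2"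
      using AB[OF r] AB[OF z(2)] by (simp add: field_simps)
    also have "\<dots> = 4 * (of_int a + of_int b * rt d)" unfolding ab by simp
    finally have "r - z = 4 * (of_int a + of_int b * rt d)" .
    moreover have "of_int a + of_int b * rt d \<in> R" using R_rt R_closed by simp
    ultimately show ?thesis using z by blast
  qed
  ultimately show ?thesis by blast
qed

lemma fractions:
  assumes "x \<in> quad_set d"
  shows "\<exists>r\<in>R. r \<noteq> 0 \<and> r * x \<in> R"
proof -
  obtain a b where ab: "x = of_rat a + of_rat b * rt d"
    using assms unfolding quad_set_def by blast
  obtain p q where p: "of_rat a = (of_int p / of_int q :: complex)" "q > 0"
    using Rats_cases'[OF Rats_of_rat[of a, where 'a = complex]] by metis
  obtain s t where s: "of_rat b = (of_int s / of_int t :: complex)" "t > 0"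
    using Rats_cases'[OF Rats_of_rat[of b, where 'a = complex]] by metis
  have "of_int (q * t) * x = of_int (p * t) + of_int (s * q) * rt d"
    unfolding ab p(1) s(1) using p(2) s(2) by (simp add: field_simps)
  also have "\<dots> \<in> R" using R_rt R_closed R_of_int by blast
  finally show ?thesis using p(2) s(2) by (intro bexI[OF _ R_of_int[of "q * t"]]) auto
qed

lemma kappa_properties: "kappa d \<in> quad_set d" "kappa d \<noteq> 0" "cnj (kappa d) = - kappa d"
proof -
  have i: "inverse (rt d) \<in> quad_set d" by (rule quad_set_inverse[OF d_neg quad_set_rt])
  have "(1 / 2) * inverse (rt d) \<in> quad_set d" by (rule quad_set_mult[OF quad_set_rat i]) simp
  moreover have "1 / (2 * rt d) = (1 / 2) * inverse (rt d)" "1 / rt d = inverse (rt d)"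
    using rt_nz[OF d_neg] by (simp_all only: divide_inverse inverse_mult_distrib mult_1_left)
  ultimately show "kappa d \<in> quad_set d"
    using i unfolding kappa_def by presburger
  show "kappa d \<noteq> 0" "cnj (kappa d) = - kappa d"
    using rt_nz[OF d_neg] cnj_rt[OF d_neg] unfolding kappa_def by auto
qed

lemma kappa_ideal_eq: "kappa_ideal d = {kappa d * r | r. r \<in> R}"
  by (simp add: kappa_ideal_def R_def)

lemma unit_equivI:
  assumes "x / y \<in> R" "y / x \<in> R" "x \<noteq> 0" "y \<noteq> 0"
  shows "unit_equiv d x y"
proof -
  have "x / y \<in> Units (ring_of_ints d)"
    unfolding Units_def mem_Collect_eq R_def[symmetric]
    by (intro conjI bexI[OF _ assms(2)] assms(1)) (use assms(3,4) in simp_all)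
  moreover have "x = x / y * y" using assms(4) by simp
  ultimately show ?thesis unfolding unit_equiv_def by blast
qed

end

lemma omega_properties:
  shows "cnj omega * omega = 1" "omega\<^sup>2 = - 1 * omega + - 1" "cnj omega = - 1 - omega"
    "omega \<in> quad_set (- 3)"
proof -
  define r where "r = rt (- 3)"
  have r: "r * r = - 3" using rt_squared[of "- 3"] by (simp add: r_def)
  have o: "omega = (- 1 + r) / 2" by (simp only: omega_def r_def)
  have c: "cnj omega = (- 1 - r) / 2" using cnj_rt[of "- 3"] by (simp add: o r_def)
  show "omega\<^sup>2 = - 1 * omega + - 1" unfolding o using r by (simp add: power2_eq_square field_simps)
  show "cnj omega * omega = 1" unfolding c unfolding o using r by (simp add: field_simps)
  show "cnj omega = - 1 - omega" unfolding c unfolding o by (simp add: field_simps)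
  have "of_rat (- 1 / 2) + of_rat (1 / 2) * r \<in> quad_set (- 3)" unfolding r_def by (rule quad_setI)
  then show "omega \<in> quad_set (- 3)" by (simp add: o of_rat_divide of_rat_minus field_simps)
qed

section \<open>Embedding a Hermitian lattice into a type-class vector space\<close>

definition fun_scale :: "complex \<Rightarrow> ('v \<Rightarrow> complex) \<Rightarrow> 'v \<Rightarrow> complex" where
  "fun_scale a f = (\<lambda>w. a * f w)"

lemma vector_space_fun_scale: "vector_space fun_scale"
  by unfold_locales (simp_all add: fun_scale_def fun_eq_iff algebra_simps)

locale class_one_lattice = class_number_one d for d :: int +
  fixes V :: "(complex, 'v) module" (structure) and h :: "'v \<Rightarrow> 'v \<Rightarrow> complex" and L :: "'v set"
  assumes hermitian: "hermitian_lattice d V h L"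
begin

sublocale VM: Module.module "quad_field d" V
  using hermitian by (simp add: hermitian_lattice_def)

lemma R_quad [simp]: "x \<in> R \<Longrightarrow> x \<in> quad_set d"
  by (simp add: R_iff)

lemma smult_closed [simp]: "a \<in> quad_set d \<Longrightarrow> x \<in> carrier V \<Longrightarrow> a \<odot> x \<in> carrier V"
  using VM.smult_closed[of a x] by simp

lemma smult_assoc: "a \<in> quad_set d \<Longrightarrow> b \<in> quad_set d \<Longrightarrow> x \<in> carrier V \<Longrightarrow>
    a \<odot> (b \<odot> x) = (a * b) \<odot> x"
  using VM.smult_assoc1[of a b x] by simp

lemma smult_add: "a \<in> quad_set d \<Longrightarrow> x \<in> carrier V \<Longrightarrow> y \<in> carrier V \<Longrightarrow>
    a \<odot> (x \<oplus> y) = a \<odot> x \<oplus> a \<odot> y"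
  using VM.smult_r_distr[of a x y] by simp

lemma smult_one [simp]: "x \<in> carrier V \<Longrightarrow> 1 \<odot> x = x"
  using VM.smult_one[of x] by simp

lemma smult_inverse: "a \<in> quad_set d \<Longrightarrow> a \<noteq> 0 \<Longrightarrow> x \<in> carrier V \<Longrightarrow>
    inverse a \<odot> (a \<odot> x) = x"
  using quad_set_inverse[OF d_neg] by (simp add: smult_assoc)

lemma h_quad: "x \<in> carrier V \<Longrightarrow> y \<in> carrier V \<Longrightarrow> h x y \<in> quad_set d"
  and h_add: "x \<in> carrier V \<Longrightarrow> y \<in> carrier V \<Longrightarrow> z \<in> carrier V \<Longrightarrow> h (x \<oplus> y) z = h x z + h y z"
  and h_smult: "a \<in> quad_set d \<Longrightarrow> x \<in> carrier V \<Longrightarrow> y \<in> carrier V \<Longrightarrow> h (a \<odot> x) y = a * h x y"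
  and h_cnj: "x \<in> carrier V \<Longrightarrow> y \<in> carrier V \<Longrightarrow> h y x = cnj (h x y)"
  and h_L: "x \<in> L \<Longrightarrow> y \<in> L \<Longrightarrow> h x y \<in> kappa_ideal d"
  and L_nondegenerate: "x \<in> L \<Longrightarrow> \<forall>y\<in>L. h x y = 0 \<Longrightarrow> x = \<zero>"
  and submodule_L: "submodule L (ring_of_ints d) V"
  and gen_L: "gen_submodule (quad_field d) V L = carrier V"
  using hermitian unfolding hermitian_lattice_def by blast+

lemma minus_eq: "x \<in> carrier V \<Longrightarrow> \<ominus> x = (- 1) \<odot> x"
proof -
  assume x: "x \<in> carrier V"
  have m: "- 1 \<in> quad_set d" by (rule quad_set_rat) simp
  have "(- 1) \<odot> x \<oplus> 1 \<odot> x = \<zero>"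
    using VM.smult_l_distr[of "- 1" 1 x] VM.smult_l_null[of x] x m quad_set_rat[of 1] by simp
  then have "(- 1) \<odot> x \<oplus> x = \<zero>" using x by simp
  then show ?thesis using VM.minus_equality[of "(- 1) \<odot> x" x] x m by simp
qed

lemma submoduleI:
  assumes "N \<subseteq> carrier V" "\<zero> \<in> N" "\<And>x y. x \<in> N \<Longrightarrow> y \<in> N \<Longrightarrow> x \<oplus> y \<in> N"
    "\<And>a x. a \<in> carrier S \<Longrightarrow> x \<in> N \<Longrightarrow> a \<odot> x \<in> N" "- 1 \<in> carrier S"
  shows "submodule N S V"
proof -
  have "inv\<^bsub>add_monoid V\<^esub> x \<in> N" if "x \<in> N" for x
    using minus_eq[of x] assms(4)[OF assms(5) that] assms(1) that by (auto simp: a_inv_def)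
  then show ?thesis
    using assms by (intro submodule.intro subgroup.intro submodule_axioms.intro) auto
qed

lemma submodule_facts:
  assumes "submodule N S V"
  shows "N \<subseteq> carrier V" "\<zero> \<in> N" "x \<in> N \<Longrightarrow> y \<in> N \<Longrightarrow> x \<oplus> y \<in> N"
    "a \<in> carrier S \<Longrightarrow> x \<in> N \<Longrightarrow> a \<odot> x \<in> N"
  using subgroup.subset[OF submodule.axioms(1)[OF assms]]
    subgroup.one_closed[OF submodule.axioms(1)[OF assms]]
    subgroup.m_closed[OF submodule.axioms(1)[OF assms]] submodule.smult_closed[OF assms] by auto

lemmas L_facts = submodule_facts[OF submodule_L, folded R_def]

lemma L_carrier [simp]: "x \<in> L \<Longrightarrow> x \<in> carrier V"
  using L_facts(1) by blast

lemma gen_submodule_subset: "submodule N S V \<Longrightarrow> X \<subseteq> N \<Longrightarrow> gen_submodule S V X \<subseteq> N"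
  unfolding gen_submodule_def by blast

text \<open>The vectors with a nonzero multiple in \<open>L\<close> form a subspace over the field;
  it contains \<open>L\<close>, and \<open>L\<close> spans \<open>V\<close>.\<close>

lemma L_denominator:
  assumes "v \<in> carrier V"
  shows "\<exists>r\<in>R. r \<noteq> 0 \<and> r \<odot> v \<in> L"
proof -
  let ?N = "{v \<in> carrier V. \<exists>r\<in>R. r \<noteq> 0 \<and> r \<odot> v \<in> L}"
  have one: "1 \<in> R" by simp
  have "submodule ?N (quad_field d) V"
  proof (rule submoduleI)
    have "1 \<odot> \<zero> \<in> L" using L_facts(2) by simp
    then show "\<zero> \<in> ?N" using one L_facts(2) by (auto intro!: bexI[of _ 1])
  next
    fix x y assume "x \<in> ?N" "y \<in> ?N"
    then obtain r s where rs: "x \<in> carrier V" "y \<in> carrier V" "r \<in> R" "s \<in> R" "r \<noteq> 0" "s \<noteq> 0"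
      "r \<odot> x \<in> L" "s \<odot> y \<in> L" by blast
    have "s \<odot> (r \<odot> x) \<oplus> r \<odot> (s \<odot> y) \<in> L" using rs L_facts by blast
    also have "s \<odot> (r \<odot> x) \<oplus> r \<odot> (s \<odot> y) = (r * s) \<odot> (x \<oplus> y)"
      using rs R_closed(2)[of r s] by (simp add: smult_assoc smult_add mult.commute)
    finally show "x \<oplus> y \<in> ?N" using rs R_closed(2)[of r s] by (auto intro!: bexI[of _ "r * s"])
  next
    fix a x assume ax: "a \<in> carrier (quad_field d)" "x \<in> ?N"
    then obtain r where r: "x \<in> carrier V" "r \<in> R" "r \<noteq> 0" "r \<odot> x \<in> L" by blast
    obtain t where t: "t \<in> R" "t \<noteq> 0" "t * a \<in> R" using fractions[of a] ax by auto
    have "(t * a) \<odot> (r \<odot> x) \<in> L" using t r L_facts by blast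
    also have "(t * a) \<odot> (r \<odot> x) = (t * r) \<odot> (a \<odot> x)"
      using t r ax R_closed(2)[of t r] by (simp add: smult_assoc mult.commute mult.left_commute)
    finally show "a \<odot> x \<in> ?N" using t r ax R_closed(2)[of t r] by (auto intro!: bexI[of _ "t * r"])
  next
    show "- 1 \<in> carrier (quad_field d)" using quad_set_rat[of "- 1"] by simp
  qed auto
  moreover have "L \<subseteq> ?N" using one L_facts(1) by (auto intro!: bexI[of _ 1])
  ultimately have "carrier V \<subseteq> ?N" using gen_submodule_subset gen_L by blast
  then show ?thesis using assms by blast
qed

text \<open>The form embeds \<open>V\<close> into the functions on \<open>V\<close>, where type-class algebra is available.\<close>

definition \<psi> :: "'v \<Rightarrow> 'v \<Rightarrow> complex" where
  "\<psi> v = (\<lambda>w. if w \<in> carrier V then h v w else 0)"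

definition VV :: "('v \<Rightarrow> complex) set" where "VV = \<psi> ` carrier V"
definition LL :: "('v \<Rightarrow> complex) set" where "LL = \<psi> ` L"

text \<open>An embedded vector is its own functional \<open>h v _\<close>, so the form becomes
  evaluation of \<open>f\<close> at the vector that \<open>g\<close> represents. Linearity in the
  first argument then holds for all functions.\<close>

definition hh :: "('v \<Rightarrow> complex) \<Rightarrow> ('v \<Rightarrow> complex) \<Rightarrow> complex" where
  "hh f g = f (inv_into (carrier V) \<psi> g)"

lemma \<psi>_add: "v \<in> carrier V \<Longrightarrow> w \<in> carrier V \<Longrightarrow> \<psi> (v \<oplus> w) = \<psi> v + \<psi> w"
  by (simp add: \<psi>_def fun_eq_iff h_add)

lemma \<psi>_smult: "a \<in> quad_set d \<Longrightarrow> v \<in> carrier V \<Longrightarrow> \<psi> (a \<odot> v) = fun_scale a (\<psi> v)"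
  by (simp add: \<psi>_def fun_eq_iff fun_scale_def h_smult)

lemma \<psi>_zero [simp]: "\<psi> \<zero> = 0"
  using \<psi>_add[of "\<zero>" "\<zero>"] by simp

text \<open>Injectivity of the embedding is nondegeneracy, carried from \<open>L\<close> to
  \<open>V\<close> by clearing denominators.\<close>

lemma \<psi>_eq_0: "v \<in> carrier V \<Longrightarrow> \<psi> v = 0 \<Longrightarrow> v = \<zero>"
proof -
  assume v: "v \<in> carrier V" "\<psi> v = 0"
  have 0: "h v w = 0" if "w \<in> carrier V" for w
    using fun_cong[OF v(2), of w] that by (simp add: \<psi>_def)
  obtain r where r: "r \<in> R" "r \<noteq> 0" "r \<odot> v \<in> L" using L_denominator v by blast
  have "r \<odot> v = \<zero>" using r v 0 by (intro L_nondegenerate) (auto simp: h_smult)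
  then have "inverse r \<odot> \<zero> = v" using smult_inverse[of r v] r v by simp
  then show "v = \<zero>" using VM.smult_r_null[of "inverse r"] quad_set_inverse[OF d_neg, of r] r by simp
qed

lemma \<psi>_minus: "v \<in> carrier V \<Longrightarrow> w \<in> carrier V \<Longrightarrow> \<psi> (v \<ominus> w) = \<psi> v - \<psi> w"
proof -
  assume v: "v \<in> carrier V" "w \<in> carrier V"
  have "- 1 \<in> quad_set d" by (rule quad_set_rat) simp
  then show ?thesis using v
    by (simp add: a_minus_def \<psi>_add \<psi>_smult minus_eq) (simp add: fun_eq_iff fun_scale_def)
qed

lemma inj_\<psi>: "inj_on \<psi> (carrier V)"
proof (rule inj_onI)
  fix v w assume v: "v \<in> carrier V" "w \<in> carrier V" "\<psi> v = \<psi> w"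
  then have "v \<ominus> w = \<zero>" by (intro \<psi>_eq_0) (simp_all add: \<psi>_minus)
  moreover have "v = (v \<ominus> w) \<oplus> w"
    using v by (simp add: a_minus_def VM.add.m_assoc VM.l_neg)
  ultimately show "v = w" using v by simp
qed

lemma \<psi>_eq_iff: "v \<in> carrier V \<Longrightarrow> w \<in> carrier V \<Longrightarrow> \<psi> v = \<psi> w \<longleftrightarrow> v = w"
  using inj_\<psi> by (auto dest: inj_onD)

lemma \<psi>_in_LL: "v \<in> carrier V \<Longrightarrow> \<psi> v \<in> LL \<longleftrightarrow> v \<in> L"
  unfolding LL_def using \<psi>_eq_iff by auto

lemma hh_\<psi>: "v \<in> carrier V \<Longrightarrow> w \<in> carrier V \<Longrightarrow> hh (\<psi> v) (\<psi> w) = h v w"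
  unfolding hh_def by (simp add: inv_into_f_f[OF inj_\<psi>]) (simp add: \<psi>_def)

sublocale S: subring_scaling fun_scale R
proof -
  interpret vector_space fun_scale by (rule vector_space_fun_scale)
  show "subring_scaling fun_scale R"
    by unfold_locales (use R_closed R_uminus in auto)
qed

lemma submod_image:
  assumes "submodule N (ring_of_ints d) V"
  shows "S.submod (\<psi> ` N)"
proof -
  note N = submodule_facts[OF assms, folded R_def]
  have NV: "v \<in> carrier V" if "v \<in> N" for v using that N(1) by blast
  show ?thesis unfolding S.submod_def
  proof (intro conjI ballI)
    show "0 \<in> \<psi> ` N" using N(2) by (rule image_eqI[where x = "\<zero>", rotated]) simp
    show "x + y \<in> \<psi> ` N" if "x \<in> \<psi> ` N" "y \<in> \<psi> ` N" for x y
      using that NV by (auto intro!: imageI N simp flip: \<psi>_add)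
    show "fun_scale r x \<in> \<psi> ` N" if "r \<in> R" "x \<in> \<psi> ` N" for r x
      using that NV by (auto intro!: imageI N simp flip: \<psi>_smult)
  qed
qed

lemma submod_LL: "S.submod LL"
  unfolding LL_def by (rule submod_image[OF submodule_L])

lemma LL_generated: "\<exists>ss. set ss \<subseteq> LL \<and> LL \<subseteq> S.span_of ss"
proof -
  obtain X where X: "finite X" "X \<subseteq> carrier V" "L = gen_submodule (ring_of_ints d) V X"
    using hermitian unfolding hermitian_lattice_def by blast
  obtain xs where xs: "set xs = X" using finite_list[OF X(1)] by blast
  have "X \<subseteq> L" unfolding X(3) gen_submodule_def by blast
  let ?N = "{v \<in> carrier V. \<psi> v \<in> S.span_of (map \<psi> xs)}"
  have sub: "S.submod (S.span_of (map \<psi> xs))" by (rule S.submod_span)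
  have "submodule ?N (ring_of_ints d) V"
    using R_uminus[of 1] sub
    by (intro submoduleI) (auto simp: \<psi>_add \<psi>_smult S.submod_add S.submod_scale simp flip: R_def)
  moreover have "X \<subseteq> ?N" using X(2) xs S.in_span[of _ "map \<psi> xs"] by auto
  ultimately have "L \<subseteq> ?N" unfolding X(3) by (rule gen_submodule_subset)
  then have "LL \<subseteq> S.span_of (map \<psi> xs)" by (auto simp: LL_def)
  moreover have "set (map \<psi> xs) \<subseteq> LL" using \<open>X \<subseteq> L\<close> xs by (auto simp: LL_def)
  ultimately show ?thesis by blast
qed

sublocale H: hermitian_space fun_scale R "quad_set d" "kappa d" VV LL hh
proof unfold_locales
  show "R \<subseteq> quad_set d" by auto
  show "x + y \<in> quad_set d" "x * y \<in> quad_set d" if "x \<in> quad_set d" "y \<in> quad_set d" for x y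
    using quad_set_add quad_set_mult that by blast+
  show "inverse x \<in> quad_set d" "cnj x \<in> quad_set d" if "x \<in> quad_set d" for x
    using quad_set_inverse quad_set_cnj that d_neg by blast+
  show "x \<in> \<rat>" if "x \<in> quad_set d" "cnj x = x" for x
    using quad_set_real that d_neg by blast
  show "cnj x \<in> R" if "x \<in> R" for x using R_cnj that by blast
  show "x \<in> \<int>" if "x \<in> R" "x \<in> \<rat>" for x using R_rat that by blast
  show "\<exists>g\<in>R. J = {r * g |r. r \<in> R}"
    if "J \<subseteq> R" "0 \<in> J" "\<And>x y. x \<in> J \<Longrightarrow> y \<in> J \<Longrightarrow> x + y \<in> J" "\<And>r x. r \<in> R \<Longrightarrow> x \<in> J \<Longrightarrow> r * x \<in> J" for J
    by (rule principal[OF that])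
  show "\<exists>Z. finite Z \<and> (\<forall>r\<in>R. \<exists>z\<in>Z. S.dvdR 4 (r - z))"
    using R_mod_4 unfolding S.dvdR_def .
  show "kappa d \<in> quad_set d" "kappa d \<noteq> 0" "cnj (kappa d) = - kappa d"
    by (rule kappa_properties)+
  show "0 \<in> VV" unfolding VV_def by (rule image_eqI[where x = "\<zero>"]) simp_all
  show "x + y \<in> VV" if "x \<in> VV" "y \<in> VV" for x y
    using that unfolding VV_def by (auto intro!: imageI simp flip: \<psi>_add)
  show "fun_scale a x \<in> VV" if "a \<in> quad_set d" "x \<in> VV" for a x
    using that unfolding VV_def by (auto intro!: imageI simp flip: \<psi>_smult)
  show "LL \<subseteq> VV" by (auto simp: LL_def VV_def)
  show "S.submod LL" by (rule submod_LL)
  show "\<exists>ss. set ss \<subseteq> LL \<and> LL \<subseteq> S.span_of ss" by (rule LL_generated)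
  show "\<exists>r\<in>R. r \<noteq> 0 \<and> fun_scale r x \<in> LL" if x: "x \<in> VV" for x
  proof -
    obtain v where v: "v \<in> carrier V" "x = \<psi> v" using x by (auto simp: VV_def)
    obtain r where "r \<in> R" "r \<noteq> 0" "r \<odot> v \<in> L" using L_denominator v by blast
    then show ?thesis using v by (intro bexI[of _ r]) (auto simp: LL_def simp flip: \<psi>_smult)
  qed
  show "hh x y \<in> quad_set d" if "x \<in> VV" "y \<in> VV" for x y
    using that by (auto simp: VV_def hh_\<psi> h_quad)
  show "hh (x + y) z = hh x z + hh y z" for x y z
    by (simp add: hh_def)
  show "hh (fun_scale a x) y = a * hh x y" for a x y
    by (simp add: hh_def fun_scale_def)
  show "hh y x = cnj (hh x y)" if "x \<in> VV" "y \<in> VV" for x y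
    using that unfolding VV_def by (auto simp: hh_\<psi> intro: h_cnj)
  show "\<exists>r\<in>R. hh x y = kappa d * r" if "x \<in> LL" "y \<in> LL" for x y
    using that h_L[unfolded kappa_ideal_eq] unfolding LL_def by (force simp: hh_\<psi>)
  show "x = 0" if x: "x \<in> LL" "\<And>y. y \<in> LL \<Longrightarrow> hh x y = 0" for x
  proof -
    obtain v where v: "v \<in> L" "x = \<psi> v" using x by (auto simp: LL_def)
    have "h v y = 0" if "y \<in> L" for y
      using x(2)[of "\<psi> y"] v that by (simp add: LL_def hh_\<psi>)
    then have "v = \<zero>" using L_nondegenerate[OF v(1)] by blast
    then show ?thesis using v by simp
  qed
qed

section \<open>The discriminant module in terms of embedded vectors\<close>

definition L_dual :: "'v set" where
  "L_dual = dual_lattice d V h L"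

lemma L_dual_carrier [simp]: "v \<in> L_dual \<Longrightarrow> v \<in> carrier V"
  by (simp add: L_dual_def dual_lattice_def)

lemma kR_eq: "H.kR = kappa_ideal d"
  by (simp add: H.kR_def kappa_ideal_eq)

lemma D_eq: "H.D = \<psi> ` L_dual"
  unfolding H.D_def kR_eq L_dual_def dual_lattice_def by (auto simp: VV_def LL_def hh_\<psi>)

lemma \<psi>_in_D: "v \<in> carrier V \<Longrightarrow> \<psi> v \<in> H.D \<longleftrightarrow> v \<in> L_dual"
  unfolding D_eq using \<psi>_eq_iff by auto

lemma \<psi>_D: "v \<in> L_dual \<Longrightarrow> \<psi> v \<in> H.D"
  unfolding D_eq by (rule imageI)

lemma L_dual_closed:
  "v \<in> L_dual \<Longrightarrow> w \<in> L_dual \<Longrightarrow> v \<oplus> w \<in> L_dual"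
  "r \<in> R \<Longrightarrow> v \<in> L_dual \<Longrightarrow> r \<odot> v \<in> L_dual"
proof -
  show "v \<oplus> w \<in> L_dual" if "v \<in> L_dual" "w \<in> L_dual"
    using S.submod_add[OF H.submod_D \<psi>_D[OF that(1)] \<psi>_D[OF that(2)]] that
    by (simp flip: \<psi>_in_D \<psi>_add)
  show "r \<odot> v \<in> L_dual" if "r \<in> R" "v \<in> L_dual"
    using S.submod_scale[OF H.submod_D that(1) \<psi>_D[OF that(2)]] that
    by (simp flip: \<psi>_in_D \<psi>_smult)
qed

text \<open>Written through \<open>\<psi>\<close> so that congruence modulo \<open>L\<close> becomes
  membership in \<open>LL\<close>; \<open>r_coset_eq\<close> identifies it with the coset of the
  record, whatever its carrier field.\<close>

definition coset :: "'v \<Rightarrow> 'v set" where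
  "coset v = {x \<in> carrier V. \<psi> x - \<psi> v \<in> LL}"

lemma coset_eq_iff: "v \<in> carrier V \<Longrightarrow> w \<in> carrier V \<Longrightarrow> coset v = coset w \<longleftrightarrow> \<psi> v - \<psi> w \<in> LL"
proof
  assume v: "v \<in> carrier V" "w \<in> carrier V" "coset v = coset w"
  have "v \<in> coset v" using v(1) submod_LL by (simp add: coset_def)
  then have "v \<in> coset w" unfolding v(3) .
  then show "\<psi> v - \<psi> w \<in> LL" by (simp add: coset_def)
next
  assume *: "\<psi> v - \<psi> w \<in> LL"
  show "coset v = coset w"
    unfolding coset_def
    using S.submod_trans[OF submod_LL _ *] S.submod_trans[OF submod_LL _ S.submod_sym[OF submod_LL *]]
    by auto
qed

lemma r_coset_eq: "v \<in> carrier V \<Longrightarrow> L +>\<^bsub>V\<lparr>carrier := X\<rparr>\<^esub> v = coset v"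
proof (intro equalityI subsetI)
  fix x assume v: "v \<in> carrier V" and "x \<in> L +>\<^bsub>V\<lparr>carrier := X\<rparr>\<^esub> v"
  then obtain l where "l \<in> L" "x = l \<oplus> v" by (auto simp: a_r_coset_def')
  then show "x \<in> coset v" using v by (auto simp: coset_def \<psi>_add LL_def)
next
  fix x assume v: "v \<in> carrier V" and x: "x \<in> coset v"
  then have "x \<ominus> v \<in> L" by (simp add: coset_def \<psi>_minus flip: \<psi>_in_LL)
  moreover have "x = (x \<ominus> v) \<oplus> v"
    using v x by (simp add: coset_def a_minus_def VM.add.m_assoc VM.l_neg)
  ultimately show "x \<in> L +>\<^bsub>V\<lparr>carrier := X\<rparr>\<^esub> v" unfolding a_r_coset_def' by auto
qed

abbreviation disc_group ("A\<^sub>L") where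
  "A\<^sub>L \<equiv> discriminant_group d V h L"

lemma carrier_discriminant: "carrier (A\<^sub>L) = coset ` L_dual"
  unfolding discriminant_group_def quotient_module_def A_RCOSETS_def' L_dual_def[symmetric]
  by (auto simp: r_coset_eq)

lemma add_discriminant:
  assumes "v \<in> carrier V" "w \<in> carrier V"
  shows "coset v \<oplus>\<^bsub>A\<^sub>L\<^esub> coset w = coset (v \<oplus> w)"
proof -
  have "coset v \<oplus>\<^bsub>A\<^sub>L\<^esub> coset w = {x \<oplus> y | x y. x \<in> coset v \<and> y \<in> coset w}"
    by (auto simp: discriminant_group_def quotient_module_def set_add_def')
  also have "\<dots> = coset (v \<oplus> w)"
  proof (intro equalityI subsetI)
    fix z assume "z \<in> {x \<oplus> y | x y. x \<in> coset v \<and> y \<in> coset w}"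
    then obtain x y where *: "z = x \<oplus> y" "x \<in> carrier V" "y \<in> carrier V"
      "\<psi> x - \<psi> v \<in> LL" "\<psi> y - \<psi> w \<in> LL" by (auto simp: coset_def)
    have "(\<psi> x - \<psi> v) + (\<psi> y - \<psi> w) \<in> LL" by (rule S.submod_add[OF submod_LL *(4,5)])
    then show "z \<in> coset (v \<oplus> w)"
      using * assms by (simp add: coset_def \<psi>_add add_diff_add)
  next
    fix z assume z: "z \<in> coset (v \<oplus> w)"
    then have zV: "z \<in> carrier V" by (simp add: coset_def)
    have "z \<ominus> w \<in> coset v"
      using z zV assms by (simp add: coset_def \<psi>_minus \<psi>_add algebra_simps)
    moreover have "w \<in> coset w" using assms submod_LL by (simp add: coset_def)
    moreover have "z = (z \<ominus> w) \<oplus> w"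
      using zV assms by (simp add: a_minus_def VM.add.m_assoc VM.l_neg)
    ultimately show "z \<in> {x \<oplus> y | x y. x \<in> coset v \<and> y \<in> coset w}" by blast
  qed
  finally show ?thesis .
qed

text \<open>The quotient defines scalar multiplication as a union over representatives; all members
  of the union coincide and there is at least one.\<close>

lemma smult_discriminant:
  assumes "v \<in> carrier V" "r \<in> R"
  shows "r \<odot>\<^bsub>A\<^sub>L\<^esub> coset v = coset (r \<odot> v)"
proof -
  have 1: "L +>\<^bsub>V\<lparr>carrier := L_dual\<rparr>\<^esub> (r \<odot> x) = coset (r \<odot> v)"
    if "x \<in> coset v" for x
  proof -
    have x: "x \<in> carrier V" "\<psi> x - \<psi> v \<in> LL" using that by (auto simp: coset_def)
    have "fun_scale r (\<psi> x - \<psi> v) \<in> LL" by (rule S.submod_scale[OF submod_LL assms(2) x(2)])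
    then show ?thesis using x assms
      by (simp add: r_coset_eq coset_eq_iff \<psi>_smult S.scale_right_diff_distrib)
  qed
  have 2: "coset v \<noteq> {}" using assms submod_LL by (auto simp: coset_def intro!: exI[of _ v])
  have "r \<odot>\<^bsub>A\<^sub>L\<^esub> coset v =
      (\<Union>x\<in>coset v. L +>\<^bsub>V\<lparr>carrier := L_dual\<rparr>\<^esub> (r \<odot> x))"
    by (simp add: discriminant_group_def quotient_module_def L_dual_def)
  also have "\<dots> = (\<Union>x\<in>coset v. coset (r \<odot> v))" by (rule SUP_cong[OF refl 1])
  also have "\<dots> = coset (r \<odot> v)" using 2 by simp
  finally show ?thesis .
qed

end

section \<open>The isomorphism with a module expression\<close>

context class_one_lattice
begin

section \<open>Cyclic modules as residue classes\<close>

definition cyclic :: "complex \<Rightarrow> (complex, complex set) module" where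
  "cyclic p = quotient_module (regular_module (ring_of_ints d)) (PIdl\<^bsub>ring_of_ints d\<^esub> p)"

definition rcos :: "complex \<Rightarrow> complex \<Rightarrow> complex set" where
  "rcos p r = {s \<in> R. S.dvdR p (s - r)}"

lemma dvdR_closed:
  "S.dvdR p 0" "S.dvdR p r \<Longrightarrow> S.dvdR p s \<Longrightarrow> S.dvdR p (r + s)"
  "S.dvdR p r \<Longrightarrow> S.dvdR p s \<Longrightarrow> S.dvdR p (r - s)" "x \<in> R \<Longrightarrow> S.dvdR p r \<Longrightarrow> S.dvdR p (x * r)"
proof -
  show "S.dvdR p 0" unfolding S.dvdR_def by (rule bexI[of _ 0]) simp_all
  show "S.dvdR p (r + s)" if "S.dvdR p r" "S.dvdR p s"
  proof -
    obtain x y where "x \<in> R" "y \<in> R" "r = p * x" "s = p * y"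
      using \<open>S.dvdR p r\<close> \<open>S.dvdR p s\<close> unfolding S.dvdR_def by blast
    then have "r + s = p * (x + y)" "x + y \<in> R" by (simp_all add: algebra_simps R_closed(1))
    then show ?thesis unfolding S.dvdR_def by blast
  qed
  show "S.dvdR p (r - s)" if "S.dvdR p r" "S.dvdR p s"
  proof -
    obtain x y where "x \<in> R" "y \<in> R" "r = p * x" "s = p * y"
      using \<open>S.dvdR p r\<close> \<open>S.dvdR p s\<close> unfolding S.dvdR_def by blast
    then have "r - s = p * (x - y)" "x - y \<in> R" by (simp_all add: algebra_simps S.R_diff)
    then show ?thesis unfolding S.dvdR_def by blast
  qed
  show "S.dvdR p (x * r)" if "x \<in> R" "S.dvdR p r"
  proof -
    obtain y where "y \<in> R" "r = p * y" using \<open>S.dvdR p r\<close> unfolding S.dvdR_def by blast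
    then have "x * r = p * (x * y)" "x * y \<in> R" using that(1) R_closed by simp_all
    then show ?thesis unfolding S.dvdR_def by blast
  qed
qed

lemma rcos_eq_iff: "r \<in> R \<Longrightarrow> s \<in> R \<Longrightarrow> rcos p r = rcos p s \<longleftrightarrow> S.dvdR p (r - s)"
proof
  assume r: "r \<in> R" "s \<in> R" and eq: "rcos p r = rcos p s"
  have "r \<in> rcos p r" using r by (simp add: rcos_def dvdR_closed)
  then have "r \<in> rcos p s" unfolding eq .
  then show "S.dvdR p (r - s)" by (simp add: rcos_def)
next
  assume *: "S.dvdR p (r - s)"
  show "rcos p r = rcos p s"
    unfolding rcos_def using dvdR_closed(2)[OF _ *] dvdR_closed(3)[OF _ *] by fastforce
qed

lemma ideal_rcos:
  assumes "p \<in> R" "r \<in> R"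
  shows "PIdl\<^bsub>ring_of_ints d\<^esub> p +>\<^bsub>regular_module (ring_of_ints d)\<^esub> r = rcos p r"
proof (intro equalityI subsetI)
  fix x assume "x \<in> PIdl\<^bsub>ring_of_ints d\<^esub> p +>\<^bsub>regular_module (ring_of_ints d)\<^esub> r"
  then obtain y where "y \<in> R" "x = y * p + r"
    by (auto simp: a_r_coset_def' cgenideal_def regular_module_def R_def)
  then show "x \<in> rcos p r" using assms R_closed
    by (auto simp: rcos_def S.dvdR_def intro!: bexI[of _ y])
next
  fix x assume "x \<in> rcos p r"
  then obtain y where "y \<in> R" "x - r = p * y" unfolding rcos_def S.dvdR_def by blast
  then have "x = y * p + r" "y \<in> R" by (simp_all add: algebra_simps)
  then show "x \<in> PIdl\<^bsub>ring_of_ints d\<^esub> p +>\<^bsub>regular_module (ring_of_ints d)\<^esub> r"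
    by (auto simp: a_r_coset_def' cgenideal_def regular_module_def R_def)
qed

lemma carrier_cyclic: "p \<in> R \<Longrightarrow> carrier (cyclic p) = rcos p ` R"
proof -
  assume p: "p \<in> R"
  have "carrier (regular_module (ring_of_ints d)) = R" by (simp add: regular_module_def R_def)
  then have "carrier (cyclic p) =
      (\<Union>r\<in>R. {PIdl\<^bsub>ring_of_ints d\<^esub> p +>\<^bsub>regular_module (ring_of_ints d)\<^esub> r})"
    by (simp add: cyclic_def quotient_module_def A_RCOSETS_def')
  then show ?thesis using p by (auto simp: ideal_rcos)
qed

lemma add_cyclic:
  assumes "p \<in> R" "r \<in> R" "s \<in> R"
  shows "rcos p r \<oplus>\<^bsub>cyclic p\<^esub> rcos p s = rcos p (r + s)"
proof -
  have "rcos p r \<oplus>\<^bsub>cyclic p\<^esub> rcos p s = {x + y | x y. x \<in> rcos p r \<and> y \<in> rcos p s}"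
    by (auto simp: cyclic_def quotient_module_def set_add_def' regular_module_def)
  also have "\<dots> = rcos p (r + s)"
  proof (intro equalityI subsetI)
    fix z assume "z \<in> {x + y | x y. x \<in> rcos p r \<and> y \<in> rcos p s}"
    then obtain x y where *: "z = x + y" "x \<in> R" "y \<in> R" "S.dvdR p (x - r)" "S.dvdR p (y - s)"
      by (auto simp: rcos_def)
    have "S.dvdR p ((x - r) + (y - s))" by (rule dvdR_closed(2)[OF *(4,5)])
    then show "z \<in> rcos p (r + s)" using * R_closed by (simp add: rcos_def add_diff_add)
  next
    fix z assume z: "z \<in> rcos p (r + s)"
    then have "z - s \<in> rcos p r" using assms S.R_diff by (simp add: rcos_def algebra_simps)
    moreover have "s \<in> rcos p s" using assms by (simp add: rcos_def dvdR_closed)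
    ultimately show "z \<in> {x + y | x y. x \<in> rcos p r \<and> y \<in> rcos p s}"
      by (intro CollectI exI[of _ "z - s"] exI[of _ s]) simp
  qed
  finally show ?thesis .
qed

lemma smult_cyclic:
  assumes "p \<in> R" "r \<in> R" "s \<in> R"
  shows "r \<odot>\<^bsub>cyclic p\<^esub> rcos p s = rcos p (r * s)"
proof -
  have 1: "PIdl\<^bsub>ring_of_ints d\<^esub> p +>\<^bsub>regular_module (ring_of_ints d)\<^esub> (r * x) = rcos p (r * s)"
    if "x \<in> rcos p s" for x
  proof -
    have x: "x \<in> R" "S.dvdR p (x - s)" using that by (auto simp: rcos_def)
    have "S.dvdR p (r * (x - s))" using dvdR_closed(4) x assms by blast
    then show ?thesis using x assms R_closed(2)
      by (simp add: ideal_rcos rcos_eq_iff right_diff_distrib)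
  qed
  have 2: "rcos p s \<noteq> {}" using assms by (auto simp: rcos_def dvdR_closed intro!: exI[of _ s])
  have "r \<odot>\<^bsub>cyclic p\<^esub> rcos p s =
      (\<Union>x\<in>rcos p s. PIdl\<^bsub>ring_of_ints d\<^esub> p +>\<^bsub>regular_module (ring_of_ints d)\<^esub> (r * x))"
    by (simp add: cyclic_def quotient_module_def) (simp add: regular_module_def)
  also have "\<dots> = (\<Union>x\<in>rcos p s. rcos p (r * s))" by (rule SUP_cong[OF refl 1])
  also have "\<dots> = rcos p (r * s)" using 2 by simp
  finally show ?thesis .
qed

text \<open>A class is sent to the residues of its coefficients in any expansion along
  \<open>gs\<close>. The relation clause of \<open>decomp\<close> makes this independent of the
  expansion and injective at once; both are contained in \<open>map2_eq\<close>.\<close>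

lemma discriminant_iso:
  assumes dec: "S.decomp ps gs H.D LL" and ps: "set ps \<subseteq> R"
  shows "module_isos (ring_of_ints d) (A\<^sub>L) (direct_sum (map cyclic ps)) \<noteq> {}"
proof -
  let ?A = "A\<^sub>L" and ?N = "direct_sum (map cyclic ps)"
  \<comment> \<open>The representative \<open>x\<close> is quantified away, so the map
    \<open>f\<close> is defined on cosets directly; the fact \<open>f\<close> below shows that the
    choice of coefficients is immaterial.\<close>
  define good where "good A rs \<longleftrightarrow> rs \<in> S.coeffs gs \<and> (\<exists>x\<in>A. \<psi> x - S.comb rs gs \<in> LL)" for A rs
  define f where "f A = map2 rcos ps (SOME rs. good A rs)" for A
  have gsD: "set gs \<subseteq> H.D" and len: "length gs = length ps"
    and gen: "\<forall>v\<in>H.D. \<exists>y\<in>S.span_of gs. v - y \<in> LL"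
    and ind: "\<And>rs. rs \<in> S.coeffs gs \<Longrightarrow> S.comb rs gs \<in> LL \<longleftrightarrow> list_all2 S.dvdR ps rs"
    using dec by (auto simp: S.decomp_def)
  have clen: "length rs = length ps" "\<And>i. i < length ps \<Longrightarrow> rs ! i \<in> R" if "rs \<in> S.coeffs gs" for rs
    using that len by (auto simp: S.coeffs_def)
  have psR: "\<And>i. i < length ps \<Longrightarrow> ps ! i \<in> R" using ps by auto
  have rep: "\<exists>rs. rs \<in> S.coeffs gs \<and> \<psi> v - S.comb rs gs \<in> LL" if "v \<in> L_dual" for v
    using bspec[OF gen \<psi>_D[OF that]] unfolding S.span_of_def by blast
  have map2_eq: "map2 rcos ps rs = map2 rcos ps ts \<longleftrightarrow> S.comb rs gs - S.comb ts gs \<in> LL"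
    if "rs \<in> S.coeffs gs" "ts \<in> S.coeffs gs" for rs ts
  proof -
    have "S.comb rs gs - S.comb ts gs \<in> LL \<longleftrightarrow> list_all2 S.dvdR ps (map2 (-) rs ts)"
      using ind[OF S.coeffs_diff[OF that]]
        S.comb_diff[OF S.coeffs_length[OF that(1)] S.coeffs_length[OF that(2)]] by simp
    also have "\<dots> \<longleftrightarrow> (\<forall>i<length ps. S.dvdR (ps ! i) (rs ! i - ts ! i))"
      using clen(1)[OF that(1)] clen(1)[OF that(2)] by (auto simp: list_all2_conv_all_nth)
    also have "\<dots> \<longleftrightarrow> (\<forall>i<length ps. rcos (ps ! i) (rs ! i) = rcos (ps ! i) (ts ! i))"
      using clen(2)[OF that(1)] clen(2)[OF that(2)] by (simp add: rcos_eq_iff)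
    also have "\<dots> \<longleftrightarrow> map2 rcos ps rs = map2 rcos ps ts"
      using clen(1)[OF that(1)] clen(1)[OF that(2)] by (auto simp: list_eq_iff_nth_eq)
    finally show ?thesis by simp
  qed
  have f: "f (coset v) = map2 rcos ps rs"
    if v: "v \<in> L_dual" and rs: "rs \<in> S.coeffs gs" "\<psi> v - S.comb rs gs \<in> LL" for v rs
  proof -
    have "v \<in> coset v" using v submod_LL by (simp add: coset_def)
    then have "good (coset v) rs" using rs unfolding good_def by blast
    then have "good (coset v) (SOME rs. good (coset v) rs)" by (rule someI)
    then obtain ts x where ts: "(SOME rs. good (coset v) rs) = ts" "ts \<in> S.coeffs gs"
      "\<psi> x - \<psi> v \<in> LL" "\<psi> x - S.comb ts gs \<in> LL" unfolding good_def by (auto simp: coset_def)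
    have "\<psi> v - S.comb ts gs \<in> LL"
      by (rule S.submod_trans[OF submod_LL S.submod_sym[OF submod_LL ts(3)] ts(4)])
    from S.submod_trans[OF submod_LL S.submod_sym[OF submod_LL this] rs(2)]
    have "S.comb ts gs - S.comb rs gs \<in> LL" .
    then show ?thesis unfolding f_def ts(1) using map2_eq[OF ts(2) rs(1)] by simp
  qed
  have carrier_N: "carrier ?N = map2 rcos ps ` S.coeffs gs"
  proof (intro equalityI subsetI)
    fix xs assume "xs \<in> carrier ?N"
    then have l: "length xs = length ps" and x: "\<And>i. i < length ps \<Longrightarrow> xs ! i \<in> rcos (ps ! i) ` R"
      using psR by (auto simp: direct_sum_def list_all2_conv_all_nth carrier_cyclic)
    have "\<forall>i\<in>{..<length ps}. \<exists>r. r \<in> R \<and> xs ! i = rcos (ps ! i) r" using x by blast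
    from bchoice[OF this] obtain r where "\<forall>i\<in>{..<length ps}. r i \<in> R \<and> xs ! i = rcos (ps ! i) (r i)"
      by (rule exE)
    then have r: "\<And>i. i < length ps \<Longrightarrow> r i \<in> R"
      "\<And>i. i < length ps \<Longrightarrow> xs ! i = rcos (ps ! i) (r i)" by simp_all
    have "xs = map2 rcos ps (map r [0..<length ps])"
      by (rule nth_equalityI) (simp_all add: l r(2))
    moreover have "map r [0..<length ps] \<in> S.coeffs gs"
      using r(1) len by (auto simp: S.coeffs_def)
    ultimately show "xs \<in> map2 rcos ps ` S.coeffs gs" by (rule image_eqI)
  next
    fix xs assume "xs \<in> map2 rcos ps ` S.coeffs gs"
    then obtain rs where rs: "xs = map2 rcos ps rs" "rs \<in> S.coeffs gs" by blast
    then show "xs \<in> carrier ?N"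
      using clen[OF rs(2)] psR by (auto simp: direct_sum_def list_all2_conv_all_nth carrier_cyclic)
  qed
  have hom: "f (coset v \<oplus>\<^bsub>?A\<^esub> coset w) = f (coset v) \<oplus>\<^bsub>?N\<^esub> f (coset w)"
    if vw: "v \<in> L_dual" "w \<in> L_dual" for v w
  proof -
    obtain rs where rs: "rs \<in> S.coeffs gs" "\<psi> v - S.comb rs gs \<in> LL" using rep[OF vw(1)] by blast
    obtain ts where ts: "ts \<in> S.coeffs gs" "\<psi> w - S.comb ts gs \<in> LL" using rep[OF vw(2)] by blast
    have "\<psi> (v \<oplus> w) - S.comb (map2 (+) rs ts) gs = (\<psi> v - S.comb rs gs) + (\<psi> w - S.comb ts gs)"
      unfolding S.comb_add[OF S.coeffs_length[OF rs(1)] S.coeffs_length[OF ts(1)], symmetric]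
      using vw by (simp add: \<psi>_add)
    also have "\<dots> \<in> LL" by (rule S.submod_add[OF submod_LL rs(2) ts(2)])
    finally have "f (coset (v \<oplus> w)) = map2 rcos ps (map2 (+) rs ts)"
      by (rule f[OF L_dual_closed(1)[OF vw] S.coeffs_add[OF rs(1) ts(1)]])
    also have "\<dots> = map2 rcos ps rs \<oplus>\<^bsub>?N\<^esub> map2 rcos ps ts"
      using clen[OF rs(1)] clen[OF ts(1)] psR
      by (auto simp: direct_sum_def list_eq_iff_nth_eq add_cyclic)
    finally show ?thesis using vw f[OF vw(1) rs] f[OF vw(2) ts] by (simp add: add_discriminant)
  qed
  have smult: "f (r \<odot>\<^bsub>?A\<^esub> coset v) = r \<odot>\<^bsub>?N\<^esub> f (coset v)"
    if r: "r \<in> R" and v: "v \<in> L_dual" for r v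
  proof -
    obtain rs where rs: "rs \<in> S.coeffs gs" "\<psi> v - S.comb rs gs \<in> LL" using rep[OF v] by blast
    have "\<psi> (r \<odot> v) - S.comb (map ((*) r) rs) gs = fun_scale r (\<psi> v - S.comb rs gs)"
      using r v S.comb_scale[OF S.coeffs_length[OF rs(1)], of r]
      by (simp add: \<psi>_smult S.scale_right_diff_distrib)
    also have "\<dots> \<in> LL" by (rule S.submod_scale[OF submod_LL r rs(2)])
    finally have "f (coset (r \<odot> v)) = map2 rcos ps (map ((*) r) rs)"
      by (rule f[OF L_dual_closed(2)[OF r v] S.coeffs_scale[OF rs(1) r]])
    also have "\<dots> = r \<odot>\<^bsub>?N\<^esub> map2 rcos ps rs"
      using clen[OF rs(1)] psR r by (auto simp: direct_sum_def list_eq_iff_nth_eq smult_cyclic)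
    finally show ?thesis using r v f[OF v rs] by (simp add: smult_discriminant)
  qed
  have "inj_on f (coset ` L_dual)"
  proof (rule inj_onI)
    fix A B assume "A \<in> coset ` L_dual" "B \<in> coset ` L_dual" and eq: "f A = f B"
    then obtain v w where vw: "v \<in> L_dual" "w \<in> L_dual" "A = coset v" "B = coset w" by blast
    obtain rs where rs: "rs \<in> S.coeffs gs" "\<psi> v - S.comb rs gs \<in> LL" using rep[OF vw(1)] by blast
    obtain ts where ts: "ts \<in> S.coeffs gs" "\<psi> w - S.comb ts gs \<in> LL" using rep[OF vw(2)] by blast
    have "S.comb rs gs - S.comb ts gs \<in> LL"
      using eq unfolding vw(3,4) f[OF vw(1) rs] f[OF vw(2) ts] map2_eq[OF rs(1) ts(1)] .
    from S.submod_trans[OF submod_LL S.submod_trans[OF submod_LL rs(2) this] S.submod_sym[OF submod_LL ts(2)]]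
    have "\<psi> v - \<psi> w \<in> LL" .
    then show "A = B" unfolding vw(3,4) using vw by (simp add: coset_eq_iff)
  qed
  moreover have "f ` coset ` L_dual = carrier ?N"
    unfolding carrier_N
  proof (intro equalityI subsetI)
    fix xs assume "xs \<in> f ` coset ` L_dual"
    then obtain v where v: "v \<in> L_dual" "xs = f (coset v)" by blast
    then show "xs \<in> map2 rcos ps ` S.coeffs gs" using rep[OF v(1)] f[OF v(1)] by auto
  next
    fix xs assume "xs \<in> map2 rcos ps ` S.coeffs gs"
    then obtain rs where rs: "rs \<in> S.coeffs gs" "xs = map2 rcos ps rs" by blast
    have "S.comb rs gs \<in> H.D" by (rule S.comb_in[OF H.submod_D gsD rs(1)])
    then obtain v where v: "v \<in> L_dual" "S.comb rs gs = \<psi> v" unfolding D_eq by blast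
    then have "f (coset v) = xs" using f[OF v(1) rs(1)] submod_LL rs(2) by simp
    then show "xs \<in> f ` coset ` L_dual" using v(1) by blast
  qed
  ultimately have "bij_betw f (carrier ?A) (carrier ?N)"
    by (simp add: bij_betw_def carrier_discriminant)
  then have "f \<in> module_isos (ring_of_ints d) ?A ?N"
    unfolding module_isos_def iso_def hom_def
    using hom smult by (auto simp: carrier_discriminant bij_betw_def simp flip: R_def)
  then show ?thesis by blast
qed

lemma iso_to_exprI:
  assumes "S.decomp (concat (map (\<lambda>(m, x). replicate (nat m) x) E)) gs H.D LL"
    and "\<And>m x. (m, x) \<in> set E \<Longrightarrow> 0 \<le> m \<and> x \<in> R"
  shows "iso_to_expr d (A\<^sub>L) E"
proof -
  let ?ps = "concat (map (\<lambda>(m, x). replicate (nat m) x) E)"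
  have "set ?ps \<subseteq> R" using assms(2) by auto
  then have "module_isos (ring_of_ints d) (A\<^sub>L) (direct_sum (map cyclic ?ps)) \<noteq> {}"
    using assms(1) discriminant_iso by blast
  also have "direct_sum (map cyclic ?ps) = expr_module d E"
    unfolding expr_module_def by (simp add: map_concat case_prod_unfold comp_def cyclic_def)
  finally show ?thesis unfolding iso_to_expr_def using assms(2) by blast
qed

end

section \<open>Generators of isotropic sublattices and their twists\<close>

context class_one_lattice
begin

lemma smult_zero: "x \<in> carrier V \<Longrightarrow> 0 \<odot> x = \<zero>"
  using VM.smult_l_null[of x] by simp

lemma line_eq:
  assumes "e \<in> carrier V"
  shows "gen_submodule (quad_field d) V {e} = {x \<odot> e | x. x \<in> quad_set d}" (is "_ = ?l")
proof
  have m1: "- 1 \<in> quad_set d" "0 \<in> quad_set d" "1 \<in> quad_set d" by (rule quad_set_rat, simp)+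
  have "submodule ?l (quad_field d) V"
  proof (rule submoduleI)
    show "\<zero> \<in> ?l" unfolding mem_Collect_eq
      by (intro exI[of _ 0]) (simp add: smult_zero[OF assms] m1)
    show "x \<oplus> y \<in> ?l" if "x \<in> ?l" "y \<in> ?l" for x y
    proof -
      obtain a b where ab: "a \<in> quad_set d" "b \<in> quad_set d" "x = a \<odot> e" "y = b \<odot> e"
        using \<open>x \<in> ?l\<close> \<open>y \<in> ?l\<close> by blast
      then have "x \<oplus> y = (a + b) \<odot> e" using VM.smult_l_distr[of a b e] assms by simp
      then show ?thesis using quad_set_add[OF ab(1,2)] by blast
    qed
    show "a \<odot> x \<in> ?l" if "a \<in> carrier (quad_field d)" "x \<in> ?l" for a x
    proof -
      obtain b where b: "b \<in> quad_set d" "x = b \<odot> e" using \<open>x \<in> ?l\<close> by blast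
      then have "a \<odot> x = (a * b) \<odot> e" "a * b \<in> quad_set d"
        using \<open>a \<in> carrier (quad_field d)\<close> assms by (simp_all add: smult_assoc quad_set_mult)
      then show ?thesis by blast
    qed
  qed (use assms m1 in auto)
  moreover have "e \<in> ?l" unfolding mem_Collect_eq
    by (intro exI[of _ 1]) (simp add: smult_one[OF assms] m1)
  ultimately show "gen_submodule (quad_field d) V {e} \<subseteq> ?l" by (intro gen_submodule_subset) auto
  show "?l \<subseteq> gen_submodule (quad_field d) V {e}"
    unfolding gen_submodule_def using submodule_facts(4)[of _ "quad_field d"] by fastforce
qed

text \<open>The given spanning vector of the line need not lie in \<open>L\<close>; multiplying it
  by a denominator moves it into \<open>I\<close> and leaves the line unchanged.\<close>

lemma isotropic_nontrivial:
  assumes I: "primitive_isotropic_rank_one d V h L I"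
  obtains e0 where "e0 \<in> carrier V" "e0 \<noteq> \<zero>" "e0 \<in> I"
    "I = {x \<odot> e0 | x. x \<in> quad_set d} \<inter> L"
    "gen_submodule (quad_field d) V I = {x \<odot> e0 | x. x \<in> quad_set d}"
proof -
  obtain e1 where e1: "e1 \<in> carrier V" "e1 \<noteq> \<zero>"
    "gen_submodule (quad_field d) V I = gen_submodule (quad_field d) V {e1}"
    using I unfolding primitive_isotropic_rank_one_def by blast
  have I_eq: "gen_submodule (quad_field d) V I \<inter> L = I"
    using I unfolding primitive_isotropic_rank_one_def by blast
  obtain r where r: "r \<in> R" "r \<noteq> 0" "r \<odot> e1 \<in> L" using L_denominator e1 by blast
  let ?e0 = "r \<odot> e1"
  have inv: "inverse r \<in> quad_set d" using quad_set_inverse[OF d_neg, of r] r by simp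
  have line: "{x \<odot> e1 | x. x \<in> quad_set d} = {x \<odot> ?e0 | x. x \<in> quad_set d}"
  proof (intro equalityI subsetI)
    fix v assume "v \<in> {x \<odot> e1 | x. x \<in> quad_set d}"
    then obtain x where "x \<in> quad_set d" "v = x \<odot> e1" by blast
    moreover have "x * inverse r \<in> quad_set d" by (rule quad_set_mult[OF \<open>x \<in> quad_set d\<close> inv])
    ultimately have "v = (x * inverse r) \<odot> ?e0" "x * inverse r \<in> quad_set d"
      using r e1 by (simp_all add: smult_assoc mult.assoc)
    then show "v \<in> {x \<odot> ?e0 | x. x \<in> quad_set d}" by blast
  next
    fix v assume "v \<in> {x \<odot> ?e0 | x. x \<in> quad_set d}"
    then obtain x where "x \<in> quad_set d" "v = x \<odot> ?e0" by blast
    then have "v = (x * r) \<odot> e1" "x * r \<in> quad_set d"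
      using r e1 by (simp_all add: smult_assoc quad_set_mult)
    then show "v \<in> {x \<odot> e1 | x. x \<in> quad_set d}" by blast
  qed
  have "r \<odot> e1 \<noteq> \<zero>"
    using smult_inverse[of r e1] VM.smult_r_null[of "inverse r"] inv r e1 by auto
  moreover have "?e0 \<in> gen_submodule (quad_field d) V I" unfolding e1(3) line_eq[OF e1(1)] using r by auto
  then have "?e0 \<in> I" using r(3) I_eq by blast
  ultimately show thesis
    using that[of ?e0] r e1 I_eq line unfolding e1(3) line_eq[OF e1(1)] by auto
qed

text \<open>Pairing with a fixed \<open>w\<close> not orthogonal to \<open>I\<close> is injective on
  the line, so a vector of \<open>I\<close> whose pairing generates the ideal of values generates
  \<open>I\<close>. The divisor is a generator of the values of \<open>L\<close> against this
  vector.\<close>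

lemma exists_is_div:
  assumes I: "primitive_isotropic_rank_one d V h L I"
  shows "\<exists>c. is_div d V h L I c"
proof -
  obtain e0 where e0: "e0 \<in> carrier V" "e0 \<noteq> \<zero>" "e0 \<in> I"
    "I = {x \<odot> e0 | x. x \<in> quad_set d} \<inter> L" by (rule isotropic_nontrivial[OF I])
  have subI: "submodule I (ring_of_ints d) V"
    using I unfolding primitive_isotropic_rank_one_def by blast
  note I_facts = submodule_facts[OF subI, folded R_def]
  have "e0 \<in> L" using e0 by blast
  then obtain w where w: "w \<in> L" "h e0 w \<noteq> 0" using L_nondegenerate e0(2) by blast
  have IL: "v \<in> L" if "v \<in> I" for v using that e0(4) by auto
  have integral: "hh (\<psi> v) (\<psi> l) \<in> H.kR" if "v \<in> L" "l \<in> L" for v l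
    using that H.h_D_L[OF subsetD[OF H.L_D]] by (simp add: LL_def)
  obtain g f where g: "g \<in> R" "f \<in> \<psi> ` I" "hh f (\<psi> w) = kappa d * g"
    and val: "\<And>f. f \<in> \<psi> ` I \<Longrightarrow> \<exists>r\<in>R. hh f (\<psi> w) = kappa d * (r * g)"
    by (rule H.values_principal[OF submod_image[OF subI], of "\<psi> w"])
       (use IL w integral in \<open>auto simp: VV_def\<close>)
  obtain e where e: "e \<in> I" "f = \<psi> e" using g(2) by blast
  have eL: "e \<in> L" using e IL by blast
  have eg: "h e w = kappa d * g" using g(3) e eL w by (simp add: hh_\<psi>)
  have "I = {x \<odot> e | x. x \<in> R}"
  proof (intro equalityI subsetI)
    fix v assume v: "v \<in> I"
    obtain x where x: "x \<in> quad_set d" "v = x \<odot> e0" using v e0(4) by blast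
    obtain z where z: "z \<in> quad_set d" "e = z \<odot> e0" using e e0(4) by blast
    obtain r where r: "r \<in> R" "h v w = kappa d * (r * g)"
      using val[OF imageI[OF v]] IL[OF v] w by (auto simp: hh_\<psi>)
    have "x * h e0 w = (r * z) * h e0 w"
      using r(2) eg x z e0(1) w(1) by (simp add: h_smult)
    then have "x = r * z" using w(2) by simp
    then have "v = r \<odot> e" using x z r e0(1) by (simp add: smult_assoc)
    then show "v \<in> {x \<odot> e | x. x \<in> R}" using r by blast
  qed (use e I_facts(4) in auto)
  moreover obtain c f1 where c: "c \<in> R" "f1 \<in> LL" "hh f1 (\<psi> e) = kappa d * c"
    and valc: "\<And>f. f \<in> LL \<Longrightarrow> \<exists>r\<in>R. hh f (\<psi> e) = kappa d * (r * c)"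
    by (rule H.values_principal[OF submod_LL, of "\<psi> e"])
       (use eL integral in \<open>auto simp: VV_def LL_def\<close>)
  obtain l1 where l1: "l1 \<in> L" "h l1 e = kappa d * c" using c eL by (auto simp: LL_def hh_\<psi>)
  have "{h l e | l. l \<in> L} = {x * (kappa d * c) | x. x \<in> R}"
  proof (intro equalityI subsetI)
    fix y assume "y \<in> {h l e | l. l \<in> L}"
    then obtain l where l: "l \<in> L" "y = h l e" by blast
    then obtain r where "r \<in> R" "y = kappa d * (r * c)"
      using valc[of "\<psi> l"] eL by (auto simp: LL_def hh_\<psi>)
    then show "y \<in> {x * (kappa d * c) | x. x \<in> R}" by auto
  next
    fix y assume "y \<in> {x * (kappa d * c) | x. x \<in> R}"
    then obtain x where x: "x \<in> R" "y = x * (kappa d * c)" by blast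
    then have "y = h (x \<odot> l1) e" "x \<odot> l1 \<in> L" using l1 eL L_facts by (simp_all add: h_smult)
    then show "y \<in> {h l e | l. l \<in> L}" by blast
  qed
  moreover have "kappa d * c \<in> quad_set d" using quad_set_mult kappa_properties(1) c by simp
  ultimately have "is_div d V h L I (kappa d * c)"
    unfolding is_div_def R_def[symmetric] using eL by blast
  then show ?thesis by blast
qed

end

text \<open>\<open>e\<close> and \<open>c\<close> are the witnesses of one instance of
  \<open>is_div\<close>, so the divisor is tied to a definite generator of \<open>I\<close>.\<close>

locale class_one_isotropic = class_one_lattice d V h L
  for d :: int and V :: "(complex, 'v) module" (structure) and h L +
  fixes I :: "'v set" and e :: 'v and c :: complex
  assumes primitive: "primitive_isotropic_rank_one d V h L I"
    and e_L: "e \<in> L" and I_eq: "I = {x \<odot> e | x. x \<in> R}"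
    and div_c: "{h l e | l. l \<in> L} = {x * c | x. x \<in> R}"
begin

lemma e_I: "e \<in> I"
  unfolding I_eq mem_Collect_eq using e_L by (intro exI[of _ 1]) simp

lemma e_nz: "e \<noteq> \<zero>"
proof
  assume "e = \<zero>"
  then have "I \<subseteq> {\<zero>}" unfolding I_eq using VM.smult_r_null by auto
  moreover obtain e0 where "e0 \<noteq> \<zero>" "e0 \<in> I" by (rule isotropic_nontrivial[OF primitive])
  ultimately show False by blast
qed

lemma gen_I: "gen_submodule (quad_field d) V I = {x \<odot> e | x. x \<in> quad_set d}"
proof -
  have "gen_submodule (quad_field d) V I = gen_submodule (quad_field d) V {e}"
  proof -
    have "I \<subseteq> N \<longleftrightarrow> {e} \<subseteq> N" if "submodule N (quad_field d) V" for N
    proof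
      assume "{e} \<subseteq> N"
      then show "I \<subseteq> N" using submodule_facts(4)[OF that] unfolding I_eq by auto
    qed (use e_I in blast)
    then have "{N. submodule N (quad_field d) V \<and> I \<subseteq> N} = {N. submodule N (quad_field d) V \<and> {e} \<subseteq> N}"
      by blast
    then show ?thesis unfolding gen_submodule_def by (rule arg_cong)
  qed
  then show ?thesis using line_eq[of e] e_L by simp
qed

lemma gen_I_L: "gen_submodule (quad_field d) V I \<inter> L = I"
  using primitive unfolding primitive_isotropic_rank_one_def by blast

text \<open>The line of \<open>e\<close> meets \<open>L\<close> exactly in \<open>I\<close>, the
  integral multiples of \<open>e\<close>; this turns primitivity of the sublattice into primitivity
  of the vector.\<close>

sublocale E: isotropic_vector fun_scale R "quad_set d" "kappa d" VV LL hh "\<psi> e"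
proof unfold_locales
  show "\<psi> e \<in> LL" using e_L by (simp add: LL_def)
  show "\<psi> e \<noteq> 0" using \<psi>_eq_0[of e] e_L e_nz by auto
  have "\<forall>x\<in>I. \<forall>y\<in>I. h x y = 0" using primitive unfolding primitive_isotropic_rank_one_def by blast
  then show "hh (\<psi> e) (\<psi> e) = 0" using e_I e_L by (simp add: hh_\<psi>)
  show "x \<in> R" if "x \<in> quad_set d" "fun_scale x (\<psi> e) \<in> LL" for x
  proof -
    have "x \<odot> e \<in> L" using that e_L by (simp flip: \<psi>_smult \<psi>_in_LL)
    then have "x \<odot> e \<in> I" using gen_I gen_I_L that by blast
    then obtain y where y: "y \<in> R" "x \<odot> e = y \<odot> e" unfolding I_eq by blast
    then have "fun_scale x (\<psi> e) = fun_scale y (\<psi> e)"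
      using that(1) e_L \<psi>_smult[of x e] \<psi>_smult[of y e] by (auto simp del: S.scale_cancel_right)
    moreover have "\<psi> e \<noteq> 0" using \<psi>_eq_0[of e] e_L e_nz by auto
    ultimately show ?thesis using y by simp
  qed
qed

lemma div_LL: "{hh l (\<psi> e) | l. l \<in> LL} = {x * c | x. x \<in> R}"
proof -
  have "{hh l (\<psi> e) | l. l \<in> LL} = {h l e | l. l \<in> L}"
    unfolding LL_def using e_L by (force simp: hh_\<psi>)
  then show ?thesis using div_c by simp
qed

section \<open>Scalars and twists in the discriminant kernel\<close>

abbreviation "\<Gamma> \<equiv> discriminant_kernel d V h L"

lemma scalar_unitary:
  assumes z: "z \<in> R" "cnj z * z = 1"
  shows "(\<lambda>v. z \<odot> v) \<in> unitary_group_rat d V h"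
proof -
  have c: "cnj z \<in> R" "z \<in> quad_set d" "cnj z \<in> quad_set d" using R_cnj z by auto
  have "bij_betw (\<lambda>v. z \<odot> v) (carrier V) (carrier V)"
    by (rule bij_betw_byWitness[where f' = "\<lambda>v. cnj z \<odot> v"])
       (use z c in \<open>auto simp: smult_assoc mult.commute\<close>)
  then have "(\<lambda>v. z \<odot> v) \<in> module_isos (quad_field d) V V"
    unfolding module_isos_def iso_def hom_def
    using c by (auto simp: smult_add smult_assoc mult.commute)
  moreover have "h (z \<odot> x) (z \<odot> y) = h x y" if xy: "x \<in> carrier V" "y \<in> carrier V" for x y
  proof -
    have "h (z \<odot> x) (z \<odot> y) = z * cnj (h (z \<odot> y) x)"
      using xy c h_cnj[of "z \<odot> y" x] by (simp add: h_smult)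
    also have "\<dots> = (cnj z * z) * cnj (h y x)" using xy c by (simp add: h_smult)
    also have "\<dots> = h x y" using z h_cnj[OF xy(2,1)] by simp
    finally show ?thesis .
  qed
  ultimately show ?thesis unfolding unitary_group_rat_def by blast
qed

text \<open>The hypothesis has \<open>1 - cnj z\<close>, the form in which twists deliver it;
  multiplying by the unit \<open>z\<close> gives the same for \<open>z - 1\<close>. Both
  \<open>z\<close> and its inverse \<open>cnj z\<close> are needed, because the kernel requires each
  coset to equal its image.\<close>

lemma scalar_inI:
  assumes z: "z \<in> R" "cnj z * z = 1" and triv: "\<forall>v\<in>H.D. fun_scale (1 - cnj z) v \<in> LL"
  shows "scalar_in V \<Gamma> z"
proof -
  have c: "cnj z \<in> R" "z \<in> quad_set d" "cnj z \<in> quad_set d" using R_cnj z by auto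
  have coset1: "z \<odot> x \<in> coset v" "cnj z \<odot> x \<in> coset v" if v: "v \<in> L_dual" "x \<in> coset v" for x v
  proof -
    have x: "x \<in> carrier V" "\<psi> x - \<psi> v \<in> LL" using v by (auto simp: coset_def)
    have 1: "fun_scale (1 - cnj z) (\<psi> v) \<in> LL" using triv \<psi>_D[OF v(1)] by blast
    have "fun_scale z (\<psi> x - \<psi> v) + fun_scale z (fun_scale (1 - cnj z) (\<psi> v)) \<in> LL"
      by (intro S.submod_add[OF submod_LL] S.submod_scale[OF submod_LL] z x 1)
    moreover have "z * cnj z = 1" using z(2) by (subst mult.commute)
    then have "fun_scale z (\<psi> x - \<psi> v) + fun_scale z (fun_scale (1 - cnj z) (\<psi> v))
        = \<psi> (z \<odot> x) - \<psi> v"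
      using x c by (simp add: \<psi>_smult S.scale_right_diff_distrib S.scale_left_diff_distrib)
    ultimately have "\<psi> (z \<odot> x) - \<psi> v \<in> LL" by (simp only:)
    then show "z \<odot> x \<in> coset v" using x c by (simp add: coset_def)
    have "fun_scale (cnj z) (\<psi> x - \<psi> v) - fun_scale (1 - cnj z) (\<psi> v) \<in> LL"
      by (intro S.submod_diff[OF submod_LL] S.submod_scale[OF submod_LL] c x 1)
    moreover have "fun_scale (cnj z) (\<psi> x - \<psi> v) - fun_scale (1 - cnj z) (\<psi> v)
        = \<psi> (cnj z \<odot> x) - \<psi> v"
      using x c by (simp add: \<psi>_smult S.scale_right_diff_distrib S.scale_left_diff_distrib)
    ultimately have "\<psi> (cnj z \<odot> x) - \<psi> v \<in> LL" by (simp only:)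
    then show "cnj z \<odot> x \<in> coset v" using x c by (simp add: coset_def)
  qed
  have inv: "z \<odot> (cnj z \<odot> x) = x" if "x \<in> carrier V" for x
    using that c z by (simp add: smult_assoc mult.commute)
  have img: "(\<lambda>v. z \<odot> v) ` X = X"
    if "X \<subseteq> carrier V" "\<And>x. x \<in> X \<Longrightarrow> z \<odot> x \<in> X" "\<And>x. x \<in> X \<Longrightarrow> cnj z \<odot> x \<in> X" for X
  proof (intro equalityI subsetI)
    fix x assume x: "x \<in> X"
    then have "x = z \<odot> (cnj z \<odot> x)" using inv that(1) by auto
    then show "x \<in> (\<lambda>v. z \<odot> v) ` X" using that(3)[OF x] by blast
  qed (use that(2) in auto)
  have "(\<lambda>v. z \<odot> v) ` L = L"
    by (rule img) (use L_facts z c in auto)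
  moreover have "(\<lambda>v. z \<odot> v) ` coset v = coset v" if "v \<in> L_dual" for v
    by (rule img) (use coset1[OF that] in \<open>auto simp: coset_def\<close>)
  ultimately show ?thesis
    unfolding scalar_in_def discriminant_kernel_def unitary_group_int_def
    using scalar_unitary[OF z] by (auto simp: carrier_discriminant)
qed

text \<open>Multiplying the congruence of \<open>z \<odot> T v\<close> and \<open>v\<close> by
  \<open>cnj z\<close>, the inverse of \<open>z\<close>, compares \<open>T v\<close> with
  \<open>cnj z \<odot> v\<close>. Inserting the transvection formula for \<open>T\<close> leaves the
  stated vector.\<close>

lemma twist_inD:
  assumes tw: "twist_in d V h I \<Gamma> z" and z: "z \<in> R" "cnj z * z = 1"
  obtains q where "q \<in> \<rat>"
    "\<forall>v\<in>H.D. fun_scale (1 - cnj z) v + fun_scale (hh v (\<psi> e) / kappa d * q) (\<psi> e) \<in> LL"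
proof -
  have c: "cnj z \<in> R" "z \<in> quad_set d" using R_cnj z by auto
  obtain T where T: "T \<in> stab_group d V h I" "(\<lambda>v. z \<odot> T v) \<in> \<Gamma>"
    using tw unfolding twist_in_def by blast
  have Tu: "T \<in> module_isos (quad_field d) V V" "\<forall>x\<in>carrier V. \<forall>y\<in>carrier V. h (T x) (T y) = h x y"
    and Tid: "\<forall>v\<in>carrier V. (\<forall>x\<in>I. h v x = 0) \<longrightarrow> T v = v"
    using T(1) unfolding stab_group_def unitary_group_rat_def by blast+
  have TV: "T x \<in> carrier V" and Tadd: "T (x \<oplus> y) = T x \<oplus> T y"
    and Tsm: "a \<in> quad_set d \<Longrightarrow> T (a \<odot> x) = a \<odot> T x"
    if "x \<in> carrier V" "y \<in> carrier V" for x y a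
    using Tu(1) that unfolding module_isos_def iso_def hom_def by auto
  define T' where "T' f = \<psi> (T (inv_into (carrier V) \<psi> f))" for f
  have T': "T' (\<psi> v) = \<psi> (T v)" if "v \<in> carrier V" for v
    using that by (simp add: T'_def inv_into_f_f[OF inj_\<psi>])
  have "\<exists>q\<in>\<rat>. \<forall>v\<in>VV. T' v = v + fun_scale (hh v (\<psi> e) / kappa d * q) (\<psi> e)"
  proof (rule E.transvection)
    fix f g assume "f \<in> VV" "g \<in> VV"
    then obtain x y where xy: "x \<in> carrier V" "y \<in> carrier V" "f = \<psi> x" "g = \<psi> y"
      unfolding VV_def by blast
    show "T' (f + g) = T' f + T' g"
      using xy T'[of "x \<oplus> y"] TV[OF xy(1,1)] TV[OF xy(2,2)] Tadd[OF xy(1,2)] by (simp add: T' \<psi>_add)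
    show "hh (T' f) (T' g) = hh f g"
      using xy TV[OF xy(1,1)] TV[OF xy(2,2)] Tu(2) by (simp add: T' hh_\<psi>)
  next
    fix f assume f: "f \<in> VV"
    then obtain x where x: "x \<in> carrier V" "f = \<psi> x" unfolding VV_def by blast
    show "T' f \<in> VV" using x TV[OF x(1,1)] T' by (simp add: VV_def)
    show "T' (fun_scale a f) = fun_scale a (T' f)" if "a \<in> quad_set d" for a
      using that x T'[of "a \<odot> x"] TV[OF x(1,1)] Tsm[OF x(1,1) that] by (simp add: T' \<psi>_smult)
    show "T' f = f" if "hh f (\<psi> e) = 0"
    proof -
      have he: "h x e = 0" using that x e_L by (simp add: hh_\<psi>)
      have "h x y = 0" if y: "y \<in> I" for y
      proof -
        obtain a where a: "a \<in> R" "y = a \<odot> e" using y unfolding I_eq by blast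
        have "h x y = cnj (h y x)" using x a e_L by (intro h_cnj) auto
        also have "h y x = a * cnj (h x e)" using a x e_L h_cnj[of x e] by (simp add: h_smult)
        finally show ?thesis using he by simp
      qed
      then have "T x = x" using Tid x by blast
      then show ?thesis using x T' by simp
    qed
  qed
  then obtain q where q: "q \<in> \<rat>"
    and Tq: "\<And>v. v \<in> VV \<Longrightarrow> T' v = v + fun_scale (hh v (\<psi> e) / kappa d * q) (\<psi> e)" by blast
  show thesis
  proof (rule that[OF q], intro ballI)
    fix f assume "f \<in> H.D"
    then obtain v where v: "v \<in> L_dual" "f = \<psi> v" unfolding D_eq by blast
    have "v \<in> coset v" using v submod_LL by (simp add: coset_def)
    moreover have "(\<lambda>v. z \<odot> T v) ` coset v = coset v"
      using T(2) v(1) unfolding discriminant_kernel_def carrier_discriminant by blast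
    ultimately have "z \<odot> T v \<in> coset v" by blast
    then have "\<psi> (z \<odot> T v) - \<psi> v \<in> LL" by (simp add: coset_def)
    moreover have tv: "T v \<in> carrier V" using TV[of v v] v by simp
    ultimately have "fun_scale z (\<psi> (T v)) - \<psi> v \<in> LL" using c by (simp add: \<psi>_smult)
    then have "fun_scale (cnj z) (fun_scale z (\<psi> (T v)) - \<psi> v) \<in> LL"
      by (rule S.submod_scale[OF submod_LL c(1)])
    then have 1: "\<psi> (T v) - fun_scale (cnj z) (\<psi> v) \<in> LL"
      using z by (simp add: S.scale_right_diff_distrib)
    have 2: "\<psi> (T v) = \<psi> v + fun_scale (hh f (\<psi> e) / kappa d * q) (\<psi> e)"
      using Tq[of f] T'[of v] v by (simp add: VV_def)
    have "fun_scale (1 - cnj z) f + fun_scale (hh f (\<psi> e) / kappa d * q) (\<psi> e)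
        = \<psi> (T v) - fun_scale (cnj z) (\<psi> v)"
      unfolding 2 v(2) by (simp add: S.scale_left_diff_distrib)
    then show "fun_scale (1 - cnj z) f + fun_scale (hh f (\<psi> e) / kappa d * q) (\<psi> e) \<in> LL"
      using 1 by simp
  qed
qed

lemma twist_in_imp_trivial:
  assumes tw: "twist_in d V h I \<Gamma> z" and z: "z \<in> R" "cnj z * z = 1"
    and N: "cnj (1 - cnj z) * (1 - cnj z) = of_nat N" "squarefree N"
  shows "\<forall>v\<in>H.D. fun_scale (1 - cnj z) v \<in> LL"
proof -
  obtain q where q: "q \<in> \<rat>"
    "\<forall>v\<in>H.D. fun_scale (1 - cnj z) v + fun_scale (hh v (\<psi> e) / kappa d * q) (\<psi> e) \<in> LL"
    by (rule twist_inD[OF tw z])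
  have "1 - cnj z \<in> R" using R_cnj[OF z(1)] S.R_diff by simp
  from E.twist_imp_scalar_squarefree[OF q(1) this div_LL q(2) N] show ?thesis by blast
qed

text \<open>If a divisor \<open>a\<close> of 2 carries the dual lattice into \<open>L\<close>, so
  does 2. Besides \<open>a = 2\<close> this serves the twists by \<open>- rt (- 1)\<close> and
  \<open>- omega\<close>, where the contradiction is reached with \<open>- 1\<close>.\<close>

lemma minus_1_scalar:
  assumes "\<forall>v\<in>H.D. fun_scale a v \<in> LL" "2 = b * a" "b \<in> R"
  shows "scalar_in V \<Gamma> (- 1)"
proof (rule scalar_inI)
  show "- 1 \<in> R" using R_uminus[of 1] by simp
  have "fun_scale b (fun_scale a v) \<in> LL" if "v \<in> H.D" for v
    using assms(1,3) that by (intro S.submod_scale[OF submod_LL assms(3)]) blast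
  then show "\<forall>v\<in>H.D. fun_scale (1 - cnj (- 1)) v \<in> LL" using assms(2) by simp
qed simp

lemma irregular_2_structure:
  assumes "irregular_2 d V h I \<Gamma>"
  obtains m where "twisted fun_scale R (quad_set d) (kappa d) VV LL hh (\<psi> e) m"
    "c / (2 * kappa d) \<in> R" "2 * kappa d / c \<in> R" "c \<noteq> 0"
proof -
  have m1: "- 1 \<in> R" "cnj (- 1) * (- 1) = (1 :: complex)" using R_uminus[of 1] by simp_all
  have ns: "\<not> scalar_in V \<Gamma> (- 1)" and tw: "twist_in d V h I \<Gamma> (- 1)"
    using assms unfolding irregular_2_def by auto
  obtain q where q: "q \<in> \<rat>"
    "\<forall>v\<in>H.D. fun_scale (1 - cnj (- 1)) v + fun_scale (hh v (\<psi> e) / kappa d * q) (\<psi> e) \<in> LL"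
    by (rule twist_inD[OF tw m1])
  have q2: "\<forall>v\<in>H.D. fun_scale 2 v + fun_scale (hh v (\<psi> e) / kappa d * q) (\<psi> e) \<in> LL"
    using q(2) by simp
  have "\<not> (\<forall>v\<in>H.D. fun_scale 2 v \<in> LL)" using ns minus_1_scalar[of 2 1] by auto
  from E.twist_2[OF q(1) div_LL q2 this] obtain m :: int where m: "odd m" "q = of_int m / 2"
    "c / (2 * kappa d) \<in> R" "2 * kappa d / c \<in> R" by blast
  have "twisted fun_scale R (quad_set d) (kappa d) VV LL hh (\<psi> e) m"
    using m(1) q2[unfolded m(2)] by unfold_locales auto
  moreover have "2 \<in> R" by simp
  then have "c \<noteq> 0" by (rule E.twist_imp_scalar(2)[OF q(1) _ div_LL q2])
  ultimately show thesis using that m by blast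
qed

end

section \<open>The prime 2 in the individual fields\<close>

lemma square_mod_4: "(a :: int)\<^sup>2 mod 4 = (if even a then 0 else 1)"
proof (cases "even a")
  case True
  then obtain b where "a = 2 * b" by blast
  then show ?thesis by (simp add: power2_eq_square)
next
  case False
  then obtain b where "a = 2 * b + 1" by (auto elim: oddE)
  then have "a\<^sup>2 = 4 * (b\<^sup>2 + b) + 1" by (simp add: power2_eq_square algebra_simps)
  then show ?thesis using False by presburger
qed

lemma odd_square_mod_8:
  assumes "odd (a :: int)"
  shows "a\<^sup>2 mod 8 = 1"
proof -
  obtain b where "a = 2 * b + 1" using assms by (auto elim: oddE)
  then have "a\<^sup>2 = 4 * (b * (b + 1)) + 1" by (simp add: power2_eq_square algebra_simps)
  moreover have "even (b * (b + 1))" by simp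
  then obtain c where "b * (b + 1) = 2 * c" by blast
  ultimately have "a\<^sup>2 = 8 * c + 1" by simp
  then show ?thesis by presburger
qed

lemma ramified_rowsI:
  "c \<in> C \<Longrightarrow> (v, [(int a, \<eta>), (int b, \<eta>\<^sup>2), (1, \<eta> ^ c)]) \<in> ramified_rows v \<eta> C D"
  unfolding ramified_rows_def by blast

lemma inert_row:
  "(2 / rt d, [(int a, 2 :: complex), (1, 2\<^sup>2)]) \<in> {(2 / rt d, [(int a, 2), (1, 2 ^ c)]) | a c. c \<in> {0,2,3}}"
  by blast

context class_number_one
begin

lemma R_lin: "of_int a + of_int b * rt d \<in> R"
  using R_closed R_rt by simp

text \<open>For \<open>d = 4 * k + 1\<close> the element is a root of
  \<open>x\<^sup>2 = x + k\<close>.\<close>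

lemma R_half:
  assumes "d mod 4 = 1"
  shows "(1 + rt d) / 2 \<in> R"
proof -
  obtain k where k: "d = 4 * k + 1" using assms by (metis div_mult_mod_eq mult.commute)
  define r where "r = rt d"
  have r: "r * r = 4 * of_int k + 1" using rt_squared[of d] k by (simp add: r_def)
  have "of_rat (1 / 2) + of_rat (1 / 2) * r \<in> quad_set d" unfolding r_def by (rule quad_setI)
  moreover have "of_rat (1 / 2) + of_rat (1 / 2) * r = (1 + r) / 2"
    by (simp add: of_rat_divide add_divide_distrib)
  moreover have "((1 + r) / 2)\<^sup>2 = of_int 1 * ((1 + r) / 2) + of_int k"
    using r by (simp add: power2_eq_square field_simps)
  ultimately show ?thesis unfolding r_def[symmetric] using R_monic_quadratic by metis
qed

text \<open>The unit \<open>w\<close> records how the entry \<open>v\<close> of a table differs from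
  \<open>2 * kappa d\<close>.\<close>

lemma unit_equiv_2kappa:
  assumes "c / (2 * kappa d) \<in> R" "2 * kappa d / c \<in> R" "c \<noteq> 0"
    and w: "w \<in> R" "inverse w \<in> R" "w \<noteq> 0" "v = w * (2 * kappa d)"
  shows "unit_equiv d c v"
proof (rule unit_equivI)
  have "c / (2 * kappa d) * inverse w \<in> R" "2 * kappa d / c * w \<in> R" using assms R_closed(2) by blast+
  then show "c / v \<in> R" "v / c \<in> R" using w(4) by (simp_all add: field_simps)
  show "c \<noteq> 0" "v \<noteq> 0" using assms kappa_properties(2) by auto
qed

end

context class_one_lattice
begin

text \<open>Once the norm of \<open>r\<close> is odd, \<open>cnj r\<close> inverts \<open>r\<close>
  modulo 2. An even norm forces 2 to divide \<open>r\<close>: for odd \<open>A\<close> and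
  \<open>B\<close> and \<open>d\<close> congruent to 5, \<open>A\<^sup>2 - d * B\<^sup>2\<close> is
  4 modulo 8, while four times an even norm is 0.\<close>

lemma residue_inert:
  assumes d: "d mod 8 = 5" and r: "r \<in> R" "\<not> S.dvdR 2 r"
  shows "\<exists>s\<in>R. S.dvdR 2 (s * r - 1)"
proof -
  obtain N where N: "cnj r * r = of_int N" using norm_int[OF r(1)] by blast
  have "odd N"
  proof
    assume "even N"
    then obtain n where n: "N = 2 * n" by blast
    obtain A B where AB: "r = (of_int A + of_int B * rt d) / 2" using R_cases[OF r(1)] by blast
    have "cnj r = (of_int A - of_int B * rt d) / 2" using cnj_rt[OF d_neg] by (simp add: AB)
    then have "cnj r * r = (of_int A - of_int B * rt d) / 2 * ((of_int A + of_int B * rt d) / 2)"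
      using AB by (simp only:)
    also have "\<dots> = (of_int (A\<^sup>2 - d * B\<^sup>2)) / 4" by (simp add: power2_eq_square field_simps)
    finally have "cnj r * r = (of_int (A\<^sup>2 - d * B\<^sup>2)) / 4" .
    then have "(of_int (A\<^sup>2 - d * B\<^sup>2) :: complex) = of_int (8 * n)" using N n by simp
    then have eq: "A\<^sup>2 - d * B\<^sup>2 = 8 * n" by (simp only: of_int_eq_iff)
    have "odd d" using d by presburger
    have par: "even A \<longleftrightarrow> even B"
    proof -
      have "even (A\<^sup>2 - d * B\<^sup>2)" unfolding eq by simp
      then show ?thesis using \<open>odd d\<close> by simp
    qed
    have "even A"
    proof (rule ccontr)
      assume "odd A"
      then have "A\<^sup>2 mod 8 = 1" "B\<^sup>2 mod 8 = 1" using par odd_square_mod_8 by auto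
      then have "(A\<^sup>2 - d * B\<^sup>2) mod 8 = (1 - 5 * 1) mod 8" using d by (metis mod_diff_eq mod_mult_eq mod_mod_trivial)
      then show False unfolding eq by simp
    qed
    then obtain a b where ab: "A = 2 * a" "B = 2 * b" using par by (auto elim!: evenE)
    have "4 * (a\<^sup>2 - d * b\<^sup>2) = 8 * n" using eq unfolding ab by (simp add: power2_eq_square algebra_simps)
    then have "a\<^sup>2 - d * b\<^sup>2 = 2 * n" by simp
    then have "even (a\<^sup>2 - d * b\<^sup>2)" by simp
    then have "even (a - b)" using \<open>odd d\<close> by simp
    then obtain k where k: "a = b + 2 * k" by (metis add.commute diff_add_cancel evenE)
    have "r = 2 * (of_int k + of_int b * ((1 + rt d) / 2))"
      unfolding AB ab k by (simp add: field_simps)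
    moreover have "d mod 4 = 1" using d by presburger
    then have "of_int k + of_int b * ((1 + rt d) / 2) \<in> R"
      by (intro R_closed R_of_int R_half)
    ultimately show False using r(2) unfolding S.dvdR_def by blast
  qed
  then obtain n where n: "N = 2 * n + 1" by (auto elim: oddE)
  then have "cnj r * r - 1 = 2 * of_int n" using N by simp
  then have "S.dvdR 2 (cnj r * r - 1)" unfolding S.dvdR_def using R_of_int by blast
  then show ?thesis using R_cnj r(1) by blast
qed

text \<open>Squares are 0 or 1 modulo 4, so for \<open>d\<close> congruent to 2 or 3 the expression
  \<open>A\<^sup>2 - d * B\<^sup>2\<close> vanishes modulo 4 only for even \<open>A\<close> and
  \<open>B\<close>.\<close>

lemma integral_coordinates:
  assumes d: "d mod 4 = 2 \<or> d mod 4 = 3" and r: "r \<in> R"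
  obtains a b where "r = of_int a + of_int b * rt d"
proof -
  obtain A B where AB: "r = (of_int A + of_int B * rt d) / 2" "4 dvd A\<^sup>2 - d * B\<^sup>2"
    using R_cases[OF r] by blast
  have "(A\<^sup>2 mod 4 - d mod 4 * (B\<^sup>2 mod 4)) mod 4 = (A\<^sup>2 - d * B\<^sup>2) mod 4"
    by (intro mod_diff_cong mod_mult_cong) simp_all
  then have "(A\<^sup>2 mod 4 - d mod 4 * (B\<^sup>2 mod 4)) mod 4 = 0" using AB(2) by simp
  then have "even A" "even B" using d by (auto simp: square_mod_4 split: if_splits)
  then obtain a b where "A = 2 * a" "B = 2 * b" by (elim evenE)
  then have "r = of_int a + of_int b * rt d" by (simp add: AB)
  then show thesis by (rule that)
qed

text \<open>Modulo \<open>1 + rt d\<close> both \<open>rt d\<close> and 1 have the same class, so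
  the parity of \<open>a + b\<close> decides.\<close>

lemma residue_gaussian:
  assumes d: "d = - 1" and r: "r \<in> R"
  shows "S.dvdR (1 + rt d) r \<or> S.dvdR (1 + rt d) (r - 1)"
proof -
  obtain a b where r_eq: "r = of_int a + of_int b * rt d"
    by (rule integral_coordinates[OF _ r]) (simp_all add: d)
  have *: "S.dvdR (1 + rt d) (of_int a' + of_int b * rt d)" if ev: "even (a' + b)" for a'
  proof -
    obtain k where "a' + b = 2 * k" using ev by blast
    then have b: "b = 2 * k - a'" by simp
    \<comment> \<open>The cofactor is the explicit quotient by \<open>1 + rt d\<close>, with
      \<open>b = 2 * k - a'\<close> inserted.\<close>
    have "of_int a' + of_int b * rt d = (1 + rt d) * (of_int k + of_int (k - a') * rt d)"
      unfolding b using rt_squared[of d] d by (simp add: algebra_simps)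
    then show ?thesis unfolding S.dvdR_def using R_lin by blast
  qed
  have "even (a + b) \<or> even (a - 1 + b)" by presburger
  then show ?thesis using *[of a] *[of "a - 1"] unfolding r_eq by (auto simp: algebra_simps)
qed

lemma residue_sqrt_2:
  assumes d: "d = - 2" and r: "r \<in> R"
  shows "S.dvdR (rt d) r \<or> S.dvdR (rt d) (r - 1)"
proof -
  obtain a b where r_eq: "r = of_int a + of_int b * rt d"
    by (rule integral_coordinates[OF _ r]) (simp_all add: d)
  have *: "S.dvdR (rt d) (of_int a' + of_int b * rt d)" if ev: "even a'" for a'
  proof -
    obtain k where k: "a' = 2 * k" using ev by blast
    have "of_int a' + of_int b * rt d = rt d * (of_int b + of_int (- k) * rt d)"
      unfolding k using rt_squared[of d] d by (simp add: algebra_simps)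
    then show ?thesis unfolding S.dvdR_def using R_lin by blast
  qed
  have "even a \<or> even (a - 1)" by presburger
  then show ?thesis using *[of a] *[of "a - 1"] unfolding r_eq by (auto simp: algebra_simps)
qed

text \<open>The integers are the combinations \<open>a + b * x\<close>, and
  \<open>x * y = - 2\<close> makes even integers multiples of \<open>x\<close>; so the parity of
  \<open>a\<close> decides the class modulo \<open>x\<close>. The same holds for
  \<open>y\<close>.\<close>

lemma primes_sqrt_7:
  assumes d: "d = - 7" and x: "x = (1 + rt d) / 2" and y: "y = (- 1 + rt d) / 2"
  shows "x \<in> R" "y \<in> R" "x * y = - 2" "x - y = 1" "cnj x = - y" "cnj y = - x"
    "r \<in> R \<Longrightarrow> S.dvdR x r \<or> S.dvdR x (r - 1)" "r \<in> R \<Longrightarrow> S.dvdR y r \<or> S.dvdR y (r - 1)"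
    "\<not> S.dvdR x 1" "\<not> S.dvdR y 1"
proof -
  show xR: "x \<in> R" unfolding x by (rule R_half) (simp add: d)
  show xy: "x - y = 1" unfolding x y by (simp add: field_simps)
  have "x - 1 \<in> R" using xR S.R_diff by simp
  then show yR: "y \<in> R" using xy by (simp add: algebra_simps)
  define s where "s = rt d"
  have s: "s * s = - 7" using rt_squared[of d] by (simp add: s_def d)
  have xs: "x = (1 + s) / 2" "y = (- 1 + s) / 2" using x y by (simp_all only: s_def)
  show pr: "x * y = - 2" unfolding xs using s by (simp add: field_simps)
  have cs: "cnj s = - s" using cnj_rt[OF d_neg] by (simp only: s_def)
  show cx: "cnj x = - y" and cy: "cnj y = - x" unfolding xs using cs by (simp_all add: field_simps)
  have lin: "S.dvdR x r \<or> S.dvdR x (r - 1)" if "r = of_int a + of_int b * x" "y \<in> R" "x * y = - 2" for r x y a b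
  proof -
    have *: "S.dvdR x (of_int a' + of_int b * x)" if ev: "even a'" for a'
    proof -
      obtain k where k: "a' = 2 * k" using ev by blast
      have "x * (of_int b - of_int k * y) = of_int b * x - of_int k * (x * y)"
        by (simp add: algebra_simps)
      then have "of_int a' + of_int b * x = x * (of_int b - of_int k * y)"
        using \<open>x * y = - 2\<close> unfolding k by simp
      moreover have "of_int b - of_int k * y \<in> R" using S.R_diff R_closed(2) \<open>y \<in> R\<close> by simp
      ultimately show ?thesis unfolding S.dvdR_def by blast
    qed
    have "even a \<or> even (a - 1)" by presburger
    then show ?thesis using *[of a] *[of "a - 1"] unfolding that(1) by (auto simp: algebra_simps)
  qed
  have dec: "\<exists>a b. r = of_int a + of_int b * x" "\<exists>a b. r = of_int a + of_int b * y" if r: "r \<in> R" for r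
  proof -
    obtain A B where AB: "r = (of_int A + of_int B * s) / 2" "4 dvd A\<^sup>2 - d * B\<^sup>2"
      using R_cases[OF r] unfolding s_def by blast
    have "even (A\<^sup>2 - d * B\<^sup>2)" using AB(2) by presburger
    then have "even (A - B)" "even (A + B)" unfolding d by simp_all
    then obtain a a' where a: "A - B = 2 * a" "A + B = 2 * a'" by (elim evenE)
    have "r = of_int a + of_int B * x"
    proof -
      have "A = B + 2 * a" using a by simp
      show ?thesis unfolding AB(1) xs \<open>A = B + 2 * a\<close> by (simp add: field_simps)
    qed
    then show "\<exists>a b. r = of_int a + of_int b * x" by blast
    have "r = of_int a' + of_int B * y"
    proof -
      have "A = 2 * a' - B" using a by simp
      show ?thesis unfolding AB(1) xs \<open>A = 2 * a' - B\<close> by (simp add: field_simps)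
    qed
    then show "\<exists>a b. r = of_int a + of_int b * y" by blast
  qed
  show "S.dvdR x r \<or> S.dvdR x (r - 1)" if "r \<in> R" using dec(1)[OF that] lin yR pr by blast
  show "S.dvdR y r \<or> S.dvdR y (r - 1)" if "r \<in> R"
    using dec(2)[OF that] lin xR pr by (metis mult.commute)
  \<comment> \<open>Norms are multiplicative integers, so an element of norm 2 has no
    inverse.\<close>
  have nd: "\<not> S.dvdR p 1" if "cnj p * p = 2" for p
  proof
    assume "S.dvdR p 1"
    then obtain z where z: "z \<in> R" "1 = p * z" unfolding S.dvdR_def by blast
    obtain N where N: "cnj z * z = of_int N" using norm_int z by blast
    have "cnj 1 * 1 = cnj (p * z) * (p * z)" using z(2) by simp
    also have "\<dots> = (cnj p * p) * (cnj z * z)" by (simp add: algebra_simps)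
    finally have "(of_int 1 :: complex) = of_int (2 * N)" using that N by simp
    then have "1 = 2 * N" by (simp only: of_int_eq_iff)
    then show False by presburger
  qed
  show "\<not> S.dvdR x 1" "\<not> S.dvdR y 1"
    by (rule nd, use cx cy pr in \<open>simp add: mult.commute\<close>)+
qed

end

section \<open>Locating the divisor and the discriminant module in the tables\<close>

context class_one_isotropic
begin

lemma listedI:
  assumes "div_of d V h L I = c" and "(v, E) \<in> T" "unit_equiv d c v"
    and "iso_to_expr d (A\<^sub>L) E"
  shows "listed d V h L I T"
  unfolding listed_def using assms by blast

text \<open>One argument serves \<open>table_C1\<close> and \<open>table_E\<close>: both contain the
  modulus \<open>2\<^sup>2\<close> at the value \<open>2 / rt d\<close>, which is
  \<open>2 * kappa d\<close> when \<open>d mod 4 = 1\<close>.\<close>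

lemma inert_listed:
  assumes irr: "irregular_2 d V h I \<Gamma>" and c: "div_of d V h L I = c" and d: "d mod 8 = 5"
    and T: "\<And>a. (2 / rt d, [(int a, 2), (1, 2\<^sup>2)]) \<in> T"
  shows "listed d V h L I T"
proof -
  obtain m where tw: "twisted fun_scale R (quad_set d) (kappa d) VV LL hh (\<psi> e) m"
    and cR: "c / (2 * kappa d) \<in> R" "2 * kappa d / c \<in> R" "c \<noteq> 0" by (rule irregular_2_structure[OF irr])
  interpret W: twisted fun_scale R "quad_set d" "kappa d" VV LL hh "\<psi> e" m by (rule tw)
  obtain gs a where dec: "S.decomp (replicate a 2 @ [2\<^sup>2]) gs H.D LL"
    using W.decomp_inert residue_inert[OF d] by blast
  have "d mod 4 = 1" using d by presburger
  then have "2 / rt d = 1 * (2 * kappa d)" by (simp add: kappa_def)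
  from unit_equiv_2kappa[OF cR _ _ _ this] have "unit_equiv d c (2 / rt d)" by simp
  moreover have "iso_to_expr d (A\<^sub>L) [(int a, 2), (1, 2\<^sup>2)]"
    by (rule iso_to_exprI[where gs = gs]) (use dec in auto)
  ultimately show ?thesis using listedI[OF c T] by blast
qed

text \<open>\<open>u\<close> compares 2 with \<open>\<eta>\<^sup>2\<close>, and \<open>w\<close>
  compares the divisor in the table with \<open>2 * kappa d\<close>. The row is that of exponent 4,
  because 4 is \<open>\<eta> ^ 4\<close> up to a unit.\<close>

lemma ramified_listed:
  assumes irr: "irregular_2 d V h I \<Gamma>" and c: "div_of d V h L I = c"
    and \<eta>: "\<eta> \<in> R" "\<eta> \<noteq> 0" "\<And>x. x \<in> R \<Longrightarrow> S.dvdR \<eta> x \<or> S.dvdR \<eta> (x - 1)"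
    and u: "2 = u * \<eta>\<^sup>2" "u \<in> R" "inverse u \<in> R"
    and w: "w \<in> R" "inverse w \<in> R" "w \<noteq> 0" "v = w * (2 * kappa d)"
    and T: "\<And>a b. (v, [(int a, \<eta>), (int b, \<eta>\<^sup>2), (1, \<eta> ^ 4)]) \<in> T"
  shows "listed d V h L I T"
proof -
  obtain m where tw: "twisted fun_scale R (quad_set d) (kappa d) VV LL hh (\<psi> e) m"
    and cR: "c / (2 * kappa d) \<in> R" "2 * kappa d / c \<in> R" "c \<noteq> 0" by (rule irregular_2_structure[OF irr])
  interpret W: twisted fun_scale R "quad_set d" "kappa d" VV LL hh "\<psi> e" m by (rule tw)
  have "\<exists>s\<in>R. S.dvdR \<eta> (s * x - 1)" if "x \<in> R" "\<not> S.dvdR \<eta> x" for x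
    using \<eta>(3)[OF that(1)] that(2) by (intro bexI[of _ 1]) simp_all
  then obtain gs a b where dec: "S.decomp (replicate a \<eta> @ replicate b (\<eta>\<^sup>2) @ [\<eta> ^ 4]) gs H.D LL"
    using W.decomp_ramified[OF \<eta>(1,2) u] by blast
  have "iso_to_expr d (A\<^sub>L) [(int a, \<eta>), (int b, \<eta>\<^sup>2), (1, \<eta> ^ 4)]"
    by (rule iso_to_exprI[where gs = gs]) (use dec \<eta>(1) S.R_power[OF \<eta>(1)] in auto)
  then show ?thesis using listedI[OF c T unit_equiv_2kappa[OF cR w]] by blast
qed

text \<open>The square of \<open>1 + r\<close> is \<open>2 * r\<close>, whence
  \<open>u = - r\<close>; and \<open>2 * kappa d = 1 / r\<close> gives \<open>w = r\<close> for the
  value 1.\<close>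

lemma gaussian_listed:
  assumes irr: "irregular_2 d V h I \<Gamma>" and c: "div_of d V h L I = c" and d: "d = - 1"
  shows "listed d V h L I table_A1"
proof -
  define r where "r = rt (- 1)"
  have r: "r * r = - 1" using rt_squared[of "- 1"] by (simp add: r_def)
  have rR: "r \<in> R" "- r \<in> R" using R_rt d R_uminus by (simp_all only: r_def)
  have r0: "r \<noteq> 0" using r by auto
  have ri: "inverse r = - r" using r r0 by (simp add: field_simps)
  define \<eta> where "\<eta> = 1 + r"
  have eta: "\<eta> \<in> R" "\<eta>\<^sup>2 = 2 * r" unfolding \<eta>_def using rR R_closed r
    by (simp_all add: power2_eq_square algebra_simps)
  have eta0: "\<eta> \<noteq> 0" using eta(2) r0 by auto
  have "1 + rt d = \<eta>" by (simp add: \<eta>_def r_def d)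
  then have field: "S.dvdR \<eta> x \<or> S.dvdR \<eta> (x - 1)" if "x \<in> R" for x
    using residue_gaussian[OF d that] by simp
  have "- r * \<eta>\<^sup>2 = - 2 * (r * r)" unfolding eta(2) by (simp add: algebra_simps)
  then have u: "2 = - r * \<eta>\<^sup>2" using r by simp
  have "1 = r * (2 * kappa d)" using r0 by (simp add: kappa_def d r_def)
  moreover have "(1, [(int a, \<eta>), (int b, \<eta>\<^sup>2), (1, \<eta> ^ 4)]) \<in> table_A1" for a b
    unfolding table_A1_def Let_def r_def[symmetric] \<eta>_def[symmetric]
    using ramified_rowsI[of 4 "{3,4,5,6}" 1 a \<eta> b "{(3,3),(3,4),(3,5)}"] by (simp only: Un_iff simp_thms) simp
  ultimately show ?thesis
    using ramified_listed[OF irr c eta(1) eta0 field u rR(2) _ rR(1) _ r0] ri rR by simp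
qed

text \<open>Here \<open>r\<^sup>2 = - 2\<close> gives \<open>u = - 1\<close>, and the value
  \<open>1 / r\<close> is exactly \<open>2 * kappa d\<close>.\<close>

lemma sqrt_2_listed:
  assumes irr: "irregular_2 d V h I \<Gamma>" and c: "div_of d V h L I = c" and d: "d = - 2"
  shows "listed d V h L I table_B"
proof -
  define r where "r = rt (- 2)"
  have r: "r * r = - 2" using rt_squared[of "- 2"] by (simp add: r_def)
  have rR: "r \<in> R" using R_rt d by (simp only: r_def)
  have r0: "r \<noteq> 0" using r by auto
  have "rt d = r" by (simp add: r_def d)
  then have field: "S.dvdR r x \<or> S.dvdR r (x - 1)" if "x \<in> R" for x
    using residue_sqrt_2[OF d that] by simp
  have m1: "- 1 \<in> R" using R_uminus[of 1] by simp
  have u: "2 = - 1 * r\<^sup>2" using r by (simp add: power2_eq_square)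
  have "1 / r = 1 * (2 * kappa d)" by (simp add: kappa_def d r_def)
  moreover have "(1 / r, [(int a, r), (int b, r\<^sup>2), (1, r ^ 4)]) \<in> table_B" for a b
    unfolding table_B_def Let_def r_def[symmetric]
    using ramified_rowsI[of 4 "{3,4,5,6}" "1 / r" a r b "{(3,3),(3,4),(3,5)}"] by (simp only: Un_iff simp_thms) simp
  ultimately show ?thesis
    using ramified_listed[OF irr c rR r0 field u m1 _ R_numeral(2)] m1 by simp
qed

text \<open>Conjugation exchanges the two primes up to sign, so \<open>splitting\<close> holds in
  both directions. As \<open>x * y = - 2\<close>, the value \<open>x * y / rt (- 7)\<close> is
  \<open>- 2 * kappa d\<close>, and the row is the one with equal multiplicities
  \<open>a\<close>.\<close>

lemma sqrt_7_listed:
  assumes irr: "irregular_2 d V h I \<Gamma>" and c: "div_of d V h L I = c" and d: "d = - 7"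
  shows "listed d V h L I table_D"
proof -
  define x where "x = (1 + rt d) / 2"
  define y where "y = (- 1 + rt d) / 2"
  note p = primes_sqrt_7[OF d x_def y_def]
  obtain m where tw: "twisted fun_scale R (quad_set d) (kappa d) VV LL hh (\<psi> e) m"
    and cR: "c / (2 * kappa d) \<in> R" "2 * kappa d / c \<in> R" "c \<noteq> 0" by (rule irregular_2_structure[OF irr])
  interpret W: twisted fun_scale R "quad_set d" "kappa d" VV LL hh "\<psi> e" m by (rule tw)
  have "W.splitting x y" unfolding W.splitting_def
    by (intro conjI ballI p(1,2,3,5,9) p(7)) (use p(4) in simp)
  moreover have "y * x = - 2" using p(3) by (subst mult.commute)
  moreover have "y - x = - (x - y)" by simp
  then have "y - x = - 1" unfolding p(4) .
  ultimately have "W.splitting x y" "W.splitting y x" unfolding W.splitting_def[of y]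
    by (blast, intro conjI ballI p(1,2,6,10) p(8)) simp_all
  then obtain gs a where dec: "S.decomp (replicate a x @ replicate a y @ [x\<^sup>2, y\<^sup>2]) gs H.D LL"
    using W.decomp_split by blast
  have m1: "- 1 \<in> R" using R_uminus[of 1] by simp
  have "x * y / rt (- 7) = - 1 * (2 * kappa d)" using p(3) by (simp add: kappa_def d)
  then have "unit_equiv d c (x * y / rt (- 7))" using m1 by (intro unit_equiv_2kappa[OF cR, of "- 1"]) auto
  moreover have "iso_to_expr d (A\<^sub>L)
      [(int a, x), (int a, y), (1, x\<^sup>2), (1, y\<^sup>2)]"
    by (rule iso_to_exprI[where gs = gs]) (use dec p(1,2) S.R_power[OF p(1)] S.R_power[OF p(2)] in auto)
  moreover have "(x * y / rt (- 7), [(int a, x), (int a, y), (1, x\<^sup>2), (1, y\<^sup>2)]) \<in> table_D"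
  proof -
    have xy: "(1 + rt (- 7)) / 2 = x" "(- 1 + rt (- 7)) / 2 = y" by (simp_all only: x_def y_def d)
    have "[(int a, x), (int a, y), (1, x\<^sup>2), (1, y\<^sup>2)] \<in> both_exprs x y (int a)"
      unfolding both_exprs_def by simp
    then have "(x * y / rt (- 7), [(int a, x), (int a, y), (1, x\<^sup>2), (1, y\<^sup>2)])
        \<in> {(x * y / rt (- 7), N) | a N. N \<in> both_exprs x y (int a)}" by blast
    then show ?thesis unfolding table_D_def Let_def xy by (simp only: Un_iff simp_thms)
  qed
  ultimately show ?thesis using listedI[OF c] by blast
qed

text \<open>All the remaining types are vacuous: the twisting scalar itself lies in the discriminant
  kernel, because the norm of \<open>1 - cnj z\<close> is squarefree.\<close>

lemma irregular_gaussian_False: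
  assumes d: "d = - 1"
  shows "\<not> semi_irregular_2 d V h I \<Gamma>" "\<not> irregular_4 d V h I \<Gamma>"
proof -
  define r where "r = rt (- 1)"
  have r: "r * r = - 1" using rt_squared[of "- 1"] by (simp add: r_def)
  have rR: "r \<in> R" "- r \<in> R" using R_rt d R_uminus by (simp_all only: r_def)
  have cr: "cnj r = - r" using cnj_rt[of "- 1"] by (simp only: r_def)
  have sq: "squarefree (2 :: nat)" by (simp add: squarefree_prime)
  show "\<not> semi_irregular_2 d V h I \<Gamma>"
  proof
    assume "semi_irregular_2 d V h I \<Gamma>"
    then have "\<not> scalar_in V \<Gamma> r" "twist_in d V h I \<Gamma> r"
      unfolding semi_irregular_2_def r_def using d by auto
    \<comment> \<open>The norm of \<open>1 - cnj r = 1 + r\<close> is 2.\<close>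
    moreover have "\<forall>v\<in>H.D. fun_scale (1 - cnj r) v \<in> LL"
      by (rule twist_in_imp_trivial[OF _ rR(1) _ _ sq]) (use calculation cr r in \<open>auto simp: algebra_simps\<close>)
    moreover have "cnj r * r = 1" using cr r by simp
    ultimately show False using scalar_inI[OF rR(1)] by blast
  qed
  show "\<not> irregular_4 d V h I \<Gamma>"
  proof
    assume "irregular_4 d V h I \<Gamma>"
    then have "\<not> scalar_in V \<Gamma> (- 1)" "twist_in d V h I \<Gamma> (- r)"
      unfolding irregular_4_def r_def by auto
    moreover have "\<forall>v\<in>H.D. fun_scale (1 - cnj (- r)) v \<in> LL"
      by (rule twist_in_imp_trivial[OF _ rR(2) _ _ sq]) (use calculation cr r in \<open>auto simp: algebra_simps\<close>)
    \<comment> \<open>This type excludes the scalars \<open>- 1\<close> and \<open>r\<close> while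
      it twists by \<open>- r\<close>, so the contradiction goes through \<open>- 1\<close>: 2 is a
      multiple of \<open>1 - r\<close>.\<close>
    moreover have "2 = (1 + r) * (1 - cnj (- r))" using cr r by (simp add: algebra_simps)
    moreover have "1 + r \<in> R" using rR R_closed by simp
    ultimately show False using minus_1_scalar by blast
  qed
qed

text \<open>The norm of \<open>1 - cnj z\<close> is 3 for \<open>z = omega\<close> and 1 for
  \<open>z = - omega\<close>. In the second case it is a unit, so the dual lattice is
  \<open>L\<close> itself and \<open>- 1\<close> acts trivially on the quotient.\<close>

lemma irregular_eisenstein_False:
  assumes d: "d = - 3"
  shows "\<not> irregular_3 d V h I \<Gamma>" "\<not> irregular_6 d V h I \<Gamma>"
proof -
  note o = omega_properties
  have oR: "omega \<in> R" using R_monic_quadratic[of omega "- 1" "- 1"] o d by simp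
  have oo: "omega * omega = - 1 - omega" using o(2) by (simp add: power2_eq_square)
  show "\<not> irregular_3 d V h I \<Gamma>"
  proof
    assume "irregular_3 d V h I \<Gamma>"
    then have "\<not> scalar_in V \<Gamma> omega" "twist_in d V h I \<Gamma> omega"
      unfolding irregular_3_def by auto
    moreover have "squarefree (3 :: nat)" by (simp add: squarefree_prime)
    moreover have "cnj (1 - cnj omega) * (1 - cnj omega) = (1 - omega) * (2 + omega)"
      using o(3) by simp
    then have "cnj (1 - cnj omega) * (1 - cnj omega) = 2 - omega - omega * omega"
      by (simp only: algebra_simps) simp
    then have "cnj (1 - cnj omega) * (1 - cnj omega) = of_nat 3" unfolding oo by simp
    ultimately have "\<forall>v\<in>H.D. fun_scale (1 - cnj omega) v \<in> LL"
      using twist_in_imp_trivial[OF _ oR o(1)] by blast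
    then show False using \<open>\<not> scalar_in V \<Gamma> omega\<close> scalar_inI[OF oR o(1)] by blast
  qed
  show "\<not> irregular_6 d V h I \<Gamma>"
  proof
    assume "irregular_6 d V h I \<Gamma>"
    then have *: "\<not> scalar_in V \<Gamma> (- 1)" "twist_in d V h I \<Gamma> (- omega)"
      unfolding irregular_6_def by auto
    have \<alpha>: "1 - cnj (- omega) = - omega" using o(3) by simp
    have "cnj (1 - cnj (- omega)) * (1 - cnj (- omega)) = of_nat 1" unfolding \<alpha> using o(1) by simp
    then have "\<forall>v\<in>H.D. fun_scale (1 - cnj (- omega)) v \<in> LL"
      by (intro twist_in_imp_trivial[OF *(2) R_uminus[OF oR], where N = 1]) (use o in auto)
    moreover have "2 * (1 + omega) * (- omega) = - 2 * (omega + omega * omega)" by (simp add: algebra_simps)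
    then have "2 = (2 * (1 + omega)) * (1 - cnj (- omega))" unfolding \<alpha> oo by simp
    moreover have "2 * (1 + omega) \<in> R" using oR R_closed by simp
    ultimately show False using minus_1_scalar *(1) by blast
  qed
qed

end

theorem proposition1p4:
  fixes d :: int and n :: nat
    and V :: "(complex, 'v) module" and h :: "'v \<Rightarrow> 'v \<Rightarrow> complex"
    and L I :: "'v set" and \<Gamma> :: "('v \<Rightarrow> 'v) set"
  assumes "d < 0" and "squarefree d" and "class_number d = 1"
    and "hermitian_lattice d V h L" and "even_lattice h L"
    and "has_signature d V h 1 n" and "n > 1"
    and "primitive_isotropic_rank_one d V h L I"
    and "\<Gamma> = discriminant_kernel d V h L"
  shows "(d = -1 \<longrightarrow>
            (irregular_2 d V h I \<Gamma> \<longrightarrow> listed d V h L I table_A1) \<and>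
            (semi_irregular_2 d V h I \<Gamma> \<or> irregular_4 d V h I \<Gamma> \<longrightarrow> listed d V h L I table_A2)) \<and>
         (d = -2 \<longrightarrow> irregular_2 d V h I \<Gamma> \<longrightarrow> listed d V h L I table_B) \<and>
         (d = -3 \<longrightarrow>
            (irregular_2 d V h I \<Gamma> \<longrightarrow> listed d V h L I table_C1) \<and>
            (irregular_3 d V h I \<Gamma> \<longrightarrow> listed d V h L I table_C2) \<and>
            (irregular_6 d V h I \<Gamma> \<longrightarrow> listed d V h L I table_C3)) \<and>
         (d = -7 \<longrightarrow> irregular_2 d V h I \<Gamma> \<longrightarrow> listed d V h L I table_D) \<and>
         (d \<in> {-11, -19, -43, -67, -163} \<longrightarrow>
            irregular_2 d V h I \<Gamma> \<longrightarrow> listed d V h L I (table_E d))"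
proof -
  interpret class_one_lattice d V h L
    using assms by unfold_locales auto
  \<comment> \<open>The chosen value is meaningful only because a divisor exists; the generator
    \<open>e\<close> belonging to this very choice is fixed from here on.\<close>
  have "is_div d V h L I (div_of d V h L I)"
    unfolding div_of_def using exists_is_div[OF assms(8)] by (rule someI_ex)
  then obtain e where e: "e \<in> L" "I = {x \<odot>\<^bsub>V\<^esub> e | x. x \<in> R}"
    "{h l e | l. l \<in> L} = {x * div_of d V h L I | x. x \<in> R}"
    unfolding is_div_def R_def by blast
  interpret class_one_isotropic d V h L I e "div_of d V h L I"
    using assms(8) e by unfold_locales
  have E: "listed d V h L I (table_E d)" if "d \<in> {-11, -19, -43, -67, -163}" "irregular_2 d V h I \<Gamma>"
  proof (rule inert_listed[OF _ refl])
    show "irregular_2 d V h I (discriminant_kernel d V h L)" using that(2) assms(9) by simp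
    show "d mod 8 = 5" using that(1) by auto
    show "(2 / rt d, [(int a, 2), (1, 2\<^sup>2)]) \<in> table_E d" for a
      unfolding table_E_def Let_def using inert_row[of d a] by (simp only: Un_iff simp_thms)
  qed
  \<comment> \<open>Modulo 8, \<open>- 3\<close> is 5 like the values of \<open>d\<close> for
    \<open>table_E\<close>, so 2 is inert here too.\<close>
  have C: "listed d V h L I table_C1" if "d = - 3" "irregular_2 d V h I \<Gamma>"
  proof (rule inert_listed[OF _ refl])
    show "irregular_2 d V h I (discriminant_kernel d V h L)" using that(2) assms(9) by simp
    show "d mod 8 = 5" using that(1) by simp
    show "(2 / rt d, [(int a, 2), (1, 2\<^sup>2)]) \<in> table_C1" for a
      unfolding table_C1_def Let_def that(1) using inert_row[of "- 3" a] by (simp only: Un_iff simp_thms)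
  qed
  \<comment> \<open>The implications into \<open>table_A2\<close>, \<open>table_C2\<close> and
    \<open>table_C3\<close> hold because their premises are contradictory.\<close>
  show ?thesis
    using E C gaussian_listed[OF _ refl] sqrt_2_listed[OF _ refl] sqrt_7_listed[OF _ refl]
      irregular_gaussian_False irregular_eisenstein_False unfolding assms(9) by blast
qed

end
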